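(* Let $\mathcal{F}\subset\partial_P\Omega$ be the collection of all non-singleton prime ends of $\Omega$ together with all rectifiably inaccessible singleton prime ends of $\Omega$, i.e. $\mathcal{F}=\partial_P\Omega\setminus\partial_{RSP}\Omega$. Then $\overline{C}^P_p(\mathcal{F})=0$.
   Context: Standing assumptions: $1<p<\infty$; $(X,d,\mu)$ is a complete metric measure space, $\mu$ is a doubling Radon measure ($0<\mu(B(x,2r))\le C\mu(B(x,r))<\infty$), and $X$ supports a $p$-Poincaré inequality; consequently $X$ is proper and quasiconvex (any two points are joined by a rectifiable curve of length at most a constant times their distance), so every domain in $X$ is rectifiably connected. $\Omega\subsetneq X$ is a bounded domain with $C_p(X\setminus\Omega)>0$, satisfying the following assumption: every collection of ends of $\Omega$ that is totally ordered by division has a lower bound, i.e. there is an end dividing every member of the collection. Prime ends: The Mazurkiewicz metric on $\Omega$ is $d_M(x,y)=\inf\operatorname{diam}(E)$, the infimum over compact connected $E\subset\Omega$ containing $x,y$; $\operatorname{dist}_M(A,K)=\inf\{d_M(x,y):x\in A,y\in K\}$. An acceptable set is a connected set $E\subsetneq\Omega$ with $\overline E\cap\partial\Omega\neq\emptyset$. A chain is a sequence $\{E_k\}_{k\ge1}$ of acceptable sets with $E_{k+1}\subset E_k$, $\operatorname{dist}_M(\Omega\cap\partial E_{k+1},\Omega\cap\partial E_k)>0$ for all $k$, and impression $\bigcap_k\overline{E_k}\subset\partial\Omega$. A chain $\{E_k\}$ divides $\{F_k\}$ if for each $k$ there is $l_k$ with $E_{l_k}\subset F_k$; two chains are equivalent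 if each divides the other; an end $[E_k]$ is an equivalence class, and its impression $I[E_k]$ is the impression of any representative. Division induces a partial order on ends; a prime end is an end not divisible by any other end. $\partial_P\Omega$ is the set of prime ends, $\partial_{SP}\Omega$ the set of prime ends with singleton impression, and $\overline\Omega^P=\Omega\cup\partial_P\Omega$. A sequence $(x_n)$ in $\Omega$ converges to $[E_k]$ if for every $k$, $x_n\in E_k$ for all sufficiently large $n$. The prime end topology on $\overline\Omega^P$ has basis $\{G,G^P: G\subset\Omega\text{ open}\}$, where $G^P=G\cup\{[E_k]\in\partial_P\Omega:E_n\subset G\text{ for some }n\}$; limits $\lim_{\Omega\ni y\to x}$ and $\liminf_{\Omega\ni y\to x}$ for $x\in\partial_P\Omega$ are taken with respect to this topology. Classification: A prime end $[E_k]\in\partial_{SP}\Omega$ is rectifiably accessible if there is a rectifiable curve $\gamma:[0,1]\to X$ with $\gamma([0,1))\subset\Omega$, $\{\gamma(1)\}=I[E_k]$, and for each $k$ some $t_k\in(0,1)$ with $\gamma((t_k,1))\subset E_k$; otherwise it is rectifiably inaccessible. $\partial_{RSP}\Omega$ denotes the set of rectifiably accessible prime ends. Sobolev notions: A nonnegative Borel $g$ is an upper gradient of $u$ on an open set $U$ if $|u(x)-u(y)|\le\int_\gamma g\,ds$ for every nonconstant rectifiable curve $\gamma$ in $U$ with endpoints $x,y$. $N^{1,p}(U)$ is the space of measurable $u$ with $\|u\|_{N^{1,p}(U)}^p=\int_U|u|^p\,d\mu+\inf_g\int_U g^p\,d\mu<\infty$ (infimum over upper gradients in $U$), modulo functions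 of zero norm. The Sobolev capacity of $E\subset X$ is $C_p(E)=\inf\|u\|^p_{N^{1,p}(X)}$ over $u\in N^{1,p}(X)$ with $u\ge1$ on $E$. The prime end capacity of $E\subset\overline\Omega^P$ is $\overline{C}^P_p(E)=\inf\|u\|^p_{N^{1,p}(\Omega)}$ over all $u\in N^{1,p}(\Omega)$ with $u\ge1$ on $E\cap\Omega$ and $\liminf_{\Omega\ni y\to x}u(y)\ge1$ for all $x\in E\cap\partial_P\Omega$. *)

theory Defs
  imports "HOL-Analysis.Analysis"
begin

text \<open>The space X is the whole type 'a (a complete metric space); mu is a Borel
measure on it.  Functions are measured with respect to the completion of mu.\<close>

definition doubling_measure :: "'a::metric_space measure \<Rightarrow> bool" where
  "doubling_measure \<mu> \<longleftrightarrow> sets \<mu> = sets borel \<and>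
     (\<exists>C::real. \<forall>x r. r > 0 \<longrightarrow>
        0 < emeasure \<mu> (ball x (2*r)) \<and>
        emeasure \<mu> (ball x (2*r)) \<le> ennreal C * emeasure \<mu> (ball x r) \<and>
        emeasure \<mu> (ball x r) < \<infinity>)"

definition curve_length :: "(real \<Rightarrow> 'a::metric_space) \<Rightarrow> real \<Rightarrow> real \<Rightarrow> ennreal" where
  "curve_length \<gamma> a b =
     (SUP (n, t) \<in> {(n::nat, t::nat \<Rightarrow> real). t 0 = a \<and> t n = b \<and> (\<forall>i<n. t i \<le> t (Suc i))}.
        (\<Sum>i<n. ennreal (dist (\<gamma> (t i)) (\<gamma> (t (Suc i))))))"

definition rectifiable_curve :: "(real \<Rightarrow> 'a::metric_space) \<Rightarrow> bool" where
  "rectifiable_curve \<gamma> \<longleftrightarrow> continuous_on {0..1} \<gamma> \<and> curve_length \<gamma> 0 1 < \<infinity>"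

definition length_fun :: "(real \<Rightarrow> 'a::metric_space) \<Rightarrow> real \<Rightarrow> real" where
  "length_fun \<gamma> t = enn2real (curve_length \<gamma> 0 (min 1 (max 0 t)))"

definition line_integral :: "(real \<Rightarrow> 'a::metric_space) \<Rightarrow> ('a \<Rightarrow> ennreal) \<Rightarrow> ennreal" where
  "line_integral \<gamma> g = (\<integral>\<^sup>+ t. g (\<gamma> t) * indicator {0..1} t \<partial>interval_measure (length_fun \<gamma>))"

definition upper_gradient :: "'a::metric_space set \<Rightarrow> ('a \<Rightarrow> real) \<Rightarrow> ('a \<Rightarrow> ennreal) \<Rightarrow> bool" where
  "upper_gradient U u g \<longleftrightarrow> g \<in> borel_measurable borel \<and>
     (\<forall>\<gamma>. rectifiable_curve \<gamma> \<and> \<gamma> ` {0..1} \<subseteq> U \<and> (\<exists>s\<in>{0..1}. \<gamma> s \<noteq> \<gamma> 0) \<longrightarrow>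
        ennreal \<bar>u (\<gamma> 0) - u (\<gamma> 1)\<bar> \<le> line_integral \<gamma> g)"

definition epow :: "ennreal \<Rightarrow> real \<Rightarrow> ennreal" where
  "epow a p = (if a = \<infinity> then \<infinity> else ennreal (enn2real a powr p))"

definition N1p_normp :: "real \<Rightarrow> 'a::metric_space measure \<Rightarrow> 'a set \<Rightarrow> ('a \<Rightarrow> real) \<Rightarrow> ennreal" where
  "N1p_normp p \<mu> U u =
     (\<integral>\<^sup>+ x\<in>U. ennreal (\<bar>u x\<bar> powr p) \<partial>completion \<mu>) +
     (INF g\<in>{g. upper_gradient U u g}. \<integral>\<^sup>+ x\<in>U. epow (g x) p \<partial>completion \<mu>)"

definition in_N1p :: "real \<Rightarrow> 'a::metric_space measure \<Rightarrow> 'a set \<Rightarrow> ('a \<Rightarrow> real) \<Rightarrow> bool" where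
  "in_N1p p \<mu> U u \<longleftrightarrow>
     (\<lambda>x. u x * indicator U x) \<in> borel_measurable (completion \<mu>) \<and>
     N1p_normp p \<mu> U u < \<infinity>"

definition sobolev_cap :: "real \<Rightarrow> 'a::metric_space measure \<Rightarrow> 'a set \<Rightarrow> ennreal" where
  "sobolev_cap p \<mu> E = (INF u\<in>{u. in_N1p p \<mu> UNIV u \<and> (\<forall>x\<in>E. u x \<ge> 1)}. N1p_normp p \<mu> UNIV u)"

definition poincare :: "real \<Rightarrow> 'a::metric_space measure \<Rightarrow> bool" where
  "poincare p \<mu> \<longleftrightarrow> (\<exists>C::real. \<exists>lam::real. C > 0 \<and> lam \<ge> 1 \<and>
     (\<forall>x r u g. r > 0 \<longrightarrow> (\<forall>y s. set_integrable (completion \<mu>) (ball y s) u) \<longrightarrow>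
        upper_gradient UNIV u g \<longrightarrow>
        (\<integral>\<^sup>+ y\<in>ball x (lam*r). epow (g y) p \<partial>completion \<mu>) < \<infinity> \<longrightarrow>
        (let uB = (\<integral>y\<in>ball x r. u y \<partial>completion \<mu>) / measure \<mu> (ball x r) in
          (\<integral>y\<in>ball x r. \<bar>u y - uB\<bar> \<partial>completion \<mu>) / measure \<mu> (ball x r)
          \<le> C * r * (enn2real (\<integral>\<^sup>+ y\<in>ball x (lam*r). epow (g y) p \<partial>completion \<mu>)
                        / measure \<mu> (ball x (lam*r))) powr (1/p))))"

definition mazurkiewicz :: "'a::metric_space set \<Rightarrow> 'a \<Rightarrow> 'a \<Rightarrow> real" where
  "mazurkiewicz \<Omega> x y = Inf {diameter E | E. compact E \<and> connected E \<and> E \<subseteq> \<Omega> \<and> x \<in> E \<and> y \<in> E}"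

definition dist_M :: "'a::metric_space set \<Rightarrow> 'a set \<Rightarrow> 'a set \<Rightarrow> real" where
  "dist_M \<Omega> A K = Inf {mazurkiewicz \<Omega> x y | x y. x \<in> A \<and> y \<in> K}"

definition acceptable :: "'a::metric_space set \<Rightarrow> 'a set \<Rightarrow> bool" where
  "acceptable \<Omega> E \<longleftrightarrow> connected E \<and> E \<subset> \<Omega> \<and> closure E \<inter> frontier \<Omega> \<noteq> {}"

definition pe_chain :: "'a::metric_space set \<Rightarrow> (nat \<Rightarrow> 'a set) \<Rightarrow> bool" where
  "pe_chain \<Omega> E \<longleftrightarrow> (\<forall>k. acceptable \<Omega> (E k)) \<and> (\<forall>k. E (Suc k) \<subseteq> E k) \<and>
     (\<forall>k. dist_M \<Omega> (\<Omega> \<inter> frontier (E (Suc k))) (\<Omega> \<inter> frontier (E k)) > 0) \<and>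
     (\<Inter>k. closure (E k)) \<subseteq> frontier \<Omega>"

definition chain_divides :: "(nat \<Rightarrow> 'a set) \<Rightarrow> (nat \<Rightarrow> 'a set) \<Rightarrow> bool" where
  "chain_divides E F \<longleftrightarrow> (\<forall>k. \<exists>l. E l \<subseteq> F k)"

definition chain_equiv :: "(nat \<Rightarrow> 'a set) \<Rightarrow> (nat \<Rightarrow> 'a set) \<Rightarrow> bool" where
  "chain_equiv E F \<longleftrightarrow> chain_divides E F \<and> chain_divides F E"

definition pe_ends :: "'a::metric_space set \<Rightarrow> (nat \<Rightarrow> 'a set) set set" where
  "pe_ends \<Omega> = {{F. pe_chain \<Omega> F \<and> chain_equiv E F} | E. pe_chain \<Omega> E}"

definition end_divides :: "(nat \<Rightarrow> 'a set) set \<Rightarrow> (nat \<Rightarrow> 'a set) set \<Rightarrow> bool" where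
  "end_divides e f \<longleftrightarrow> (\<exists>E\<in>e. \<exists>F\<in>f. chain_divides E F)"

definition impression :: "(nat \<Rightarrow> 'a::topological_space set) set \<Rightarrow> 'a set" where
  "impression e = (\<Inter>k. closure ((SOME E. E \<in> e) k))"

definition prime_ends :: "'a::metric_space set \<Rightarrow> (nat \<Rightarrow> 'a set) set set" where
  "prime_ends \<Omega> = {e \<in> pe_ends \<Omega>. \<forall>f\<in>pe_ends \<Omega>. end_divides f e \<longrightarrow> f = e}"

definition singleton_prime_ends :: "'a::metric_space set \<Rightarrow> (nat \<Rightarrow> 'a set) set set" where
  "singleton_prime_ends \<Omega> = {e \<in> prime_ends \<Omega>. \<exists>x. impression e = {x}}"

definition rect_accessible_prime_ends :: "'a::metric_space set \<Rightarrow> (nat \<Rightarrow> 'a set) set set" where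
  "rect_accessible_prime_ends \<Omega> = {e \<in> singleton_prime_ends \<Omega>.
     \<exists>\<gamma> E. E \<in> e \<and> rectifiable_curve \<gamma> \<and> \<gamma> ` {0..<1} \<subseteq> \<Omega> \<and> impression e = {\<gamma> 1} \<and>
        (\<forall>k. \<exists>t\<in>{0<..<1}. \<gamma> ` {t<..<1} \<subseteq> E k)}"

definition ends_chains_bounded :: "'a::metric_space set \<Rightarrow> bool" where
  "ends_chains_bounded \<Omega> \<longleftrightarrow>
     (\<forall>S. S \<subseteq> pe_ends \<Omega> \<and> S \<noteq> {} \<and> (\<forall>e\<in>S. \<forall>f\<in>S. end_divides e f \<or> end_divides f e) \<longrightarrow>
        (\<exists>g\<in>pe_ends \<Omega>. \<forall>e\<in>S. end_divides g e))"

text \<open>Neighbourhood filter (restricted to Omega) of a prime end in the prime end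
  topology: generated by the open sets G of Omega with E n contained in G for some n.\<close>
definition pe_nhds :: "'a::metric_space set \<Rightarrow> (nat \<Rightarrow> 'a set) set \<Rightarrow> 'a filter" where
  "pe_nhds \<Omega> e = (INF G\<in>{G. open G \<and> G \<subseteq> \<Omega> \<and> (\<exists>E\<in>e. \<exists>n. E n \<subseteq> G)}. principal G)"

definition pe_cap :: "real \<Rightarrow> 'a::metric_space measure \<Rightarrow> 'a set \<Rightarrow> (nat \<Rightarrow> 'a set) set set \<Rightarrow> ennreal" where
  "pe_cap p \<mu> \<Omega> F = (INF u\<in>{u. in_N1p p \<mu> \<Omega> u \<and>
        (\<forall>e\<in>F. Liminf (pe_nhds \<Omega> e) (\<lambda>y. ereal (u y)) \<ge> 1)}. N1p_normp p \<mu> \<Omega> u)"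

end

theory Submission
  imports Defs
begin

text \<open>
  Let \<open>d\<close> be the distance to the complement of \<open>\<Omega>\<close>. Since the boundary strips \<open>{x \<in> \<Omega>. d x < r}\<close>
  have measure tending to 0, there is a weight \<open>h (d x)\<close> in \<open>L\<^sup>p \<Omega>\<close> that blows up at the boundary.
  Let \<open>U x\<close> be the least weighted length of a curve in \<open>\<Omega>\<close> from a base point to \<open>x\<close>. The functions
  \<open>min 1 (U / n)\<close> have upper gradient a constant multiple of \<open>h (d x) / n\<close> and tend to 0 in \<open>N\<^sup>1\<^sup>p\<close>, so it
  suffices that \<open>U\<close> tends to infinity at every prime end that is not rectifiably accessible. If \<open>U\<close> stays bounded
  along points approaching a prime end \<open>[E k]\<close>, there are curves of bounded length that reach
  \<open>E n\<close> and spend only a short time near the boundary. They need a definite time to pass from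
  \<open>E k\<close> to \<open>E (k + 1)\<close>, so they visit there a fixed compact subset of \<open>\<Omega>\<close>; limits of the visited
  points can be joined to a single rectifiable curve that ends at the prime end. The components of
  \<open>\<Omega>\<close> intersected with small balls around its endpoint form an end dividing \<open>[E k]\<close>, hence equal to it.
\<close>

subsection \<open>Length of curves\<close>

definition interval_partition :: "real \<Rightarrow> real \<Rightarrow> nat \<Rightarrow> (nat \<Rightarrow> real) \<Rightarrow> bool" where
  "interval_partition a b n t \<longleftrightarrow> t 0 = a \<and> t n = b \<and> (\<forall>i<n. t i \<le> t (Suc i))"

definition polygonal_length :: "(real \<Rightarrow> 'a::metric_space) \<Rightarrow> nat \<Rightarrow> (nat \<Rightarrow> real) \<Rightarrow> ennreal" where
  "polygonal_length \<gamma> n t = (\<Sum>i<n. ennreal (dist (\<gamma> (t i)) (\<gamma> (t (Suc i)))))"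

lemma curve_length_eq_SUP:
  "curve_length \<gamma> a b = (SUP (n, t) \<in> {(n, t). interval_partition a b n t}. polygonal_length \<gamma> n t)"
  unfolding curve_length_def interval_partition_def polygonal_length_def ..

lemma polygonal_length_le_curve_length:
  "interval_partition a b n t \<Longrightarrow> polygonal_length \<gamma> n t \<le> curve_length \<gamma> a b"
  unfolding curve_length_eq_SUP by (rule SUP_upper2[of "(n, t)"]) auto

lemma curve_length_leI:
  assumes "\<And>n t. interval_partition a b n t \<Longrightarrow> polygonal_length \<gamma> n t \<le> B"
  shows "curve_length \<gamma> a b \<le> B"
  unfolding curve_length_eq_SUP by (rule SUP_least) (use assms in auto)

lemma interval_partition_mono:
  assumes "interval_partition a b n t" "i \<le> j" "j \<le> n"
  shows "t i \<le> t j"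
  using assms(2,3)
proof (induction j rule: dec_induct)
  case (step j)
  moreover from step have "t j \<le> t (Suc j)"
    using assms(1) by (simp add: interval_partition_def)
  ultimately show ?case by simp
qed simp

lemma interval_partition_bounds:
  assumes "interval_partition a b n t" "i \<le> n"
  shows "a \<le> t i" "t i \<le> b"
  using interval_partition_mono[OF assms(1), of 0 i] interval_partition_mono[OF assms(1), of i n] assms
  by (auto simp: interval_partition_def)

lemma interval_partition_endpoints:
  "a \<le> b \<Longrightarrow> interval_partition a b 1 (\<lambda>i. if i = 0 then a else b)"
  by (simp add: interval_partition_def)

lemma interval_partition_clamp:
  assumes "interval_partition a b n t" "a \<le> s" "s \<le> b"
  shows "interval_partition a s n (\<lambda>i. min s (t i))" "interval_partition s b n (\<lambda>i. max s (t i))"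
  using assms unfolding interval_partition_def by fastforce+

lemma dist_le_curve_length: "a \<le> b \<Longrightarrow> ennreal (dist (\<gamma> a) (\<gamma> b)) \<le> curve_length \<gamma> a b"
  using polygonal_length_le_curve_length[OF interval_partition_endpoints, of a b \<gamma>]
  by (simp add: polygonal_length_def)

lemma polygonal_length_append:
  assumes t: "interval_partition a s n t" and t': "interval_partition s b m t'"
  shows "polygonal_length \<gamma> n t + polygonal_length \<gamma> m t' \<le> curve_length \<gamma> a b"
proof -
  define r where "r i = (if i \<le> n then t i else t' (i - n))" for i
  have r: "r i = t i" "r (n + j) = t' j" if "i \<le> n" for i j
    using t t' that by (auto simp: r_def interval_partition_def)
  have "r i \<le> r (Suc i)" if "i < n + m" for i
    using that t t' r(1)[of i] r(1)[of "Suc i"] r(2)[of 0 "i - n"] r(2)[of 0 "Suc i - n"]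
    by (cases "i < n") (auto simp: interval_partition_def Suc_diff_le)
  then have "interval_partition a b (n + m) r"
    using t t' r(1)[of 0] r(2)[of 0 m] by (auto simp: interval_partition_def)
  moreover have "polygonal_length \<gamma> (n + j) r = polygonal_length \<gamma> n t + polygonal_length \<gamma> j t'" for j
  proof (induction j)
    case 0
    then show ?case using r(1) by (simp add: polygonal_length_def)
  next
    case (Suc j)
    then show ?case using r(2)[of 0 j] r(2)[of 0 "Suc j"] by (simp add: polygonal_length_def ac_simps)
  qed
  ultimately show ?thesis by (metis polygonal_length_le_curve_length)
qed

lemma polygonal_length_add_curve_length_le:
  assumes "interval_partition a s n t" "s \<le> b"
  shows "polygonal_length \<gamma> n t + curve_length \<gamma> s b \<le> curve_length \<gamma> a b"
proof -
  have "{(n, t). interval_partition s b n t} \<noteq> {}"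
    using interval_partition_endpoints[OF assms(2)] by blast
  then show ?thesis
    unfolding curve_length_eq_SUP[of \<gamma> s b]
    by (subst ennreal_SUP_add_right) (auto intro!: SUP_least polygonal_length_append[OF assms(1)])
qed

lemma curve_length_add_le:
  assumes "a \<le> s" "s \<le> b"
  shows "curve_length \<gamma> a s + curve_length \<gamma> s b \<le> curve_length \<gamma> a b"
proof -
  have "{(n, t). interval_partition a s n t} \<noteq> {}"
    using interval_partition_endpoints[OF assms(1)] by blast
  then show ?thesis
    unfolding curve_length_eq_SUP[of \<gamma> a s]
    by (subst ennreal_SUP_add_left[symmetric])
      (auto intro!: SUP_least polygonal_length_add_curve_length_le[OF _ assms(2)])
qed

lemma polygonal_length_le_clamp:
  fixes \<gamma> :: "real \<Rightarrow> 'a::metric_space"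
  assumes t: "interval_partition a b n t"
  shows "polygonal_length \<gamma> n t \<le>
    polygonal_length \<gamma> n (\<lambda>i. min s (t i)) + polygonal_length \<gamma> n (\<lambda>i. max s (t i))"
  unfolding polygonal_length_def sum.distrib[symmetric]
proof (rule sum_mono)
  fix i assume "i \<in> {..<n}"
  then consider "t (Suc i) \<le> s" "t i \<le> s" | "s \<le> t i" "s \<le> t (Suc i)" | "t i \<le> s" "s \<le> t (Suc i)"
    using t unfolding interval_partition_def by force
  then show "ennreal (dist (\<gamma> (t i)) (\<gamma> (t (Suc i)))) \<le>
      ennreal (dist (\<gamma> (min s (t i))) (\<gamma> (min s (t (Suc i))))) +
      ennreal (dist (\<gamma> (max s (t i))) (\<gamma> (max s (t (Suc i)))))"
    by cases (simp_all add: min_def max_def dist_triangle flip: ennreal_plus)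
qed

lemma curve_length_add:
  assumes "a \<le> s" "s \<le> b"
  shows "curve_length \<gamma> a b = curve_length \<gamma> a s + curve_length \<gamma> s b"
proof (rule antisym[OF curve_length_leI curve_length_add_le[OF assms]])
  fix n t assume t: "interval_partition a b n t"
  show "polygonal_length \<gamma> n t \<le> curve_length \<gamma> a s + curve_length \<gamma> s b"
    using interval_partition_clamp[OF t assms]
    by (intro order_trans[OF polygonal_length_le_clamp[OF t, of \<gamma> s]] add_mono
      polygonal_length_le_curve_length)
qed

lemma polygonal_length_le_first_chord:
  assumes "s < b" "interval_partition s b n t"
  shows "\<exists>c>s. c \<le> b \<and> polygonal_length \<gamma> n t \<le> ennreal (dist (\<gamma> s) (\<gamma> c)) + curve_length \<gamma> c b"
  using assms
proof (induction n arbitrary: t)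
  case (Suc n)
  have t1: "s \<le> t 1" "t 1 \<le> b"
    using interval_partition_bounds[OF Suc.prems(2), of 1] by auto
  have split: "polygonal_length \<gamma> (Suc n) t =
      ennreal (dist (\<gamma> s) (\<gamma> (t 1))) + polygonal_length \<gamma> n (\<lambda>i. t (Suc i))"
    using Suc.prems(2) unfolding polygonal_length_def sum.lessThan_Suc_shift
    by (simp add: interval_partition_def)
  have tail: "interval_partition (t 1) b n (\<lambda>i. t (Suc i))"
    using Suc.prems(2) by (simp add: interval_partition_def)
  show ?case
  proof (cases "s < t 1")
    case True
    then show ?thesis
      unfolding split using t1 tail
      by (intro exI[of _ "t 1"]) (auto intro: add_left_mono polygonal_length_le_curve_length)
  next
    case False
    then have "t 1 = s" using t1 by simp
    then show ?thesis
      unfolding split using Suc.IH[of "\<lambda>i. t (Suc i)"] tail Suc.prems(1) by simp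
  qed
qed (simp add: interval_partition_def)

lemma curve_length_le_dist_add:
  assumes "s < b" "curve_length \<gamma> s b < \<infinity>" "0 < e"
  shows "\<exists>c>s. c \<le> b \<and>
    (\<forall>d. s < d \<longrightarrow> d \<le> c \<longrightarrow> curve_length \<gamma> s d \<le> ennreal (dist (\<gamma> s) (\<gamma> d)) + ennreal e)"
proof -
  let ?P = "{(n, t). interval_partition s b n t}"
  have "?P \<noteq> {}" using interval_partition_endpoints[of s b] assms(1) by auto
  then have "\<exists>i\<in>?P. curve_length \<gamma> s b < (case i of (n, t) \<Rightarrow> polygonal_length \<gamma> n t) + ennreal e"
    by (rule SUP_approx_ennreal[OF assms(3) _ curve_length_eq_SUP]) (use assms(2) in simp)
  then obtain n t where t: "interval_partition s b n t"
    and approx: "curve_length \<gamma> s b < polygonal_length \<gamma> n t + ennreal e" by auto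
  obtain c where c: "s < c" "c \<le> b"
    "polygonal_length \<gamma> n t \<le> ennreal (dist (\<gamma> s) (\<gamma> c)) + curve_length \<gamma> c b"
    using polygonal_length_le_first_chord[OF assms(1) t] by blast
  have "curve_length \<gamma> s d \<le> ennreal (dist (\<gamma> s) (\<gamma> d)) + ennreal e" if d: "s < d" "d \<le> c" for d
  proof -
    have "curve_length \<gamma> d b + curve_length \<gamma> s d \<le> polygonal_length \<gamma> n t + ennreal e"
      using approx d c(2) curve_length_add[of s d b \<gamma>] by (simp add: add.commute less_imp_le)
    also have "\<dots> \<le> ennreal (dist (\<gamma> s) (\<gamma> c)) + curve_length \<gamma> c b + ennreal e"
      by (intro add_right_mono c(3))
    also have "ennreal (dist (\<gamma> s) (\<gamma> c)) \<le> ennreal (dist (\<gamma> s) (\<gamma> d)) + ennreal (dist (\<gamma> d) (\<gamma> c))"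
      by (simp add: dist_triangle flip: ennreal_plus)
    also have "ennreal (dist (\<gamma> d) (\<gamma> c)) \<le> curve_length \<gamma> d c"
      using d by (intro dist_le_curve_length)
    finally have "curve_length \<gamma> d b + curve_length \<gamma> s d \<le>
        curve_length \<gamma> d b + (ennreal (dist (\<gamma> s) (\<gamma> d)) + ennreal e)"
      using d c(2) curve_length_add[of d c b \<gamma>] by (simp add: add_mono ac_simps)
    moreover have "curve_length \<gamma> d b < \<infinity>"
      using assms(2) d c(2) curve_length_add[of s d b \<gamma>] by (simp add: less_top)
    ultimately show ?thesis by (auto simp: ennreal_add_left_cancel_le)
  qed
  with c show ?thesis by blast
qed

lemma curve_length_at_right_small:
  assumes "s < b" "curve_length \<gamma> s b < \<infinity>" "continuous (at_right s) \<gamma>" "0 < e"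
  shows "\<forall>\<^sub>F d in at_right s. curve_length \<gamma> s d \<le> ennreal e"
proof -
  obtain c where c: "s < c"
    "\<And>d. s < d \<Longrightarrow> d \<le> c \<Longrightarrow> curve_length \<gamma> s d \<le> ennreal (dist (\<gamma> s) (\<gamma> d)) + ennreal (e / 2)"
    using curve_length_le_dist_add[OF assms(1,2) half_gt_zero[OF assms(4)]] by blast
  have "\<forall>\<^sub>F d in at_right s. dist (\<gamma> d) (\<gamma> s) < e / 2"
    using assms(3,4) unfolding continuous_within by (intro tendstoD) auto
  moreover have "\<forall>\<^sub>F d in at_right s. s < d \<and> d \<le> c"
    using c(1) unfolding eventually_at_right_field by (intro exI[of _ c]) auto
  ultimately show ?thesis
  proof eventually_elim
    case (elim d)
    then have "curve_length \<gamma> s d \<le> ennreal (dist (\<gamma> s) (\<gamma> d)) + ennreal (e / 2)" by (intro c) auto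
    also have "\<dots> \<le> ennreal (e / 2) + ennreal (e / 2)"
      using elim by (intro add_right_mono ennreal_leI) (simp add: dist_commute)
    finally show ?case using assms(4) by (simp flip: ennreal_plus)
  qed
qed

lemma curve_length_finite:
  assumes "rectifiable_curve \<gamma>" "0 \<le> s" "s \<le> t" "t \<le> 1"
  shows "curve_length \<gamma> s t < \<infinity>"
proof -
  have "curve_length \<gamma> 0 1 = curve_length \<gamma> 0 s + (curve_length \<gamma> s t + curve_length \<gamma> t 1)"
    using assms(2-4) by (simp add: curve_length_add[of 0 s 1] curve_length_add[of s t 1])
  then show ?thesis using assms(1) by (simp add: rectifiable_curve_def less_top)
qed

lemma length_fun_diff:
  assumes "rectifiable_curve \<gamma>" "0 \<le> s" "s \<le> t" "t \<le> 1"
  shows "length_fun \<gamma> t - length_fun \<gamma> s = enn2real (curve_length \<gamma> s t)"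
proof -
  have "curve_length \<gamma> 0 t = curve_length \<gamma> 0 s + curve_length \<gamma> s t"
    using assms by (intro curve_length_add)
  moreover have "curve_length \<gamma> 0 s < \<infinity>" "curve_length \<gamma> s t < \<infinity>"
    using curve_length_finite[OF assms(1), of 0 s] curve_length_finite[OF assms] assms by auto
  ultimately show ?thesis using assms by (simp add: length_fun_def enn2real_plus)
qed

lemma length_fun_clamp: "length_fun \<gamma> t = length_fun \<gamma> (min 1 (max 0 t))"
  by (simp add: length_fun_def)

lemma length_fun_mono:
  assumes "rectifiable_curve \<gamma>" "s \<le> t"
  shows "length_fun \<gamma> s \<le> length_fun \<gamma> t"
proof -
  have "0 \<le> length_fun \<gamma> (min 1 (max 0 t)) - length_fun \<gamma> (min 1 (max 0 s))"
    using length_fun_diff[OF assms(1), of "min 1 (max 0 s)" "min 1 (max 0 t)"] assms(2)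
    by (simp add: min_le_iff_disj max_def)
  then show ?thesis by (simp flip: length_fun_clamp)
qed

lemma dist_le_length_fun_diff:
  assumes "rectifiable_curve \<gamma>" "0 \<le> s" "s \<le> t" "t \<le> 1"
  shows "dist (\<gamma> s) (\<gamma> t) \<le> length_fun \<gamma> t - length_fun \<gamma> s"
  unfolding length_fun_diff[OF assms]
  using dist_le_curve_length[OF assms(3), of \<gamma>] curve_length_finite[OF assms]
  by (cases "curve_length \<gamma> s t") auto

lemma length_fun_tendsto_at_right:
  assumes \<gamma>: "rectifiable_curve \<gamma>" and s: "0 \<le> s" "s < 1"
  shows "(length_fun \<gamma> \<longlongrightarrow> length_fun \<gamma> s) (at_right s)"
proof (rule tendstoI)
  fix e :: real assume "0 < e"
  have cont: "continuous (at_right s) \<gamma>"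
    using \<gamma> s unfolding rectifiable_curve_def continuous_within
    by (intro continuous_on_Icc_at_rightD[of s 1]) (auto intro: continuous_on_subset)
  have "\<forall>\<^sub>F t in at_right s. curve_length \<gamma> s t \<le> ennreal (e / 2)"
    using s \<open>0 < e\<close> by (intro curve_length_at_right_small[OF s(2) _ cont] curve_length_finite[OF \<gamma>]) auto
  moreover have "\<forall>\<^sub>F t in at_right s. s < t \<and> t < 1"
    using s unfolding eventually_at_right_field by blast
  ultimately show "\<forall>\<^sub>F t in at_right s. dist (length_fun \<gamma> t) (length_fun \<gamma> s) < e"
  proof eventually_elim
    case (elim t)
    then have "enn2real (curve_length \<gamma> s t) \<le> e / 2" using \<open>0 < e\<close> by (intro enn2real_leI) auto
    then show ?case
      using length_fun_diff[OF \<gamma> s(1), of t] elim \<open>0 < e\<close> by (simp add: dist_real_def)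
  qed
qed

text \<open>Without right continuity \<open>interval_measure (length_fun \<gamma>)\<close> would be a junk value.\<close>

lemma length_fun_right_continuous:
  assumes "rectifiable_curve \<gamma>"
  shows "continuous (at_right a) (length_fun \<gamma>)"
  unfolding continuous_within
proof -
  consider (before) "a < 0" | (after) "1 \<le> a" | (inside) "0 \<le> a" "a < 1" by linarith
  then show "(length_fun \<gamma> \<longlongrightarrow> length_fun \<gamma> a) (at_right a)"
  proof cases
    case before
    then have "\<forall>\<^sub>F x in at_right a. length_fun \<gamma> x = length_fun \<gamma> a"
      unfolding eventually_at_right_field by (intro exI[of _ 0]) (auto simp: length_fun_def)
    then show ?thesis by (rule tendsto_eventually)
  next
    case after
    then have "\<forall>\<^sub>F x in at_right a. length_fun \<gamma> x = length_fun \<gamma> a"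
      unfolding eventually_at_right_field by (intro exI[of _ "a + 1"]) (auto simp: length_fun_def)
    then show ?thesis by (rule tendsto_eventually)
  next
    case inside
    then show ?thesis by (rule length_fun_tendsto_at_right[OF assms])
  qed
qed

subsection \<open>Upper gradients\<close>

lemma borel_measurable_curve_comp:
  fixes \<gamma> :: "real \<Rightarrow> 'a::metric_space" and g :: "'a \<Rightarrow> ennreal"
  assumes g: "g \<in> borel_measurable borel" and \<gamma>: "continuous_on {a..b} \<gamma>"
  shows "(\<lambda>t. g (\<gamma> t) * indicator {a..b} t) \<in> borel_measurable borel"
proof (cases "a \<le> b")
  case True
  have "continuous_on UNIV (\<lambda>t. \<gamma> (max a (min b t)))"
    by (rule continuous_on_compose2[OF \<gamma>]) (use True in \<open>auto intro!: continuous_intros\<close>)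
  then have [measurable]: "(\<lambda>t. \<gamma> (max a (min b t))) \<in> borel_measurable borel"
    by (rule borel_measurable_continuous_onI)
  have "(\<lambda>t. g (\<gamma> (max a (min b t))) * indicator {a..b} t) \<in> borel_measurable borel"
    using g by measurable
  also have "(\<lambda>t. g (\<gamma> (max a (min b t))) * indicator {a..b} t) = (\<lambda>t. g (\<gamma> t) * indicator {a..b} t)"
    by (auto simp: indicator_def)
  finally show ?thesis .
qed simp

lemma nn_integral_length_fun_ge:
  fixes \<gamma> :: "real \<Rightarrow> 'a::metric_space"
  assumes \<gamma>: "rectifiable_curve \<gamma>" and st: "0 \<le> s" "s \<le> t" "t \<le> 1" and "0 \<le> d"
    and bound: "\<And>r. s \<le> r \<Longrightarrow> r \<le> t \<Longrightarrow> ennreal d \<le> f r * ennreal (dist (\<gamma> s) (\<gamma> t))"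
  shows "ennreal d \<le> (\<integral>\<^sup>+r\<in>{s<..t}. f r \<partial>interval_measure (length_fun \<gamma>))"
proof (cases "\<gamma> s = \<gamma> t")
  case True
  then show ?thesis using bound[of s] st by simp
next
  case False
  define D where "D = dist (\<gamma> s) (\<gamma> t)"
  have D: "0 < D" using False by (simp add: D_def)
  have slope: "ennreal (d / D) \<le> f r" if "s \<le> r" "r \<le> t" for r
    using divide_le_posI_ennreal[OF _ bound[OF that, unfolded mult.commute[of "f r"]]] D \<open>0 \<le> d\<close>
    by (simp add: D_def divide_ennreal)
  have "ennreal d = ennreal (d / D) * ennreal D"
    using D \<open>0 \<le> d\<close> by (simp flip: ennreal_mult)
  also have "\<dots> \<le> ennreal (d / D) * ennreal (length_fun \<gamma> t - length_fun \<gamma> s)"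
    unfolding D_def by (intro mult_left_mono ennreal_leI dist_le_length_fun_diff[OF \<gamma> st]) auto
  also have "ennreal (length_fun \<gamma> t - length_fun \<gamma> s) = emeasure (interval_measure (length_fun \<gamma>)) {s<..t}"
    using st by (intro emeasure_interval_measure_Ioc[symmetric] length_fun_mono[OF \<gamma>]
      length_fun_right_continuous[OF \<gamma>])
  also have "ennreal (d / D) * \<dots> = (\<integral>\<^sup>+r\<in>{s<..t}. ennreal (d / D) \<partial>interval_measure (length_fun \<gamma>))"
    by (simp add: nn_integral_cmult_indicator)
  also have "\<dots> \<le> (\<integral>\<^sup>+r\<in>{s<..t}. f r \<partial>interval_measure (length_fun \<gamma>))"
    by (intro nn_integral_mono) (auto simp: indicator_def slope)
  finally show ?thesis .
qed

lemma abs_diff_le_set_nn_integral: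
  fixes v :: "real \<Rightarrow> real" and \<tau> :: "nat \<Rightarrow> real"
  assumes f: "f \<in> borel_measurable M" and M: "sets M = sets borel" and \<tau>: "\<And>i. \<tau> i \<le> \<tau> (Suc i)"
    and local: "\<And>i. i < n \<Longrightarrow> ennreal \<bar>v (\<tau> i) - v (\<tau> (Suc i))\<bar> \<le> (\<integral>\<^sup>+t\<in>{\<tau> i<..\<tau> (Suc i)}. f t \<partial>M)"
  shows "ennreal \<bar>v (\<tau> 0) - v (\<tau> n)\<bar> \<le> (\<integral>\<^sup>+t\<in>{\<tau> 0<..\<tau> n}. f t \<partial>M)"
  using local
proof (induction n)
  case (Suc n)
  have "\<tau> 0 \<le> \<tau> n" using \<tau> by (rule lift_Suc_mono_le) simp
  have "ennreal \<bar>v (\<tau> 0) - v (\<tau> (Suc n))\<bar> \<le>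
      ennreal \<bar>v (\<tau> 0) - v (\<tau> n)\<bar> + ennreal \<bar>v (\<tau> n) - v (\<tau> (Suc n))\<bar>"
    by (simp flip: ennreal_plus)
  also have "\<dots> \<le> (\<integral>\<^sup>+t\<in>{\<tau> 0<..\<tau> n}. f t \<partial>M) + (\<integral>\<^sup>+t\<in>{\<tau> n<..\<tau> (Suc n)}. f t \<partial>M)"
    using Suc by (intro add_mono) auto
  also have "\<dots> = (\<integral>\<^sup>+t\<in>{\<tau> 0<..\<tau> n} \<union> {\<tau> n<..\<tau> (Suc n)}. f t \<partial>M)"
    using f M by (intro nn_integral_disjoint_pair[symmetric]) auto
  also have "{\<tau> 0<..\<tau> n} \<union> {\<tau> n<..\<tau> (Suc n)} = {\<tau> 0<..\<tau> (Suc n)}"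
    using \<open>\<tau> 0 \<le> \<tau> n\<close> \<tau> by (simp add: ivl_disj_un)
  finally show ?case .
qed simp

lemma abs_diff_le_line_integral:
  fixes \<gamma> :: "real \<Rightarrow> 'a::metric_space" and v :: "real \<Rightarrow> real"
  assumes \<gamma>: "rectifiable_curve \<gamma>" and g: "g \<in> borel_measurable borel" and "0 < \<eta>"
    and local: "\<And>s r t. 0 \<le> s \<Longrightarrow> s \<le> r \<Longrightarrow> r \<le> t \<Longrightarrow> t \<le> 1 \<Longrightarrow> t - s < \<eta> \<Longrightarrow>
      ennreal \<bar>v s - v t\<bar> \<le> g (\<gamma> r) * ennreal (dist (\<gamma> s) (\<gamma> t))"
  shows "ennreal \<bar>v 0 - v 1\<bar> \<le> line_integral \<gamma> g"
proof -
  let ?\<nu> = "interval_measure (length_fun \<gamma>)"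
  define f where "f t = g (\<gamma> t) * indicator {0..1} t" for t
  have f: "f \<in> borel_measurable ?\<nu>"
    using borel_measurable_curve_comp[OF g, of 0 1 \<gamma>] \<gamma>
    by (simp add: f_def[abs_def] rectifiable_curve_def cong: measurable_cong_sets)
  obtain N :: nat where N: "0 < N" "1 / real N < \<eta>"
    using \<open>0 < \<eta>\<close> by (metis nat_approx_posE zero_less_Suc)
  define \<tau> where "\<tau> i = real i / real N" for i
  have \<tau>: "0 \<le> \<tau> i" "\<tau> i \<le> \<tau> (Suc i)" "\<tau> (Suc i) - \<tau> i < \<eta>" for i
    using N by (auto simp: \<tau>_def divide_right_mono diff_divide_distrib[symmetric])
  have "ennreal \<bar>v (\<tau> i) - v (\<tau> (Suc i))\<bar> \<le> (\<integral>\<^sup>+t\<in>{\<tau> i<..\<tau> (Suc i)}. f t \<partial>?\<nu>)" if "i < N" for i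
  proof -
    have "\<tau> (Suc i) \<le> 1" using that N by (simp add: \<tau>_def)
    then show ?thesis
      using \<tau>[of i] by (intro nn_integral_length_fun_ge[OF \<gamma>]) (auto simp: f_def intro!: local)
  qed
  then have "ennreal \<bar>v (\<tau> 0) - v (\<tau> N)\<bar> \<le> (\<integral>\<^sup>+t\<in>{\<tau> 0<..\<tau> N}. f t \<partial>?\<nu>)"
    by (intro abs_diff_le_set_nn_integral f \<tau>(2)) auto
  then have "ennreal \<bar>v 0 - v 1\<bar> \<le> (\<integral>\<^sup>+t\<in>{0<..1}. f t \<partial>?\<nu>)" using N by (simp add: \<tau>_def)
  also have "\<dots> \<le> line_integral \<gamma> g"
    unfolding line_integral_def f_def by (intro nn_integral_mono) (auto simp: indicator_def)
  finally show ?thesis .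
qed

lemma upper_gradient_if_locally_lipschitz:
  fixes u :: "'a::metric_space \<Rightarrow> real"
  assumes g: "g \<in> borel_measurable borel"
    and \<delta>: "continuous_on U \<delta>" "\<And>x. x \<in> U \<Longrightarrow> 0 < \<delta> x"
    and lip: "\<And>x y z. x \<in> U \<Longrightarrow> dist x y < \<delta> x \<Longrightarrow> dist x z < \<delta> x \<Longrightarrow>
      ennreal \<bar>u y - u z\<bar> \<le> g x * ennreal (dist y z)"
  shows "upper_gradient U u g"
  unfolding upper_gradient_def
proof (intro conjI g allI impI, elim conjE)
  fix \<gamma> :: "real \<Rightarrow> 'a"
  assume \<gamma>: "rectifiable_curve \<gamma>" and U: "\<gamma> ` {0..1} \<subseteq> U"
  have cont: "continuous_on {0..1} \<gamma>" using \<gamma> by (simp add: rectifiable_curve_def)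
  have "continuous_on {0..1} (\<lambda>t. \<delta> (\<gamma> t))"
    using U by (intro continuous_on_compose2[OF \<delta>(1) cont])
  then obtain t0 where t0: "t0 \<in> {0..1}" "\<And>t. t \<in> {0..1} \<Longrightarrow> \<delta> (\<gamma> t0) \<le> \<delta> (\<gamma> t)"
    using continuous_attains_inf[of "{0..1}" "\<lambda>t. \<delta> (\<gamma> t)"] by auto
  have "0 < \<delta> (\<gamma> t0)" using t0(1) U by (intro \<delta>(2)) blast
  then obtain \<eta> where "0 < \<eta>"
    and \<eta>: "\<And>s t. s \<in> {0..1} \<Longrightarrow> t \<in> {0..1} \<Longrightarrow> dist t s < \<eta> \<Longrightarrow> dist (\<gamma> t) (\<gamma> s) < \<delta> (\<gamma> t0)"
    using compact_uniformly_continuous[OF cont] unfolding uniformly_continuous_on_def by (meson compact_Icc)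
  show "ennreal \<bar>u (\<gamma> 0) - u (\<gamma> 1)\<bar> \<le> line_integral \<gamma> g"
  proof (rule abs_diff_le_line_integral[OF \<gamma> g \<open>0 < \<eta>\<close>, where v = "\<lambda>t. u (\<gamma> t)"])
    fix s r t :: real assume st: "0 \<le> s" "s \<le> r" "r \<le> t" "t \<le> 1" "t - s < \<eta>"
    have "dist (\<gamma> r) (\<gamma> q) < \<delta> (\<gamma> r)" if "q \<in> {0..1}" "\<bar>r - q\<bar> < \<eta>" for q
      using \<eta>[of q r] t0(2)[of r] st that by (simp add: dist_real_def)
    then show "ennreal \<bar>u (\<gamma> s) - u (\<gamma> t)\<bar> \<le> g (\<gamma> r) * ennreal (dist (\<gamma> s) (\<gamma> t))"
      using U st by (intro lip) auto
  qed
qed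

lemma upper_gradient_cmult:
  fixes c :: real
  assumes "upper_gradient U u g" "0 \<le> c"
  shows "upper_gradient U (\<lambda>x. c * u x) (\<lambda>x. ennreal c * g x)"
  unfolding upper_gradient_def
proof (intro conjI allI impI)
  have g: "g \<in> borel_measurable borel" using assms(1) by (simp add: upper_gradient_def)
  then show "(\<lambda>x. ennreal c * g x) \<in> borel_measurable borel" by measurable
  fix \<gamma> :: "real \<Rightarrow> 'a"
  assume \<gamma>: "rectifiable_curve \<gamma> \<and> \<gamma> ` {0..1} \<subseteq> U \<and> (\<exists>s\<in>{0..1}. \<gamma> s \<noteq> \<gamma> 0)"
  have "(\<lambda>t. g (\<gamma> t) * indicator {0..1} t) \<in> borel_measurable (interval_measure (length_fun \<gamma>))"
    using borel_measurable_curve_comp[OF g] \<gamma>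
    by (simp add: rectifiable_curve_def cong: measurable_cong_sets)
  then have "line_integral \<gamma> (\<lambda>x. ennreal c * g x) = ennreal c * line_integral \<gamma> g"
    by (simp add: line_integral_def mult.assoc nn_integral_cmult)
  moreover have "ennreal \<bar>c * u (\<gamma> 0) - c * u (\<gamma> 1)\<bar> = ennreal c * ennreal \<bar>u (\<gamma> 0) - u (\<gamma> 1)\<bar>"
    using assms(2) by (simp add: abs_mult flip: ennreal_mult right_diff_distrib)
  moreover have "ennreal \<bar>u (\<gamma> 0) - u (\<gamma> 1)\<bar> \<le> line_integral \<gamma> g"
    using assms(1) \<gamma> by (simp add: upper_gradient_def)
  ultimately show "ennreal \<bar>c * u (\<gamma> 0) - c * u (\<gamma> 1)\<bar> \<le> line_integral \<gamma> (\<lambda>x. ennreal c * g x)"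
    by (simp add: mult_left_mono)
qed

subsection \<open>Doubling spaces\<close>

locale doubling_space =
  fixes \<mu> :: "'a::metric_space measure" and D :: real
  assumes sets_eq_borel: "sets \<mu> = sets borel" and D_ge_1: "1 \<le> D"
    and emeasure_ball_finite: "emeasure \<mu> (ball x r) < \<infinity>"
    and measure_ball_pos: "0 < r \<Longrightarrow> 0 < measure \<mu> (ball x r)"
    and measure_ball_double: "0 < r \<Longrightarrow> measure \<mu> (ball x (2 * r)) \<le> D * measure \<mu> (ball x r)"

lemma doubling_measure_imp_doubling_space:
  assumes "doubling_measure \<mu>"
  shows "\<exists>D. doubling_space \<mu> D"
proof -
  obtain D where D: "\<And>x r. r > 0 \<Longrightarrow> 0 < emeasure \<mu> (ball x (2*r))"
     "\<And>x r. r > 0 \<Longrightarrow> emeasure \<mu> (ball x (2*r)) \<le> ennreal D * emeasure \<mu> (ball x r)"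
     "\<And>x r. r > 0 \<Longrightarrow> emeasure \<mu> (ball x r) < \<infinity>"
    using assms unfolding doubling_measure_def by blast
  have fin: "emeasure \<mu> (ball x r) < \<infinity>" for x r
    using D(3)[of r x] by (cases "r > 0") (auto simp: ball_empty)
  have em: "emeasure \<mu> (ball x r) = ennreal (measure \<mu> (ball x r))" for x r
    using fin by (intro emeasure_eq_ennreal_measure) (auto simp: less_top)
  have "doubling_space \<mu> (max 1 D)"
  proof
    fix x :: 'a and r :: real assume "0 < r"
    then show "0 < measure \<mu> (ball x r)" using D(1)[of "r/2" x] by (simp add: em)
    have "ennreal (measure \<mu> (ball x (2*r))) \<le> ennreal D * ennreal (measure \<mu> (ball x r))"
      using D(2)[OF \<open>0 < r\<close>, of x] by (simp only: em)
    also have "\<dots> \<le> ennreal (max 1 D) * ennreal (measure \<mu> (ball x r))"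
      by (intro mult_right_mono ennreal_leI) auto
    also have "\<dots> = ennreal (max 1 D * measure \<mu> (ball x r))" by (simp add: ennreal_mult)
    finally show "measure \<mu> (ball x (2*r)) \<le> max 1 D * measure \<mu> (ball x r)"
      by (subst (asm) ennreal_le_iff) auto
  qed (use assms fin in \<open>auto simp: doubling_measure_def\<close>)
  then show ?thesis ..
qed

lemma finite_cover_if_separated_card_le:
  fixes A :: "'a::metric_space set"
  assumes "0 < e"
    and card: "\<And>S. finite S \<Longrightarrow> S \<subseteq> A \<Longrightarrow> pairwise (\<lambda>x y. e \<le> dist x y) S \<Longrightarrow> card S \<le> n"
  shows "\<exists>S. finite S \<and> A \<subseteq> (\<Union>x\<in>S. ball x e)"
proof -
  let ?sep = "\<lambda>S. finite S \<and> S \<subseteq> A \<and> pairwise (\<lambda>x y. e \<le> dist x y) S"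
  have "\<exists>S. ?sep S \<and> (\<forall>T. ?sep T \<longrightarrow> card T \<le> card S)"
  proof (rule ex_has_greatest_nat)
    show "?sep {}" by simp
    show "\<forall>S. ?sep S \<longrightarrow> card S < Suc n" using card by (simp only: less_Suc_eq_le) blast
  qed
  then obtain S where S: "?sep S" and maximal: "\<And>T. ?sep T \<Longrightarrow> card T \<le> card S" by blast
  have "y \<in> (\<Union>x\<in>S. ball x e)" if "y \<in> A" for y
  proof (rule ccontr)
    assume "y \<notin> (\<Union>x\<in>S. ball x e)"
    then have far: "e \<le> dist s y" if "s \<in> S" for s using that by (auto simp: not_less)
    then have "y \<notin> S" using \<open>0 < e\<close> by fastforce
    moreover have "?sep (insert y S)"
      using S \<open>y \<in> A\<close> far by (auto simp: pairwise_insert dist_commute)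
    ultimately show False using maximal[of "insert y S"] S by simp
  qed
  with S show ?thesis by blast
qed

context doubling_space
begin

lemma fmeasurable_ball: "ball x r \<in> fmeasurable \<mu>"
  using emeasure_ball_finite sets_eq_borel by (auto simp: fmeasurable_def)

lemma emeasure_bounded_finite:
  assumes "bounded S"
  shows "emeasure \<mu> S < \<infinity>"
proof -
  obtain x R where "S \<subseteq> ball x R" using bounded_subset_ballD[OF assms] by blast
  then have "emeasure \<mu> S \<le> emeasure \<mu> (ball x R)" using sets_eq_borel by (intro emeasure_mono) auto
  then show ?thesis using emeasure_ball_finite order_le_less_trans by blast
qed

lemma measure_ball_power: "0 < r \<Longrightarrow> measure \<mu> (ball x (2^k * r)) \<le> D^k * measure \<mu> (ball x r)"
proof (induction k)
  case (Suc k)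
  have "measure \<mu> (ball x (2^Suc k * r)) \<le> D * measure \<mu> (ball x (2^k * r))"
    using measure_ball_double[of "2^k * r" x] Suc.prems by (simp add: mult.assoc)
  also have "\<dots> \<le> D * (D^k * measure \<mu> (ball x r))"
    using Suc D_ge_1 by (intro mult_left_mono) auto
  finally show ?case by (simp add: mult.assoc)
qed simp

lemma measure_ball_le_power:
  assumes "0 < s" "dist x y + r \<le> 2^k * s"
  shows "measure \<mu> (ball x r) \<le> D^k * measure \<mu> (ball y s)"
proof -
  have "ball x r \<subseteq> ball y (2^k * s)"
  proof
    fix z assume "z \<in> ball x r"
    then show "z \<in> ball y (2^k * s)"
      using assms(2) dist_triangle[of y z x] by (simp add: dist_commute)
  qed
  then have "measure \<mu> (ball x r) \<le> measure \<mu> (ball y (2^k * s))"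
    using fmeasurable_ball[of x r] by (intro measure_mono_fmeasurable fmeasurable_ball) auto
  also have "\<dots> \<le> D^k * measure \<mu> (ball y s)" by (rule measure_ball_power[OF assms(1)])
  finally show ?thesis .
qed

lemma card_separated_le:
  fixes x :: 'a
  assumes S: "finite S" "S \<subseteq> cball x R" "pairwise (\<lambda>x y. e \<le> dist x y) S"
    and e: "0 < e" and R: "0 \<le> R" and k: "2 * R + e \<le> 2^k * (e / 2)"
  shows "card S \<le> nat \<lceil>D^k\<rceil>"
proof -
  let ?m = "measure \<mu> (ball x (R + e))"
  have "real (card S) * (?m / D^k) = (\<Sum>s\<in>S. ?m / D^k)" by simp
  also have "\<dots> \<le> (\<Sum>s\<in>S. measure \<mu> (ball s (e / 2)))"
  proof (rule sum_mono)
    fix s assume "s \<in> S"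
    then have "dist x s \<le> R" using S(2) by auto
    then have "?m \<le> D^k * measure \<mu> (ball s (e / 2))"
      using e k by (intro measure_ball_le_power) auto
    then show "?m / D^k \<le> measure \<mu> (ball s (e / 2))"
      using D_ge_1 by (simp add: field_simps)
  qed
  also have "\<dots> = measure \<mu> (\<Union>s\<in>S. ball s (e / 2))"
  proof (rule measure_finite_Union[symmetric])
    show "disjoint_family_on (\<lambda>s. ball s (e / 2)) S"
      unfolding disjoint_family_on_def
      using S(3) by (auto intro!: disjoint_ballI simp: pairwise_def)
  qed (use S(1) emeasure_ball_finite sets_eq_borel in \<open>auto simp: less_top\<close>)
  also have "\<dots> \<le> ?m"
  proof (rule measure_mono_fmeasurable)
    show "(\<Union>s\<in>S. ball s (e / 2)) \<subseteq> ball x (R + e)"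
    proof clarify
      fix s y assume "s \<in> S" "y \<in> ball s (e / 2)"
      then show "y \<in> ball x (R + e)" using S(2) dist_triangle[of x y s] e by force
    qed
    show "(\<Union>s\<in>S. ball s (e / 2)) \<in> sets \<mu>" using sets_eq_borel by (auto intro!: borel_open)
  qed (rule fmeasurable_ball)
  finally have "real (card S) / D^k * ?m \<le> 1 * ?m" by simp
  then have "real (card S) / D^k \<le> 1"
    using measure_ball_pos[of "R + e" x] e R by (simp only: mult_le_cancel_right)
  then have "real (card S) \<le> D^k" using D_ge_1 by (simp add: field_simps)
  then show ?thesis by linarith
qed

lemma cball_totally_bounded:
  fixes x :: 'a
  assumes "0 < e"
  shows "\<exists>S. finite S \<and> cball x R \<subseteq> (\<Union>y\<in>S. ball y e)"
proof -
  obtain k :: nat where "(2 * max 0 R + e) / (e / 2) < 2^k"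
    using real_arch_pow[of 2] by auto
  then have k: "2 * max 0 R + e \<le> 2^k * (e / 2)" using assms by (simp add: field_simps)
  have "\<exists>S. finite S \<and> cball x (max 0 R) \<subseteq> (\<Union>y\<in>S. ball y e)"
    using card_separated_le[OF _ _ _ assms _ k] assms by (intro finite_cover_if_separated_card_le) auto
  then show ?thesis by (meson subset_cball max.cobounded2 subset_trans)
qed

end

lemma doubling_space_compact:
  fixes \<mu> :: "'a::complete_space measure" and S :: "'a set"
  assumes "doubling_space \<mu> D" "closed S" "bounded S"
  shows "compact S"
proof -
  obtain x R where "S \<subseteq> cball x R" using assms(3) by (auto simp: bounded_def subset_eq)
  then have "\<exists>K. finite K \<and> S \<subseteq> (\<Union>y\<in>K. ball y e)" if "0 < e" for e
    using doubling_space.cball_totally_bounded[OF assms(1) that, of x R] by (meson subset_trans)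
  then show ?thesis
    unfolding compact_eq_totally_bounded using assms(2) by (simp add: complete_eq_closed)
qed

subsection \<open>Mean oscillation\<close>

context doubling_space
begin

definition average :: "('a \<Rightarrow> real) \<Rightarrow> 'a \<Rightarrow> real \<Rightarrow> real" where
  "average u x r = (LINT y:ball x r|\<mu>. u y) / measure \<mu> (ball x r)"

definition mean_oscillation :: "('a \<Rightarrow> real) \<Rightarrow> 'a \<Rightarrow> real \<Rightarrow> real" where
  "mean_oscillation u x r = average (\<lambda>y. \<bar>u y - average u x r\<bar>) x r"

lemma set_integrable_ball_const: "set_integrable \<mu> (ball x r) (\<lambda>_. c :: real)"
  using fmeasurable_ball[of x r] by (simp add: set_integrable_def fmeasurable_def)

lemma average_const: "0 < r \<Longrightarrow> average (\<lambda>_. c) x r = c"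
  using measure_ball_pos[of r x] fmeasurable_ball[of x r]
  by (simp add: average_def set_lebesgue_integral_def fmeasurable_def)

lemma average_mono:
  assumes "set_integrable \<mu> (ball x r) u" "set_integrable \<mu> (ball x r) v"
    and "\<And>y. y \<in> ball x r \<Longrightarrow> u y \<le> v y"
  shows "average u x r \<le> average v x r"
  unfolding average_def by (intro divide_right_mono set_integral_mono assms) auto

lemma abs_average_diff_const_le:
  assumes "0 < r" "set_integrable \<mu> (ball x r) u"
  shows "\<bar>average u x r - c\<bar> \<le> average (\<lambda>y. \<bar>u y - c\<bar>) x r"
proof -
  have "average u x r - c = average (\<lambda>y. u y - c) x r"
    using set_integral_diff(2)[OF assms(2) set_integrable_ball_const] average_const[OF assms(1), of c x]
    by (simp add: average_def diff_divide_distrib)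
  moreover have "\<bar>LINT y:ball x r|\<mu>. u y - c\<bar> \<le> (LINT y:ball x r|\<mu>. \<bar>u y - c\<bar>)"
    using integral_norm_bound[of \<mu> "\<lambda>y. indicator (ball x r) y *\<^sub>R (u y - c)"]
    by (simp add: set_lebesgue_integral_def abs_mult)
  ultimately show ?thesis by (simp add: average_def divide_right_mono)
qed

lemma average_subball_le:
  assumes "0 < r" "0 < s" and sub: "ball x r \<subseteq> ball z s"
    and L: "measure \<mu> (ball z s) \<le> L * measure \<mu> (ball x r)"
    and f: "set_integrable \<mu> (ball z s) f" "\<And>y. 0 \<le> f y"
  shows "average f x r \<le> L * average f z s"
proof -
  have "set_integrable \<mu> (ball x r) f"
    using fmeasurable_ball[of x r] sub by (intro set_integrable_subset[OF f(1)]) (auto simp: fmeasurable_def)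
  then have "(LINT y:ball x r|\<mu>. f y) \<le> (LINT y:ball z s|\<mu>. f y)"
    using f sub unfolding set_lebesgue_integral_def set_integrable_def
    by (intro integral_mono) (auto simp: indicator_def)
  then have "average f x r \<le> (LINT y:ball z s|\<mu>. f y) * (1 / measure \<mu> (ball x r))"
    by (simp add: average_def divide_right_mono)
  also have "\<dots> \<le> (LINT y:ball z s|\<mu>. f y) * (L / measure \<mu> (ball z s))"
  proof (rule mult_left_mono)
    show "1 / measure \<mu> (ball x r) \<le> L / measure \<mu> (ball z s)"
      using L measure_ball_pos[OF assms(1), of x] measure_ball_pos[OF assms(2), of z]
      by (simp add: field_simps)
    show "0 \<le> (LINT y:ball z s|\<mu>. f y)"
      using f(2) unfolding set_lebesgue_integral_def by (intro integral_nonneg_AE) simp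
  qed
  finally show ?thesis by (simp add: average_def mult.commute)
qed

lemma abs_average_diff_average_le:
  assumes r: "0 < r" "0 < s" and k: "dist z x + s \<le> 2^k * r" and sub: "ball x r \<subseteq> ball z s"
    and u: "\<And>x r. set_integrable \<mu> (ball x r) u"
  shows "\<bar>average u x r - average u z s\<bar> \<le> D^k * mean_oscillation u z s"
proof -
  have int: "set_integrable \<mu> (ball x r) (\<lambda>y. \<bar>u y - c\<bar>)" for x r c
    by (intro set_integrable_abs set_integral_diff u set_integrable_ball_const)
  have "\<bar>average u x r - average u z s\<bar> \<le> average (\<lambda>y. \<bar>u y - average u z s\<bar>) x r"
    by (rule abs_average_diff_const_le[OF r(1) u])
  also have "\<dots> \<le> D^k * average (\<lambda>y. \<bar>u y - average u z s\<bar>) z s"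
    using measure_ball_le_power[OF r(1) k] by (intro average_subball_le[OF r sub] int) auto
  finally show ?thesis by (simp add: mean_oscillation_def)
qed

lemma average_tendsto:
  assumes u: "\<And>x r. set_integrable \<mu> (ball x r) u" and cont: "isCont u x"
  shows "(average u x \<longlongrightarrow> u x) (at_right 0)"
proof (rule tendstoI)
  fix e :: real assume "0 < e"
  then obtain d where d: "0 < d" "\<And>y. dist y x < d \<Longrightarrow> dist (u y) (u x) < e / 2"
    using cont half_gt_zero unfolding continuous_at_eps_delta dist_real_def by (metis dist_commute)
  have "dist (average u x r) (u x) < e" if r: "0 < r" "r < d" for r
  proof -
    have "\<bar>average u x r - u x\<bar> \<le> average (\<lambda>y. \<bar>u y - u x\<bar>) x r"
      by (rule abs_average_diff_const_le[OF r(1) u])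
    also have "\<dots> \<le> average (\<lambda>_. e / 2) x r"
    proof (rule average_mono)
      show "set_integrable \<mu> (ball x r) (\<lambda>y. \<bar>u y - u x\<bar>)"
        by (intro set_integrable_abs set_integral_diff u set_integrable_ball_const)
      show "\<bar>u y - u x\<bar> \<le> e / 2" if "y \<in> ball x r" for y
        using d(2)[of y] that r by (simp add: dist_real_def dist_commute)
    qed (rule set_integrable_ball_const)
    also have "\<dots> < e" using average_const[OF r(1)] \<open>0 < e\<close> by simp
    finally show ?thesis by (simp add: dist_real_def)
  qed
  then show "\<forall>\<^sub>F r in at_right 0. dist (average u x r) (u x) < e"
    using d(1) unfolding eventually_at_right_field by auto
qed

lemma abs_average_diff_le:
  assumes u: "\<And>x r. set_integrable \<mu> (ball x r) u" and cont: "isCont u x" and "0 < r"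
    and osc: "\<And>s. 0 < s \<Longrightarrow> mean_oscillation u x s \<le> A * s"
  shows "\<bar>average u x r - u x\<bar> \<le> 2 * D * A * r"
proof -
  have dyadic: "\<bar>average u x (r / 2^n) - average u x r\<bar> \<le> 2 * D * A * r * (1 - 1 / 2^n)" for n
  proof (induction n)
    case (Suc n)
    have "\<bar>average u x (r / 2^Suc n) - average u x (r / 2^n)\<bar> \<le> D^1 * mean_oscillation u x (r / 2^n)"
      using \<open>0 < r\<close> u by (intro abs_average_diff_average_le subset_ball) (auto simp: field_simps)
    also have "\<dots> \<le> D * (A * (r / 2^n))"
      unfolding power_one_right using osc[of "r / 2^n"] \<open>0 < r\<close> D_ge_1 by (intro mult_left_mono) auto
    also have "\<dots> = 2 * D * A * r * (1 - 1 / 2^Suc n) - 2 * D * A * r * (1 - 1 / 2^n)"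
      by (simp add: field_simps)
    finally show ?case using Suc by linarith
  qed simp
  have "filterlim (\<lambda>n. r / 2^n) (at_right 0) sequentially"
  proof (rule tendsto_imp_filterlim_at_right)
    show "(\<lambda>n. r / 2^n) \<longlonglongrightarrow> 0"
      using tendsto_mult_right_zero[OF LIMSEQ_realpow_zero[of "1/2"], of r] by (simp add: power_one_over)
  qed (use \<open>0 < r\<close> in simp)
  then have "(\<lambda>n. average u x (r / 2^n)) \<longlonglongrightarrow> u x"
    by (rule filterlim_compose[OF average_tendsto[OF u cont]])
  then have "(\<lambda>n. \<bar>average u x (r / 2^n) - average u x r\<bar>) \<longlonglongrightarrow> \<bar>u x - average u x r\<bar>"
    by (intro tendsto_intros)
  moreover have "(\<lambda>n. 2 * D * A * r * (1 - 1 / 2^n)) \<longlonglongrightarrow> 2 * D * A * r * (1 - 0)"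
    by (intro tendsto_intros) (simp add: LIMSEQ_inverse_realpow_zero flip: inverse_eq_divide)
  ultimately have "\<bar>u x - average u x r\<bar> \<le> 2 * D * A * r * (1 - 0)"
    by (rule LIMSEQ_le) (use dyadic in blast)
  then show ?thesis by (simp add: abs_minus_commute)
qed

lemma mean_oscillation_imp_lipschitz:
  assumes u: "\<And>x r. set_integrable \<mu> (ball x r) u" and cont: "continuous_on UNIV u"
    and osc: "\<And>x r. 0 < r \<Longrightarrow> mean_oscillation u x r \<le> A * r"
  shows "\<bar>u x - u y\<bar> \<le> (6 * D + 2 * D^2) * A * dist x y"
proof (cases "x = y")
  case False
  define d where "d = dist x y"
  have d: "0 < d" using False by (simp add: d_def)
  have cont: "isCont u z" for z using cont by (simp add: continuous_on_eq_continuous_at)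
  have "ball y d \<subseteq> ball x (2 * d)"
  proof
    fix z assume "z \<in> ball y d"
    then show "z \<in> ball x (2 * d)" using dist_triangle[of x z y] by (simp add: d_def)
  qed
  then have "\<bar>average u y d - average u x (2 * d)\<bar> \<le> D^2 * mean_oscillation u x (2 * d)"
    using d u by (intro abs_average_diff_average_le) (auto simp: d_def)
  also have "\<dots> \<le> D^2 * (A * (2 * d))" using osc[of "2 * d" x] d by (intro mult_left_mono) auto
  finally have "\<bar>average u y d - average u x (2 * d)\<bar> \<le> D^2 * (A * (2 * d))" .
  moreover have "\<bar>average u y d - u y\<bar> \<le> 2 * D * A * d"
    using d by (intro abs_average_diff_le u cont osc) auto
  moreover have "\<bar>average u x (2 * d) - u x\<bar> \<le> 2 * D * A * (2 * d)"
    using d by (intro abs_average_diff_le u cont osc) auto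
  ultimately have "\<bar>u x - u y\<bar> \<le> D^2 * (A * (2 * d)) + 2 * D * A * d + 2 * D * A * (2 * d)"
    by linarith
  then show ?thesis by (simp add: d_def algebra_simps)
qed simp

text \<open>The Poincare inequality is stated for the completion of \<open>\<mu>\<close>; for Borel functions the
  integrals agree.\<close>

lemma poincare_mean_oscillation_le:
  assumes "poincare p \<mu>"
  obtains P where "0 < P" "\<And>u N x r. upper_gradient UNIV u (\<lambda>_. 1) \<Longrightarrow> u \<in> borel_measurable borel \<Longrightarrow>
    (\<And>y. \<bar>u y\<bar> \<le> N) \<Longrightarrow> 0 < r \<Longrightarrow> mean_oscillation u x r \<le> P * r"
proof -
  obtain P lam where P: "P > 0" "lam \<ge> 1" and
    poin: "\<And>x r u g. r > 0 \<Longrightarrow> (\<forall>y s. set_integrable (completion \<mu>) (ball y s) u) \<Longrightarrow>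
        upper_gradient UNIV u g \<Longrightarrow>
        (\<integral>\<^sup>+ y\<in>ball x (lam*r). epow (g y) p \<partial>completion \<mu>) < \<infinity> \<Longrightarrow>
        (let uB = (LINT y:ball x r|completion \<mu>. u y) / measure \<mu> (ball x r) in
          (LINT y:ball x r|completion \<mu>. \<bar>u y - uB\<bar>) / measure \<mu> (ball x r)
          \<le> P * r * (enn2real (\<integral>\<^sup>+ y\<in>ball x (lam*r). epow (g y) p \<partial>completion \<mu>)
                        / measure \<mu> (ball x (lam*r))) powr (1/p))"
    using assms unfolding poincare_def by blast
  have "mean_oscillation u x r \<le> P * r"
    if ug: "upper_gradient UNIV u (\<lambda>_. 1)" and u: "u \<in> borel_measurable borel" "\<And>y. \<bar>u y\<bar> \<le> N"
      and "0 < r" for u N x r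
  proof -
    have [measurable]: "u \<in> borel_measurable \<mu>" "ball y s \<in> sets \<mu>" for y s
      using u(1) sets_eq_borel by (auto cong: measurable_cong_sets)
    have "integrable \<mu> (\<lambda>y. indicator (ball z s) y *\<^sub>R u y)" for z s
      using u(2) fmeasurable_ball[of z s]
      by (intro integrableI_bounded_set_indicator[where B = N]) (auto simp: fmeasurable_def)
    then have int: "set_integrable (completion \<mu>) (ball z s) u" for z s
      unfolding set_integrable_def by (subst integrable_completion) auto
    have set_lint: "(LINT y:ball x r|completion \<mu>. f y) = (LINT y:ball x r|\<mu>. f y)"
      if "f \<in> borel_measurable \<mu>" for f :: "'a \<Rightarrow> real"
      unfolding set_lebesgue_integral_def using that by (intro integral_completion) measurable
    have "0 < lam * r" using P \<open>0 < r\<close> by simp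
    have "(\<integral>\<^sup>+ y\<in>ball x (lam*r). epow 1 p \<partial>completion \<mu>) = ennreal (measure \<mu> (ball x (lam*r)))"
      using emeasure_ball_finite[of x "lam * r"]
      by (simp add: epow_def emeasure_eq_ennreal_measure less_top)
    then have "(LINT y:ball x r|\<mu>. \<bar>u y - average u x r\<bar>) / measure \<mu> (ball x r) \<le> P * r * 1"
      using poin[OF \<open>0 < r\<close> _ ug, of x] int measure_ball_pos[OF \<open>0 < lam * r\<close>, of x]
      by (simp add: Let_def average_def set_lint)
    then show ?thesis by (simp add: mean_oscillation_def average_def)
  qed
  with P(1) show ?thesis by (rule that)
qed

lemma poincare_imp_lipschitz:
  assumes "poincare p \<mu>"
  obtains K where "0 < K" "\<And>(u :: 'a \<Rightarrow> real) N \<epsilon> x y. 0 < \<epsilon> \<Longrightarrow> (\<And>z. \<bar>u z\<bar> \<le> N) \<Longrightarrow>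
    (\<And>y z. dist y z < \<epsilon> \<Longrightarrow> \<bar>u y - u z\<bar> \<le> dist y z) \<Longrightarrow> \<bar>u x - u y\<bar> \<le> K * dist x y"
proof -
  obtain P where P: "0 < P" "\<And>u N x r. upper_gradient UNIV u (\<lambda>_. 1) \<Longrightarrow> u \<in> borel_measurable borel \<Longrightarrow>
    (\<And>y. \<bar>u y\<bar> \<le> N) \<Longrightarrow> 0 < r \<Longrightarrow> mean_oscillation u x r \<le> P * r"
    using poincare_mean_oscillation_le[OF assms] by blast
  have "\<bar>u x - u y\<bar> \<le> (6 * D + 2 * D^2) * P * dist x y"
    if \<epsilon>: "0 < \<epsilon>" and bd: "\<And>z. \<bar>u z\<bar> \<le> N"
      and lip: "\<And>y z. dist y z < \<epsilon> \<Longrightarrow> \<bar>u y - u z\<bar> \<le> dist y z"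
    for u :: "'a \<Rightarrow> real" and N \<epsilon> x y
  proof (rule mean_oscillation_imp_lipschitz)
    show "continuous_on UNIV u"
      unfolding continuous_on_iff
    proof (intro ballI allI impI)
      fix z :: 'a and e :: real assume "0 < e"
      then show "\<exists>d>0. \<forall>z'\<in>UNIV. dist z' z < d \<longrightarrow> dist (u z') (u z) < e"
        using lip[of _ z] \<epsilon> by (intro exI[of _ "min e \<epsilon>"]) (fastforce simp: dist_real_def)
    qed
    then have borel: "u \<in> borel_measurable borel" by (rule borel_measurable_continuous_onI)
    have "upper_gradient UNIV u (\<lambda>_. 1)"
    proof (rule upper_gradient_if_locally_lipschitz)
      fix x y z :: 'a assume "dist x y < \<epsilon> / 2" "dist x z < \<epsilon> / 2"
      then show "ennreal \<bar>u y - u z\<bar> \<le> 1 * ennreal (dist y z)"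
        using dist_triangle_half_r[of x y \<epsilon> z] by (auto intro: lip ennreal_leI)
    qed (use \<epsilon> in \<open>auto intro: continuous_intros\<close>)
    then show "mean_oscillation u x r \<le> P * r" if "0 < r" for x r by (rule P(2)[OF _ borel bd that])
    show "set_integrable \<mu> (ball x r) u" for x r
      unfolding set_integrable_def using fmeasurable_ball[of x r] borel bd sets_eq_borel
      by (intro integrableI_bounded_set_indicator[where B = N])
        (auto simp: fmeasurable_def cong: measurable_cong_sets)
  qed
  moreover have "0 < (6 * D + 2 * D^2) * P" using P(1) D_ge_1 by (simp add: add_pos_pos)
  ultimately show ?thesis using that by blast
qed

end

subsection \<open>Lipschitz curves\<close>

lemma diameter_leI:
  assumes "S \<noteq> {}" "\<And>x y. x \<in> S \<Longrightarrow> y \<in> S \<Longrightarrow> dist x y \<le> d"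
  shows "diameter S \<le> d"
  unfolding diameter_def using assms by (auto intro!: cSUP_least)

lemma lipschitz_on_compose_affine:
  fixes m b :: real
  assumes "L-lipschitz_on U c" "(\<lambda>t. m * t + b) ` V \<subseteq> U"
  shows "(L * \<bar>m\<bar>)-lipschitz_on V (\<lambda>t. c (m * t + b))"
proof (rule lipschitz_on_compose2[where g = c and f = "\<lambda>t. m * t + b"])
  show "\<bar>m\<bar>-lipschitz_on V (\<lambda>t. m * t + b)"
    by (intro lipschitz_onI) (simp_all add: dist_real_def abs_mult flip: right_diff_distrib)
  show "L-lipschitz_on ((\<lambda>t. m * t + b) ` V) c" using assms by (rule lipschitz_on_subset)
qed

lemma lipschitz_curve_length_le:
  assumes "L-lipschitz_on {a..b} \<gamma>"
  shows "curve_length \<gamma> a b \<le> ennreal (L * (b - a))"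
proof (rule curve_length_leI)
  fix n t assume t: "interval_partition a b n t"
  have "polygonal_length \<gamma> n t = ennreal (\<Sum>i<n. dist (\<gamma> (t i)) (\<gamma> (t (Suc i))))"
    by (simp add: polygonal_length_def sum_ennreal)
  also have "\<dots> \<le> ennreal (\<Sum>i<n. L * (t (Suc i) - t i))"
  proof (intro ennreal_leI sum_mono)
    fix i assume "i \<in> {..<n}"
    then show "dist (\<gamma> (t i)) (\<gamma> (t (Suc i))) \<le> L * (t (Suc i) - t i)"
      using lipschitz_onD[OF assms, of "t i" "t (Suc i)"] interval_partition_bounds[OF t, of i]
        interval_partition_bounds[OF t, of "Suc i"] interval_partition_mono[OF t, of i "Suc i"]
      by (simp add: dist_real_def)
  qed
  also have "(\<Sum>i<n. L * (t (Suc i) - t i)) = L * (b - a)"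
    using t by (simp add: interval_partition_def sum_distrib_left[symmetric] sum_lessThan_telescope)
  finally show "polygonal_length \<gamma> n t \<le> ennreal (L * (b - a))" .
qed

lemma lipschitz_imp_rectifiable_curve:
  assumes "L-lipschitz_on {0..1} \<gamma>"
  shows "rectifiable_curve \<gamma>"
  unfolding rectifiable_curve_def
  using lipschitz_curve_length_le[OF assms] lipschitz_on_continuous_on[OF assms]
  by (auto intro: order_le_less_trans[OF _ ennreal_less_top])

lemma lipschitz_image_continuum:
  assumes "1-lipschitz_on {a..b} c" "a \<le> (b::real)"
  shows "compact (c ` {a..b})" "connected (c ` {a..b})" "diameter (c ` {a..b}) \<le> b - a"
proof -
  have "continuous_on {a..b} c" using assms(1) by (rule lipschitz_on_continuous_on)
  then show "compact (c ` {a..b})" "connected (c ` {a..b})"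
    by (auto intro: compact_continuous_image connected_continuous_image)
  have "dist (c s) (c t) \<le> b - a" if "s \<in> {a..b}" "t \<in> {a..b}" for s t
    using lipschitz_onD[OF assms(1) that] that by (auto simp: dist_real_def)
  then show "diameter (c ` {a..b}) \<le> b - a" using assms(2) by (intro diameter_leI) auto
qed

definition lip_curve :: "'a::metric_space set \<Rightarrow> real \<Rightarrow> (real \<Rightarrow> 'a) \<Rightarrow> bool" where
  "lip_curve A l c \<longleftrightarrow> 0 \<le> l \<and> 1-lipschitz_on {0..l} c \<and> c ` {0..l} \<subseteq> A"

definition lip_joined :: "'a::metric_space set \<Rightarrow> real \<Rightarrow> 'a \<Rightarrow> 'a \<Rightarrow> bool" where
  "lip_joined A l x y \<longleftrightarrow> (\<exists>c. lip_curve A l c \<and> c 0 = x \<and> c l = y)"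

definition curve_join :: "real \<Rightarrow> (real \<Rightarrow> 'a) \<Rightarrow> (real \<Rightarrow> 'a) \<Rightarrow> real \<Rightarrow> 'a" where
  "curve_join l c c' t = (if t \<le> l then c t else c' (t - l))"

lemma lip_curve_mem: "lip_curve A l c \<Longrightarrow> 0 \<le> t \<Longrightarrow> t \<le> l \<Longrightarrow> c t \<in> A"
  by (auto simp: lip_curve_def)

lemma lip_curve_continuous: "lip_curve A l c \<Longrightarrow> continuous_on {0..l} c"
  unfolding lip_curve_def by (blast intro: lipschitz_on_continuous_on)

lemma lip_curve_join:
  assumes c: "lip_curve A l c" and c': "lip_curve A m c'" and "c l = c' 0"
  shows "lip_curve A (l + m) (curve_join l c c')"
proof -
  have "1-lipschitz_on {l..l + m} (\<lambda>t. c' (t - l))"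
    using lipschitz_on_compose_affine[of 1 "{0..m}" c' 1 "- l" "{l..l + m}"] c'
    by (force simp: lip_curve_def)
  then have "1-lipschitz_on {0..l + m} (\<lambda>t. if t \<le> l then c t else c' (t - l))"
    using c assms(3) by (intro lipschitz_on_concat) (auto simp: lip_curve_def)
  then have "1-lipschitz_on {0..l + m} (curve_join l c c')"
    by (simp add: curve_join_def[abs_def])
  then show ?thesis using c c' by (auto simp: lip_curve_def curve_join_def)
qed

lemma curve_join_endpoints:
  assumes "0 \<le> l" "0 \<le> m" "c l = c' 0"
  shows "curve_join l c c' 0 = c 0" "curve_join l c c' (l + m) = c' m"
  using assms by (auto simp: curve_join_def)

lemma lip_joined_segment:
  assumes "1-lipschitz_on {a..b} c" "a \<le> b" "c ` {a..b} \<subseteq> A"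
  shows "lip_joined A (b - a) (c a) (c b)"
  unfolding lip_joined_def lip_curve_def
  using lipschitz_on_compose_affine[OF assms(1), of 1 a "{0..b - a}"] assms(2,3)
  by (intro exI[of _ "\<lambda>t. c (t + a)"]) (force simp: image_subset_iff)

lemma lip_curve_segment:
  assumes "lip_curve A l c" "0 \<le> a" "a \<le> b" "b \<le> l" "c ` {a..b} \<subseteq> B"
  shows "lip_joined B (b - a) (c a) (c b)"
  using assms by (intro lip_joined_segment) (auto simp: lip_curve_def intro: lipschitz_on_subset)

lemma lip_joined_refl: "x \<in> A \<Longrightarrow> 0 \<le> l \<Longrightarrow> lip_joined A l x x"
  unfolding lip_joined_def lip_curve_def
  by (intro exI[of _ "\<lambda>_. x"]) (auto intro!: lipschitz_on_leI)

lemma lip_joined_mono: "lip_joined A l x y \<Longrightarrow> A \<subseteq> B \<Longrightarrow> lip_joined B l x y"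
  unfolding lip_joined_def lip_curve_def by blast

lemma lip_joined_mem: "lip_joined A l x y \<Longrightarrow> x \<in> A \<and> y \<in> A"
  unfolding lip_joined_def lip_curve_def by force

lemma lip_joined_trans:
  assumes "lip_joined A l x y" "lip_joined A m y z"
  shows "lip_joined A (l + m) x z"
proof -
  obtain c c' where c: "lip_curve A l c" "c 0 = x" "c l = y" and c': "lip_curve A m c'" "c' 0 = y" "c' m = z"
    using assms unfolding lip_joined_def by blast
  then have "curve_join l c c' 0 = x" "curve_join l c c' (l + m) = z"
    using curve_join_endpoints[of l m c c'] by (auto simp: lip_curve_def)
  moreover have "lip_curve A (l + m) (curve_join l c c')"
    using c c' by (intro lip_curve_join) auto
  ultimately show ?thesis unfolding lip_joined_def by blast
qed

lemma lip_joined_lengthen: "lip_joined A l x y \<Longrightarrow> l \<le> m \<Longrightarrow> lip_joined A m x y"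
  using lip_joined_trans[of A l x y "m - l" y] lip_joined_refl[of y A "m - l"] lip_joined_mem[of A l x y]
  by simp

lemma lip_joined_sym:
  assumes "lip_joined A l x y"
  shows "lip_joined A l y x"
proof -
  obtain c where c: "lip_curve A l c" "c 0 = x" "c l = y" using assms unfolding lip_joined_def by blast
  then have "lip_curve A l (\<lambda>t. c (l - t))"
    using lipschitz_on_compose_affine[of 1 "{0..l}" c "- 1" l "{0..l}"]
    by (auto simp: lip_curve_def image_subset_iff)
  then show ?thesis unfolding lip_joined_def using c by (intro exI[of _ "\<lambda>t. c (l - t)"]) simp
qed

lemma lip_joined_continuum:
  assumes "lip_joined A l x y"
  obtains K where "compact K" "connected K" "K \<subseteq> A" "x \<in> K" "y \<in> K" "diameter K \<le> l"
proof -
  obtain c where c: "0 \<le> l" "1-lipschitz_on {0..l} c" "c ` {0..l} \<subseteq> A" "c 0 = x" "c l = y"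
    using assms unfolding lip_joined_def lip_curve_def by blast
  show ?thesis
    using lipschitz_image_continuum[OF c(2,1)] c by (intro that[of "c ` {0..l}"]) force+
qed

subsection \<open>Quasiconvexity\<close>

definition coarse_paths :: "real \<Rightarrow> real \<Rightarrow> 'a::metric_space \<Rightarrow> 'a \<Rightarrow> (real \<Rightarrow> 'a) set" where
  "coarse_paths \<epsilon> L x y = {f. f 0 = x \<and> f L = y \<and> (\<forall>s t. dist (f s) (f t) \<le> \<bar>s - t\<bar> + \<epsilon>)}"

lemma coarse_paths_const: "0 \<le> \<epsilon> \<Longrightarrow> (\<lambda>_. x) \<in> coarse_paths \<epsilon> L x x"
  by (simp add: coarse_paths_def)

lemma coarse_paths_mono: "\<epsilon> \<le> \<epsilon>' \<Longrightarrow> coarse_paths \<epsilon> L x y \<subseteq> coarse_paths \<epsilon>' L x y"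
  unfolding coarse_paths_def by (fastforce intro: order_trans)

lemma coarse_path_dist_le:
  assumes f: "f \<in> coarse_paths \<epsilon> L x y" and z: "dist y z \<le> \<epsilon>" and M: "L + dist y z \<le> M" and "s < M"
  shows "dist (f (min L s)) z \<le> M - s + \<epsilon>"
proof (cases "s \<le> L")
  case True
  have "dist (f s) (f L) \<le> \<bar>s - L\<bar> + \<epsilon>" "f L = y" using f by (auto simp: coarse_paths_def)
  then show ?thesis
    using dist_triangle[of "f s" z y] M True by (simp add: min_absorb2)
next
  case False
  have "f L = y" using f by (simp add: coarse_paths_def)
  then show ?thesis using z \<open>s < M\<close> False by (simp add: min_absorb1)
qed

lemma coarse_path_extend:
  assumes f: "f \<in> coarse_paths \<epsilon> L x y" and z: "dist y z \<le> \<epsilon>" and M: "0 \<le> L" "L + dist y z \<le> M"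
  defines "g \<equiv> \<lambda>t. if t < M then f (min L t) else z"
  shows "g \<in> coarse_paths \<epsilon> M x z"
proof -
  have f': "f 0 = x" "f L = y" "\<And>s t. dist (f s) (f t) \<le> \<bar>s - t\<bar> + \<epsilon>"
    using f by (auto simp: coarse_paths_def)
  have "0 \<le> \<epsilon>" using z zero_le_dist[of y z] by linarith
  have jump: "dist (g s) (g t) \<le> \<bar>s - t\<bar> + \<epsilon>" if "s < M" "M \<le> t" for s t
  proof -
    have "M - s \<le> \<bar>s - t\<bar>" using that by linarith
    then show ?thesis using coarse_path_dist_le[OF f z M(2) that(1)] that by (simp add: g_def)
  qed
  have "dist (g s) (g t) \<le> \<bar>s - t\<bar> + \<epsilon>" for s t
  proof -
    consider (path) "s < M" "t < M" | (forward) "s < M" "M \<le> t" | (backward) "M \<le> s" "t < M" |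
      (endpoint) "M \<le> s" "M \<le> t"
      by linarith
    then show ?thesis
    proof cases
      case path
      have "\<bar>min L s - min L t\<bar> \<le> \<bar>s - t\<bar>" by (simp add: min_def)
      then show ?thesis using f'(3)[of "min L s" "min L t"] path by (simp add: g_def)
    next
      case backward
      then show ?thesis using jump[of t s] by (simp add: dist_commute abs_minus_commute)
    qed (use jump \<open>0 \<le> \<epsilon>\<close> in \<open>auto simp: g_def\<close>)
  qed
  moreover have "g 0 = x"
  proof (cases "0 < M")
    case False
    then have "L = 0" "dist y z = 0" using M zero_le_dist[of y z] by linarith+
    then show ?thesis using f' False by (simp add: g_def)
  qed (use f' M(1) in \<open>simp add: g_def\<close>)
  ultimately show ?thesis by (simp add: coarse_paths_def g_def)
qed

lemma compact_PiE_UNIV: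
  fixes K :: "'i \<Rightarrow> 'a::topological_space set"
  assumes "\<And>i. compact (K i)"
  shows "compact (PiE UNIV K)"
  using compactin_PiE[of "\<lambda>_. euclidean" UNIV K] assms
  by (simp add: euclidean_product_topology)

lemma closed_coarse_paths: "closed (coarse_paths \<epsilon> L x y)"
  unfolding coarse_paths_def
  by (intro closed_Collect_conj closed_Collect_all closed_Collect_le closed_Collect_eq
    continuous_intros continuous_on_product_coordinates)

lemma coarse_paths_subset_PiE:
  assumes "\<epsilon> \<le> 1"
  shows "coarse_paths \<epsilon> L x y \<subseteq> PiE UNIV (\<lambda>t. cball x (\<bar>t\<bar> + 1))"
proof
  fix f assume "f \<in> coarse_paths \<epsilon> L x y"
  then have f: "f 0 = x" "\<And>t. dist (f 0) (f t) \<le> \<bar>0 - t\<bar> + \<epsilon>" unfolding coarse_paths_def by blast+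
  have "f t \<in> cball x (\<bar>t\<bar> + 1)" for t using f(1) f(2)[of t] assms by simp
  then show "f \<in> PiE UNIV (\<lambda>t. cball x (\<bar>t\<bar> + 1))" by auto
qed

lemma INT_coarse_paths: "(\<Inter>n. coarse_paths (1 / real (Suc n)) L x y) \<subseteq> coarse_paths 0 L x y"
proof
  fix f assume "f \<in> (\<Inter>n. coarse_paths (1 / real (Suc n)) L x y)"
  then have f: "f 0 = x" "f L = y" "\<And>n s t. dist (f s) (f t) \<le> \<bar>s - t\<bar> + 1 / real (Suc n)"
    unfolding coarse_paths_def by blast+
  have "dist (f s) (f t) \<le> \<bar>s - t\<bar>" for s t
  proof (rule field_le_epsilon)
    fix e :: real assume "0 < e"
    then obtain n where "1 / real (Suc n) < e" by (rule nat_approx_posE)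
    then show "dist (f s) (f t) \<le> \<bar>s - t\<bar> + e" using f(3)[of s t n] by linarith
  qed
  then show "f \<in> coarse_paths 0 L x y" using f(1,2) by (simp add: coarse_paths_def)
qed

lemma coarse_paths_limit:
  fixes x y :: "'a::metric_space"
  assumes proper: "\<And>r. compact (cball x r)" and paths: "\<And>\<epsilon>. 0 < \<epsilon> \<Longrightarrow> coarse_paths \<epsilon> L x y \<noteq> {}"
  shows "coarse_paths 0 L x y \<noteq> {}"
proof -
  let ?K = "PiE UNIV (\<lambda>t::real. cball x (\<bar>t\<bar> + 1))"
  define F where "F n = coarse_paths (1 / real (Suc n)) L x y" for n
  have "?K \<inter> (\<Inter>n\<in>UNIV. F n) \<noteq> {}"
  proof (rule compact_imp_fip_image)
    show "compact ?K" by (intro compact_PiE_UNIV proper)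
    show "closed (F n)" for n unfolding F_def by (rule closed_coarse_paths)
    fix I :: "nat set" assume "finite I"
    define n where "n = Max (insert 0 I)"
    obtain f where f: "f \<in> F n" using paths[of "1 / real (Suc n)"] by (auto simp: F_def)
    have "F n \<subseteq> F m" if "m \<in> I" for m
    proof -
      have "m \<le> n" using that \<open>finite I\<close> by (simp add: n_def)
      then show ?thesis unfolding F_def by (intro coarse_paths_mono) (simp add: frac_le)
    qed
    moreover have "F n \<subseteq> ?K" unfolding F_def by (intro coarse_paths_subset_PiE) simp
    ultimately show "?K \<inter> (\<Inter>n\<in>I. F n) \<noteq> {}" using f by blast
  qed
  then show ?thesis using INT_coarse_paths[of L x y] unfolding F_def by blast
qed

definition truncate :: "real \<Rightarrow> ennreal \<Rightarrow> real" where
  "truncate N a = enn2real (min (ennreal N) a)"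

lemma truncate_0 [simp]: "truncate N 0 = 0"
  by (simp add: truncate_def min_def)

lemma truncate_nonneg: "0 \<le> truncate N a"
  by (simp add: truncate_def)

lemma truncate_le: "0 \<le> N \<Longrightarrow> truncate N a \<le> N"
  unfolding truncate_def by (intro enn2real_leI) auto

lemma truncate_le_add:
  assumes "0 \<le> d" "b \<le> a + ennreal d"
  shows "truncate N b \<le> truncate N a + d"
proof -
  have fin: "min (ennreal N) a < top" by (simp add: min_less_iff_disj)
  have "min (ennreal N) b \<le> min (ennreal N) a + ennreal d"
    using assms(2) by (auto simp: min_def add_increasing2 intro: order_trans split: if_splits)
  then have "enn2real (min (ennreal N) b) \<le> enn2real (min (ennreal N) a + ennreal d)"
    using fin by (intro enn2real_mono) simp_all
  then show ?thesis using fin assms(1) by (simp add: truncate_def enn2real_plus)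
qed

lemma less_if_truncate_less:
  assumes "truncate N a < N"
  shows "a < ennreal N"
proof (rule ccontr)
  assume "\<not> a < ennreal N"
  then have "truncate N a = enn2real (ennreal N)" by (simp add: truncate_def min_absorb1)
  then show False using assms truncate_nonneg[of N a] by simp
qed

definition coarse_dist :: "real \<Rightarrow> 'a::metric_space \<Rightarrow> 'a \<Rightarrow> ennreal" where
  "coarse_dist \<epsilon> x y = (INF L\<in>{L. 0 \<le> L \<and> coarse_paths \<epsilon> L x y \<noteq> {}}. ennreal L)"

lemma coarse_dist_refl: "0 \<le> \<epsilon> \<Longrightarrow> coarse_dist \<epsilon> x x = 0"
  using INF_lower[of 0 "{L. 0 \<le> L \<and> coarse_paths \<epsilon> L x x \<noteq> {}}" ennreal] coarse_paths_const[of \<epsilon> x 0]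
  by (auto simp: coarse_dist_def)

lemma coarse_dist_step:
  assumes "dist y z \<le> \<epsilon>"
  shows "coarse_dist \<epsilon> x z \<le> coarse_dist \<epsilon> x y + ennreal (dist y z)"
proof -
  have "coarse_dist \<epsilon> x z - ennreal (dist y z) \<le> ennreal L"
    if L: "0 \<le> L" "coarse_paths \<epsilon> L x y \<noteq> {}" for L
  proof -
    have "coarse_paths \<epsilon> (L + dist y z) x z \<noteq> {}"
      using coarse_path_extend[OF _ assms L(1)] L(2) by blast
    then have "coarse_dist \<epsilon> x z \<le> ennreal (L + dist y z)"
      unfolding coarse_dist_def using L(1) by (intro INF_lower) simp
    then show ?thesis using L(1) by (simp add: ennreal_minus_le_iff add.commute)
  qed
  then have "coarse_dist \<epsilon> x z - ennreal (dist y z) \<le> coarse_dist \<epsilon> x y"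
    unfolding coarse_dist_def[of \<epsilon> x y] by (intro INF_greatest) auto
  then show ?thesis by (simp add: ennreal_minus_le_iff add.commute)
qed

lemma coarse_path_if_coarse_dist_less:
  assumes "coarse_dist \<epsilon> x y < ennreal L" "0 \<le> \<epsilon>"
  shows "coarse_paths \<epsilon> L x y \<noteq> {}"
proof -
  obtain l where "0 \<le> l" "coarse_paths \<epsilon> l x y \<noteq> {}" "ennreal l < ennreal L"
    using assms(1) unfolding coarse_dist_def INF_less_iff by blast
  then show ?thesis
    using coarse_path_extend[of _ \<epsilon> l x y y L] assms(2) by (auto simp: ennreal_less_iff)
qed

text \<open>The coarse distance from \<open>x\<close> is locally 1-Lipschitz, so the Poincare inequality makes it
  Lipschitz with a constant independent of \<open>\<epsilon>\<close>; the coarse paths converge to a curve as \<open>\<epsilon> \<rightarrow> 0\<close>.\<close>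

lemma (in doubling_space) poincare_coarse_paths:
  assumes "poincare p \<mu>"
  obtains K where "0 < K"
    "\<And>\<epsilon> L x (y :: 'a). 0 < \<epsilon> \<Longrightarrow> 0 \<le> L \<Longrightarrow> K * dist x y < L \<Longrightarrow> coarse_paths \<epsilon> L x y \<noteq> {}"
proof -
  obtain K where K: "0 < K" and lip: "\<And>(u :: 'a \<Rightarrow> real) N \<epsilon> x y. 0 < \<epsilon> \<Longrightarrow> (\<And>z. \<bar>u z\<bar> \<le> N) \<Longrightarrow>
      (\<And>y z. dist y z < \<epsilon> \<Longrightarrow> \<bar>u y - u z\<bar> \<le> dist y z) \<Longrightarrow> \<bar>u x - u y\<bar> \<le> K * dist x y"
    using poincare_imp_lipschitz[OF assms] by blast
  have "coarse_paths \<epsilon> L x y \<noteq> {}" if \<epsilon>: "0 < \<epsilon>" and L: "0 \<le> L" "K * dist x y < L" for \<epsilon> L and x y :: 'a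
  proof -
    define u where "u z = truncate L (coarse_dist \<epsilon> x z)" for z
    have bounded: "\<bar>u z\<bar> \<le> L" for z
      using truncate_nonneg[of L] truncate_le[OF L(1)] by (simp add: u_def)
    have step: "u z \<le> u y + dist y z" if "dist y z < \<epsilon>" for y z
      unfolding u_def using that by (intro truncate_le_add coarse_dist_step) auto
    have "\<bar>u x - u y\<bar> \<le> K * dist x y"
    proof (rule lip[OF \<epsilon> bounded])
      show "\<bar>u y - u z\<bar> \<le> dist y z" if "dist y z < \<epsilon>" for y z
        using step[of y z] step[of z y] that by (simp add: dist_commute abs_le_iff)
    qed
    then have "u y < L" using L(2) \<epsilon> by (simp add: u_def coarse_dist_refl)
    then show ?thesis
      unfolding u_def using \<epsilon> by (intro coarse_path_if_coarse_dist_less less_if_truncate_less) auto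
  qed
  with K show ?thesis by (rule that)
qed

lemma poincare_quasiconvex:
  fixes \<mu> :: "'a::complete_space measure"
  assumes D: "doubling_space \<mu> D" and P: "poincare p \<mu>"
  obtains C where "1 \<le> C" "\<And>x y :: 'a. lip_joined UNIV (C * dist x y) x y"
proof -
  obtain K where K: "0 < K"
    "\<And>\<epsilon> L x (y :: 'a). 0 < \<epsilon> \<Longrightarrow> 0 \<le> L \<Longrightarrow> K * dist x y < L \<Longrightarrow> coarse_paths \<epsilon> L x y \<noteq> {}"
    using doubling_space.poincare_coarse_paths[OF D P] by blast
  have "lip_joined UNIV ((K + 1) * dist x y) x y" for x y :: 'a
  proof (cases "x = y")
    case False
    define L where "L = (K + 1) * dist x y"
    have L: "0 \<le> L" "K * dist x y < L" using False K(1) by (auto simp: L_def algebra_simps)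
    then obtain c where "c \<in> coarse_paths 0 L x y"
      using coarse_paths_limit[of x L y] K(2) doubling_space_compact[OF D] by auto
    then have c: "c 0 = x" "c L = y" "\<And>s t. dist (c s) (c t) \<le> dist s t"
      by (auto simp: coarse_paths_def dist_real_def)
    then have "lip_curve UNIV L c" using L(1) by (auto simp: lip_curve_def intro!: lipschitz_onI)
    then show ?thesis using c(1,2) unfolding L_def lip_joined_def by blast
  qed (simp add: lip_joined_refl)
  with K(1) show ?thesis by (intro that[of "K + 1"]) auto
qed

subsection \<open>Chains and ends\<close>

lemma chain_divides_refl: "chain_divides E E"
  unfolding chain_divides_def by blast

lemma chain_divides_trans: "chain_divides E F \<Longrightarrow> chain_divides F G \<Longrightarrow> chain_divides E G"
  unfolding chain_divides_def by (meson subset_trans)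

lemma chain_divides_impression:
  assumes "chain_divides E F"
  shows "(\<Inter>k. closure (E k)) \<subseteq> (\<Inter>k. closure (F k))"
proof (rule INT_greatest)
  fix k
  obtain l where "E l \<subseteq> F k" using assms unfolding chain_divides_def by blast
  then show "(\<Inter>k. closure (E k)) \<subseteq> closure (F k)" using closure_mono by blast
qed

lemma pe_end_chain: "e \<in> pe_ends \<Omega> \<Longrightarrow> E \<in> e \<Longrightarrow> pe_chain \<Omega> E"
  unfolding pe_ends_def by blast

lemma pe_end_nonempty: "e \<in> pe_ends \<Omega> \<Longrightarrow> e \<noteq> {}"
  using chain_divides_refl unfolding pe_ends_def chain_equiv_def by blast

lemma pe_end_chain_divides:
  assumes "e \<in> pe_ends \<Omega>" "E \<in> e" "F \<in> e"
  shows "chain_divides E F"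
proof -
  obtain G where "e = {F. pe_chain \<Omega> F \<and> chain_equiv G F}" using assms(1) unfolding pe_ends_def by blast
  then have "chain_divides E G" "chain_divides G F" using assms(2,3) by (auto simp: chain_equiv_def)
  then show ?thesis by (rule chain_divides_trans)
qed

lemma pe_end_equiv_chain:
  assumes "e \<in> pe_ends \<Omega>" "E \<in> e" "pe_chain \<Omega> F" "chain_equiv E F"
  shows "F \<in> e"
proof -
  obtain G where e: "e = {F. pe_chain \<Omega> F \<and> chain_equiv G F}" using assms(1) unfolding pe_ends_def by blast
  then have "chain_equiv G F"
    using assms(2,4) chain_divides_trans[of G E F] chain_divides_trans[of F E G]
    by (simp add: chain_equiv_def)
  then show ?thesis using e assms(3) by blast
qed

lemma impression_eq:
  assumes "e \<in> pe_ends \<Omega>" "E \<in> e"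
  shows "impression e = (\<Inter>k. closure (E k))"
proof -
  have "(SOME F. F \<in> e) \<in> e" using assms(2) by (metis someI)
  then show ?thesis
    unfolding impression_def using assms
    by (intro antisym chain_divides_impression pe_end_chain_divides)
qed

lemma prime_end_dividing_chain:
  assumes e: "e \<in> prime_ends \<Omega>" "E \<in> e" and F: "pe_chain \<Omega> F" "chain_divides F E"
  shows "F \<in> e"
proof -
  define f where "f = {G. pe_chain \<Omega> G \<and> chain_equiv F G}"
  have "F \<in> f" using F(1) by (simp add: f_def chain_equiv_def chain_divides_refl)
  moreover have "f \<in> pe_ends \<Omega>" using F(1) unfolding pe_ends_def f_def by blast
  ultimately show ?thesis
    using e F(2) unfolding prime_ends_def end_divides_def by blast
qed

lemma pe_chain_decreasing: "pe_chain \<Omega> E \<Longrightarrow> j \<le> k \<Longrightarrow> E k \<subseteq> E j"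
  by (rule lift_Suc_antimono_le[of E]) (simp add: pe_chain_def)

lemma pe_chain_subset: "pe_chain \<Omega> E \<Longrightarrow> E k \<subseteq> \<Omega>"
  by (auto simp: pe_chain_def acceptable_def)

lemma pe_chain_shift:
  assumes "pe_chain \<Omega> E"
  shows "pe_chain \<Omega> (\<lambda>k. E (k + m))" "chain_equiv E (\<lambda>k. E (k + m))"
proof -
  have sub: "E (k + m) \<subseteq> E k" for k using pe_chain_decreasing[OF assms] by simp
  then show "chain_equiv E (\<lambda>k. E (k + m))"
    unfolding chain_equiv_def chain_divides_def by blast
  have "(\<Inter>k. closure (E (k + m))) \<subseteq> (\<Inter>k. closure (E k))"
    using closure_mono[OF sub] by blast
  then show "pe_chain \<Omega> (\<lambda>k. E (k + m))" using assms by (auto simp: pe_chain_def)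
qed

definition chain_gap :: "'a::metric_space set \<Rightarrow> (nat \<Rightarrow> 'a set) \<Rightarrow> nat \<Rightarrow> real" where
  "chain_gap \<Omega> E k = dist_M \<Omega> (\<Omega> \<inter> frontier (E (Suc k))) (\<Omega> \<inter> frontier (E k))"

lemma chain_gap_pos: "pe_chain \<Omega> E \<Longrightarrow> 0 < chain_gap \<Omega> E k"
  by (simp add: pe_chain_def chain_gap_def)

subsection \<open>Domains in quasiconvex spaces\<close>

definition lip_component :: "'a::metric_space set \<Rightarrow> 'a \<Rightarrow> 'a set" where
  "lip_component A x = {y. \<exists>l. lip_joined A l x y}"

lemma lip_component_subset: "lip_component A x \<subseteq> A"
  unfolding lip_component_def using lip_joined_mem by blast

lemma lip_component_mono: "A \<subseteq> B \<Longrightarrow> lip_component A x \<subseteq> lip_component B x"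
  unfolding lip_component_def using lip_joined_mono by blast

lemma lip_component_eq: "y \<in> lip_component A x \<Longrightarrow> lip_component A y = lip_component A x"
  unfolding lip_component_def by (auto intro: lip_joined_trans lip_joined_sym)

lemma connected_lip_component: "connected (lip_component A x)"
  unfolding connected_iff_connected_component
proof (intro ballI)
  fix y z assume y: "y \<in> lip_component A x" and "z \<in> lip_component A x"
  then obtain l where "lip_joined A l y z"
    using lip_component_eq[OF y] unfolding lip_component_def by blast
  then obtain c where c: "0 \<le> l" "1-lipschitz_on {0..l} c" "c ` {0..l} \<subseteq> A" "c 0 = y" "c l = z"
    unfolding lip_joined_def lip_curve_def by blast
  have "c t \<in> lip_component A y" if "t \<in> {0..l}" for t
  proof -
    have "c ` {0..t} \<subseteq> c ` {0..l}" using that by (intro image_mono) auto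
    then have "lip_joined A (t - 0) (c 0) (c t)"
      using that c(3) by (intro lip_joined_segment lipschitz_on_subset[OF c(2)]) auto
    then show ?thesis unfolding c(4) lip_component_def by blast
  qed
  then have "c ` {0..l} \<subseteq> lip_component A x" using lip_component_eq[OF y] by blast
  then show "connected_component (lip_component A x) y z"
    using lipschitz_image_continuum(2)[OF c(2,1)] c(1,4,5)
    by (intro connected_componentI[of "c ` {0..l}"]) (auto intro: rev_image_eqI)
qed

lemma mazurkiewicz_le:
  assumes "compact K" "connected K" "K \<subseteq> \<Omega>" "x \<in> K" "y \<in> K"
  shows "mazurkiewicz \<Omega> x y \<le> diameter K"
  unfolding mazurkiewicz_def
proof (rule cInf_lower)
  show "bdd_below {diameter E |E. compact E \<and> connected E \<and> E \<subseteq> \<Omega> \<and> x \<in> E \<and> y \<in> E}"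
    by (intro bdd_belowI[of _ 0]) (auto intro!: diameter_ge_0 compact_imp_bounded)
qed (use assms in blast)

locale quasiconvex_domain =
  fixes \<Omega> :: "'a::metric_space set" and C :: real
  assumes C_ge_1: "1 \<le> C" and quasiconvex: "lip_joined (UNIV :: 'a set) (C * dist x y) x y"
    and open_domain: "open \<Omega>" and connected_domain: "connected \<Omega>"
begin

lemma lip_joined_in_ball:
  fixes x y :: 'a
  assumes "ball x r \<subseteq> A" "C * dist x y < r"
  shows "lip_joined A (C * dist x y) x y"
proof -
  obtain c where c: "0 \<le> C * dist x y" "1-lipschitz_on {0..C * dist x y} c" "c 0 = x" "c (C * dist x y) = y"
    using quasiconvex[of x y] unfolding lip_joined_def lip_curve_def by blast
  have "c t \<in> A" if "t \<in> {0..C * dist x y}" for t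
  proof -
    have "dist (c 0) (c t) \<le> t" using lipschitz_onD[OF c(2), of 0 t] that by (auto simp: dist_real_def)
    then show ?thesis using assms c(3) that by auto
  qed
  then show ?thesis using c unfolding lip_joined_def lip_curve_def by blast
qed

lemma ball_subset_lip_component:
  assumes "ball x r \<subseteq> A"
  shows "ball x (r / C) \<subseteq> lip_component A (x :: 'a)"
proof
  fix y assume "y \<in> ball x (r / C)"
  then have "C * dist x y < r" using C_ge_1 by (simp add: less_divide_eq mult.commute)
  then show "y \<in> lip_component A x" using lip_joined_in_ball[OF assms] by (auto simp: lip_component_def)
qed

lemma open_lip_component:
  assumes "open A"
  shows "open (lip_component A (x :: 'a))"
  unfolding open_contains_ball
proof
  fix y assume y: "y \<in> lip_component A x"
  then obtain r where r: "0 < r" "ball y r \<subseteq> A"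
    using assms lip_component_subset by (meson open_contains_ball subsetD)
  then show "\<exists>e>0. ball y e \<subseteq> lip_component A x"
    using ball_subset_lip_component[OF r(2)] lip_component_eq[OF y] C_ge_1
    by (intro exI[of _ "r / C"]) auto
qed

lemma lip_component_closed_in:
  assumes "open A" "y \<in> A" "y \<in> closure (lip_component A (x :: 'a))"
  shows "y \<in> lip_component A x"
proof -
  obtain r where r: "0 < r" "ball y r \<subseteq> A" using assms by (meson open_contains_ball)
  then have "0 < r / C" using C_ge_1 by simp
  then obtain z where z: "z \<in> lip_component A x" "z \<in> ball y (r / C)"
    using assms(3) unfolding closure_approachable by (auto simp: dist_commute)
  then have "z \<in> lip_component A y" using ball_subset_lip_component[OF r(2)] by blast
  then have "lip_component A y = lip_component A x"
    using lip_component_eq z(1) by blast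
  then show ?thesis using assms(2) lip_joined_refl[of y A 0] by (auto simp: lip_component_def)
qed

lemma frontier_lip_component:
  assumes "open A"
  shows "frontier (lip_component A (x :: 'a)) \<inter> A = {}"
  using lip_component_closed_in[OF assms] open_lip_component[OF assms]
  by (auto simp: frontier_def interior_open)

lemma lip_joined_connected:
  fixes x y :: 'a
  assumes "open A" "connected A" "x \<in> A" "y \<in> A"
  shows "\<exists>l. lip_joined A l x y"
proof (rule ccontr)
  assume "\<not> ?thesis"
  then have "y \<notin> lip_component A x" by (simp add: lip_component_def)
  moreover have "x \<in> lip_component A x"
    using assms lip_joined_refl[of x A 0] by (auto simp: lip_component_def)
  ultimately have "A \<inter> frontier (lip_component A x) \<noteq> {}"
    using assms by (intro connected_Int_frontier) auto
  then show False using frontier_lip_component[OF assms(1)] by blast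
qed

lemma dist_le_mazurkiewicz:
  assumes "x \<in> \<Omega>" "y \<in> \<Omega>"
  shows "dist x y \<le> mazurkiewicz \<Omega> x y"
  unfolding mazurkiewicz_def
proof (rule cInf_greatest)
  obtain l where "lip_joined \<Omega> l x y"
    using lip_joined_connected[OF open_domain connected_domain assms] by blast
  then obtain K where "compact K" "connected K" "K \<subseteq> \<Omega>" "x \<in> K" "y \<in> K"
    by (rule lip_joined_continuum)
  then show "{diameter E |E. compact E \<and> connected E \<and> E \<subseteq> \<Omega> \<and> x \<in> E \<and> y \<in> E} \<noteq> {}" by blast
qed (auto intro!: diameter_bounded_bound compact_imp_bounded)

lemma dist_M_le:
  assumes "A \<subseteq> \<Omega>" "B \<subseteq> \<Omega>" "x \<in> A" "y \<in> B"
  shows "dist_M \<Omega> A B \<le> mazurkiewicz \<Omega> x y"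
  unfolding dist_M_def
proof (rule cInf_lower)
  have "0 \<le> mazurkiewicz \<Omega> x y" if "x \<in> A" "y \<in> B" for x y
    using dist_le_mazurkiewicz[of x y] zero_le_dist[of x y] that assms(1,2) by (meson order_trans subsetD)
  then show "bdd_below {mazurkiewicz \<Omega> x y |x y. x \<in> A \<and> y \<in> B}"
    by (intro bdd_belowI[of _ 0]) auto
qed (use assms in blast)

lemma dist_M_ge:
  assumes "A \<noteq> {}" "B \<noteq> {}" "A \<subseteq> \<Omega>" "B \<subseteq> \<Omega>" and "\<And>x y. x \<in> A \<Longrightarrow> y \<in> B \<Longrightarrow> m \<le> dist x y"
  shows "m \<le> dist_M \<Omega> A B"
  unfolding dist_M_def
proof (rule cInf_greatest)
  fix d assume "d \<in> {mazurkiewicz \<Omega> x y |x y. x \<in> A \<and> y \<in> B}"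
  then obtain x y where "d = mazurkiewicz \<Omega> x y" "x \<in> A" "y \<in> B" by blast
  then show "m \<le> d" using assms dist_le_mazurkiewicz by (meson order_trans subsetD)
qed (use assms in blast)

lemma acceptable_frontier:
  assumes "acceptable \<Omega> E"
  shows "\<Omega> \<inter> frontier E \<noteq> {}"
proof -
  have "E \<noteq> {}" "E \<subset> \<Omega>" using assms by (auto simp: acceptable_def)
  then show ?thesis using connected_domain by (intro connected_Int_frontier) auto
qed

lemma chain_gap_le_diameter:
  assumes "compact K" "connected K" "K \<subseteq> \<Omega>"
    and "K \<inter> frontier (E (Suc k)) \<noteq> {}" "K \<inter> frontier (E k) \<noteq> {}"
  shows "chain_gap \<Omega> E k \<le> diameter K"
proof -
  obtain x y where xy: "x \<in> K \<inter> frontier (E (Suc k))" "y \<in> K \<inter> frontier (E k)" using assms(4,5) by blast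
  have "chain_gap \<Omega> E k \<le> mazurkiewicz \<Omega> x y"
    unfolding chain_gap_def using xy assms(3) by (intro dist_M_le) auto
  also have "\<dots> \<le> diameter K" using xy assms by (intro mazurkiewicz_le) auto
  finally show ?thesis .
qed

lemma chain_continuum_subset:
  assumes E: "pe_chain \<Omega> E" and K: "compact K" "connected K" "K \<subseteq> \<Omega>" "K \<inter> E (Suc k) \<noteq> {}"
    and diam: "diameter K < chain_gap \<Omega> E k"
  shows "K \<subseteq> E k"
proof (rule ccontr)
  assume not: "\<not> K \<subseteq> E k"
  have sub: "E (Suc k) \<subseteq> E k" using E by (simp add: pe_chain_def)
  have "K \<inter> frontier (E (Suc k)) \<noteq> {}" "K \<inter> frontier (E k) \<noteq> {}"
    using connected_Int_frontier[OF K(2)] K(4) not sub by blast+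
  then show False using chain_gap_le_diameter[OF K(1-3)] diam by (meson not_le)
qed

lemma chain_lip_joined:
  assumes E: "pe_chain \<Omega> E" and path: "lip_joined \<Omega> l x y" and mem: "x \<in> E (Suc k) \<or> y \<in> E (Suc k)"
    and l: "l < chain_gap \<Omega> E k"
  shows "lip_joined (E k) l x y"
proof -
  obtain c where c: "0 \<le> l" "1-lipschitz_on {0..l} c" "c ` {0..l} \<subseteq> \<Omega>" "c 0 = x" "c l = y"
    using path unfolding lip_joined_def lip_curve_def by blast
  have "x \<in> c ` {0..l}" "y \<in> c ` {0..l}" using c by (auto intro: rev_image_eqI)
  then have "c ` {0..l} \<subseteq> E k"
    using lipschitz_image_continuum[OF c(2,1)] c(3) mem l
    by (intro chain_continuum_subset[OF E]) auto
  then show ?thesis using c unfolding lip_joined_def lip_curve_def by blast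
qed

lemma chain_subset_interior:
  assumes E: "pe_chain \<Omega> E"
  shows "E (Suc k) \<subseteq> interior (E k)"
proof
  fix x assume x: "x \<in> E (Suc k)"
  have sub: "E (Suc k) \<subseteq> E k" using E by (simp add: pe_chain_def)
  show "x \<in> interior (E k)"
  proof (rule ccontr)
    assume "x \<notin> interior (E k)"
    then have "{x} \<inter> frontier (E (Suc k)) \<noteq> {}" "{x} \<inter> frontier (E k) \<noteq> {}"
      using x sub closure_subset interior_mono[OF sub] by (auto simp: frontier_def)
    then have "chain_gap \<Omega> E k \<le> diameter {x}"
      using x pe_chain_subset[OF E] by (intro chain_gap_le_diameter) auto
    then show False using chain_gap_pos[OF E, of k] by simp
  qed
qed

lemma eventually_pe_nhdsI:
  assumes e: "e \<in> pe_ends \<Omega>" "E \<in> e" and P: "\<And>y. y \<in> E n \<Longrightarrow> P y"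
  shows "eventually P (pe_nhds \<Omega> e)"
proof -
  have E: "pe_chain \<Omega> E" using e by (rule pe_end_chain)
  have "pe_nhds \<Omega> e \<le> principal (interior (E n))"
    unfolding pe_nhds_def
    using e(2) chain_subset_interior[OF E, of n] pe_chain_subset[OF E, of n] interior_subset[of "E n"]
    by (intro INF_lower) auto
  moreover have "eventually P (principal (interior (E n)))"
    unfolding eventually_principal using P interior_subset by blast
  ultimately show ?thesis by (rule filter_leD)
qed

end

subsection \<open>The end determined by a curve\<close>

context quasiconvex_domain
begin

context
  fixes \<Gamma> :: "real \<Rightarrow> 'a" and S :: real
  assumes S_pos: "0 < S" and \<Gamma>_lip: "1-lipschitz_on {0..S} \<Gamma>"
    and \<Gamma>_in: "\<Gamma> ` {0..<S} \<subseteq> \<Omega>" and \<Gamma>_end: "\<Gamma> S \<notin> \<Omega>"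
begin

definition tail_component :: "real \<Rightarrow> 'a set" where
  "tail_component r = (\<Union>t \<in> {t \<in> {0..<S}. S - t < r}. lip_component (\<Omega> \<inter> ball (\<Gamma> S) r) (\<Gamma> t))"

lemma tail_times:
  assumes "0 < r" "t < S"
  obtains s where "0 \<le> s" "t < s" "s < S" "S - s < r"
proof -
  obtain s where "max (max 0 t) (S - r) < s" "s < S"
    using assms S_pos dense[of "max (max 0 t) (S - r)" S] by auto
  then show ?thesis by (intro that[of s]) auto
qed

lemma curve_tail_in_ball:
  assumes "0 \<le> t" "t < S" "S - t < r"
  shows "\<Gamma> t \<in> \<Omega> \<inter> ball (\<Gamma> S) r"
proof -
  have "dist (\<Gamma> S) (\<Gamma> t) \<le> S - t"
    using lipschitz_onD[OF \<Gamma>_lip, of S t] assms by (simp add: dist_real_def)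
  then show ?thesis using \<Gamma>_in assms by auto
qed

lemma tail_component_eq:
  assumes t: "0 \<le> t" "t < S" "S - t < r"
  shows "tail_component r = lip_component (\<Omega> \<inter> ball (\<Gamma> S) r) (\<Gamma> t)"
proof -
  let ?A = "\<Omega> \<inter> ball (\<Gamma> S) r"
  have joined: "lip_joined ?A (b - a) (\<Gamma> a) (\<Gamma> b)" if "0 \<le> a" "a \<le> b" "b < S" "S - a < r" for a b
  proof (rule lip_joined_segment)
    show "1-lipschitz_on {a..b} \<Gamma>" using that by (intro lipschitz_on_subset[OF \<Gamma>_lip]) auto
    show "\<Gamma> ` {a..b} \<subseteq> ?A" using that by (intro image_subsetI curve_tail_in_ball) auto
  qed (rule that(2))
  have component_eq: "lip_component ?A (\<Gamma> s) = lip_component ?A (\<Gamma> t)" if "0 \<le> s" "s < S" "S - s < r" for s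
  proof (rule lip_component_eq)
    have "\<exists>l. lip_joined ?A l (\<Gamma> t) (\<Gamma> s)"
      using joined[of s t] joined[of t s] that t lip_joined_sym by (meson linear)
    then show "\<Gamma> s \<in> lip_component ?A (\<Gamma> t)" by (simp add: lip_component_def)
  qed
  show ?thesis
    unfolding tail_component_def
  proof (rule SUP_eq_const)
    show "{t \<in> {0..<S}. S - t < r} \<noteq> {}" using t by auto
    fix s assume "s \<in> {t \<in> {0..<S}. S - t < r}"
    then show "lip_component ?A (\<Gamma> s) = lip_component ?A (\<Gamma> t)" by (intro component_eq) auto
  qed
qed

lemma tail_component_obtain:
  assumes "0 < r"
  obtains t where "0 \<le> t" "t < S" "S - t < r" "tail_component r = lip_component (\<Omega> \<inter> ball (\<Gamma> S) r) (\<Gamma> t)"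
proof -
  obtain t where "0 \<le> t" "t < S" "S - t < r" using tail_times[OF assms S_pos] .
  then show ?thesis using tail_component_eq that by blast
qed

lemma tail_component_subset: "tail_component r \<subseteq> \<Omega> \<inter> ball (\<Gamma> S) r"
  unfolding tail_component_def using lip_component_subset by blast

lemma curve_tail_in_component:
  assumes "0 \<le> t" "t < S" "S - t < r"
  shows "\<Gamma> t \<in> tail_component r"
  unfolding tail_component_eq[OF assms]
  using lip_joined_refl[OF curve_tail_in_ball[OF assms] order_refl] unfolding lip_component_def by blast

lemma tail_component_mono:
  assumes "r \<le> r'"
  shows "tail_component r \<subseteq> tail_component r'"
proof -
  have "\<Omega> \<inter> ball (\<Gamma> S) r \<subseteq> \<Omega> \<inter> ball (\<Gamma> S) r'" using assms by auto
  then have "lip_component (\<Omega> \<inter> ball (\<Gamma> S) r) x \<subseteq> lip_component (\<Omega> \<inter> ball (\<Gamma> S) r') x" for x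
    by (rule lip_component_mono)
  then show ?thesis unfolding tail_component_def using assms by force
qed

lemma connected_tail_component:
  assumes "0 < r"
  shows "connected (tail_component r)"
proof -
  obtain t where eq: "tail_component r = lip_component (\<Omega> \<inter> ball (\<Gamma> S) r) (\<Gamma> t)"
    using tail_component_obtain[OF assms] .
  show ?thesis unfolding eq by (rule connected_lip_component)
qed

lemma endpoint_in_closure_tail_component:
  assumes "0 < r"
  shows "\<Gamma> S \<in> closure (tail_component r)"
  unfolding closure_approachable
proof (intro allI impI)
  fix e :: real assume "0 < e"
  then obtain t where "0 \<le> t" "t < S" "S - t < min r e"
    using tail_times[of "min r e" 0] assms S_pos by (metis min_less_iff_conj)
  then have "dist (\<Gamma> t) (\<Gamma> S) < e" "\<Gamma> t \<in> tail_component r"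
    using curve_tail_in_ball[of t e] curve_tail_in_component[of t r] by (auto simp: dist_commute)
  then show "\<exists>y\<in>tail_component r. dist y (\<Gamma> S) < e" by blast
qed

lemma endpoint_in_frontier: "\<Gamma> S \<in> frontier \<Omega>"
proof -
  have "closure (tail_component 1) \<subseteq> closure \<Omega>"
    using tail_component_subset[of 1] by (intro closure_mono) auto
  then have "\<Gamma> S \<in> closure \<Omega>" using endpoint_in_closure_tail_component[of 1] by auto
  then show ?thesis using \<Gamma>_end open_domain by (simp add: frontier_def interior_open)
qed

lemma closure_tail_component: "closure (tail_component r) \<subseteq> cball (\<Gamma> S) r"
  using tail_component_subset[of r] by (intro closure_minimal) auto

lemma frontier_tail_component:
  assumes "0 < r" "x \<in> \<Omega>" "x \<in> frontier (tail_component r)"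
  shows "dist (\<Gamma> S) x = r"
proof -
  obtain t where "tail_component r = lip_component (\<Omega> \<inter> ball (\<Gamma> S) r) (\<Gamma> t)"
    using tail_component_obtain[OF assms(1)] .
  then have "x \<notin> ball (\<Gamma> S) r"
    using frontier_lip_component[OF open_Int[OF open_domain open_ball], of "\<Gamma> S" r "\<Gamma> t"] assms(2,3)
    by auto
  moreover have "x \<in> cball (\<Gamma> S) r"
    using assms(3) closure_tail_component unfolding frontier_def by blast
  ultimately show ?thesis by simp
qed

lemma acceptable_tail_component:
  assumes "0 < r" "r \<le> dist (\<Gamma> S) (\<Gamma> 0)"
  shows "acceptable \<Omega> (tail_component r)"
  unfolding acceptable_def
proof (intro conjI)
  show "connected (tail_component r)" by (rule connected_tail_component[OF assms(1)])
  have "\<Gamma> 0 \<in> \<Omega>" using \<Gamma>_in S_pos by auto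
  moreover have "\<Gamma> 0 \<notin> tail_component r" using tail_component_subset[of r] assms(2) by auto
  ultimately show "tail_component r \<subset> \<Omega>" using tail_component_subset by blast
  show "closure (tail_component r) \<inter> frontier \<Omega> \<noteq> {}"
    using endpoint_in_closure_tail_component[OF assms(1)] endpoint_in_frontier by blast
qed

lemma tail_component_dist_M_pos:
  assumes "0 < r" "r < r'" "r' \<le> dist (\<Gamma> S) (\<Gamma> 0)"
  shows "0 < dist_M \<Omega> (\<Omega> \<inter> frontier (tail_component r)) (\<Omega> \<inter> frontier (tail_component r'))"
proof -
  have "r' - r \<le> dist_M \<Omega> (\<Omega> \<inter> frontier (tail_component r)) (\<Omega> \<inter> frontier (tail_component r'))"
  proof (rule dist_M_ge)
    fix x y assume "x \<in> \<Omega> \<inter> frontier (tail_component r)" "y \<in> \<Omega> \<inter> frontier (tail_component r')"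
    then have "dist (\<Gamma> S) x = r" "dist (\<Gamma> S) y = r'"
      using frontier_tail_component[of r x] frontier_tail_component[of r' y] assms by auto
    then show "r' - r \<le> dist x y" using dist_triangle[of "\<Gamma> S" y x] by simp
  next
    show "\<Omega> \<inter> frontier (tail_component r) \<noteq> {}" "\<Omega> \<inter> frontier (tail_component r') \<noteq> {}"
      using assms by (intro acceptable_frontier acceptable_tail_component; linarith)+
  qed auto
  then show ?thesis using assms(2) by simp
qed

lemma INT_closure_tail_component:
  assumes "\<And>l. 0 < r l" "r \<longlonglongrightarrow> 0"
  shows "(\<Inter>l. closure (tail_component (r l))) = {\<Gamma> S}"
proof
  show "(\<Inter>l. closure (tail_component (r l))) \<subseteq> {\<Gamma> S}"
  proof
    fix x assume x: "x \<in> (\<Inter>l. closure (tail_component (r l)))"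
    have "dist (\<Gamma> S) x \<le> r l" for l using x closure_tail_component[of "r l"] by auto
    then have "dist (\<Gamma> S) x \<le> 0" by (intro LIMSEQ_le_const[OF assms(2)]) auto
    then show "x \<in> {\<Gamma> S}" by simp
  qed
qed (use endpoint_in_closure_tail_component assms(1) in blast)

lemma pe_chain_tail_component:
  assumes r: "\<And>l. 0 < r l" "\<And>l. r (Suc l) < r l" "r \<longlonglongrightarrow> 0" "r 0 \<le> dist (\<Gamma> S) (\<Gamma> 0)"
  shows "pe_chain \<Omega> (\<lambda>l. tail_component (r l))"
proof -
  have "r l \<le> r 0" for l
    by (rule lift_Suc_antimono_le[of r]) (use r(2) in \<open>auto intro: less_imp_le\<close>)
  then have le: "r l \<le> dist (\<Gamma> S) (\<Gamma> 0)" for l using r(4) order_trans by blast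
  have acc: "acceptable \<Omega> (tail_component (r l))" for l
    using r(1) le by (intro acceptable_tail_component)
  show ?thesis
    unfolding pe_chain_def INT_closure_tail_component[OF r(1,3)]
    using r le acc endpoint_in_frontier
    by (auto intro!: tail_component_dist_M_pos simp: less_imp_le tail_component_mono)
qed

lemma tail_component_divides:
  assumes E: "pe_chain \<Omega> E" and tail: "\<And>k. \<exists>t\<in>{0<..<S}. \<Gamma> ` {t<..<S} \<subseteq> E k"
    and r: "\<And>l. 0 < r l" "r \<longlonglongrightarrow> 0"
  shows "chain_divides (\<lambda>l. tail_component (r l)) E"
  unfolding chain_divides_def
proof
  fix k
  have "\<forall>\<^sub>F l in sequentially. 2 * r l < chain_gap \<Omega> E k"
    using tendsto_mult_right_zero[OF r(2), of 2] chain_gap_pos[OF E] by (intro order_tendstoD) auto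
  then obtain l where l: "2 * r l < chain_gap \<Omega> E k" by (meson eventually_happens sequentially_bot)
  obtain t where t: "t \<in> {0<..<S}" "\<Gamma> ` {t<..<S} \<subseteq> E (Suc k)" using tail by blast
  obtain s where s: "0 \<le> s" "t < s" "s < S" "S - s < r l"
    using tail_times[OF r(1), of t] t(1) by auto
  have "y \<in> E k" if "y \<in> tail_component (r l)" for y
  proof -
    obtain m where "lip_joined (\<Omega> \<inter> ball (\<Gamma> S) (r l)) m (\<Gamma> s) y"
      using \<open>y \<in> tail_component (r l)\<close> tail_component_eq[OF s(1,3,4)] by (auto simp: lip_component_def)
    then obtain K where K: "compact K" "connected K" "K \<subseteq> \<Omega> \<inter> ball (\<Gamma> S) (r l)" "\<Gamma> s \<in> K" "y \<in> K"
      by (rule lip_joined_continuum)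
    have "diameter K \<le> 2 * r l"
    proof (rule diameter_leI)
      fix a b assume "a \<in> K" "b \<in> K"
      then have "dist (\<Gamma> S) a < r l" "dist (\<Gamma> S) b < r l" using K(3) by auto
      then show "dist a b \<le> 2 * r l" using dist_triangle3[of a b "\<Gamma> S"] by linarith
    qed (use K in auto)
    moreover have "\<Gamma> s \<in> E (Suc k)" using t(2) s by (auto simp: image_subset_iff)
    ultimately have "K \<subseteq> E k" using K l by (intro chain_continuum_subset[OF E]) auto
    then show ?thesis using K(5) by blast
  qed
  then show "\<exists>l. tail_component (r l) \<subseteq> E k" by blast
qed

end

lemma chain_tail_endpoint:
  fixes S :: real
  assumes E: "pe_chain \<Omega> E" and \<Gamma>: "continuous_on {0..S} \<Gamma>"
    and tail: "\<And>k. \<exists>t\<in>{0<..<S}. \<Gamma> ` {t<..<S} \<subseteq> E k"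
  shows "\<Gamma> S \<in> frontier \<Omega>"
proof -
  have "\<Gamma> S \<in> closure (E k)" for k
  proof -
    obtain t where t: "0 < t" "t < S" "\<Gamma> ` {t<..<S} \<subseteq> E k" using tail[of k] by auto
    have "\<Gamma> ` closure {t<..<S} \<subseteq> closure (E k)"
      using t closure_subset[of "E k"] by (intro image_closure_subset continuous_on_subset[OF \<Gamma>]) auto
    then show ?thesis using t by auto
  qed
  then show ?thesis using E unfolding pe_chain_def by blast
qed

text \<open>The components of \<open>\<Omega> \<inter> ball (\<Gamma> S) r\<close> containing the end of \<open>\<Gamma>\<close> form a chain with impression
  \<open>{\<Gamma> S}\<close> that divides the given prime end, hence represents it.\<close>

lemma impression_eq_endpoint:
  fixes S :: real
  assumes e: "e \<in> prime_ends \<Omega>" "E \<in> e" and \<Gamma>: "0 < S" "1-lipschitz_on {0..S} \<Gamma>" "\<Gamma> ` {0..<S} \<subseteq> \<Omega>"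
    and tail: "\<And>k. \<exists>t\<in>{0<..<S}. \<Gamma> ` {t<..<S} \<subseteq> E k"
  shows "impression e = {\<Gamma> S}"
proof -
  have end_e: "e \<in> pe_ends \<Omega>" using e(1) by (simp add: prime_ends_def)
  have E: "pe_chain \<Omega> E" using end_e e(2) by (rule pe_end_chain)
  have "\<Gamma> S \<in> frontier \<Omega>"
    using E lipschitz_on_continuous_on[OF \<Gamma>(2)] tail by (rule chain_tail_endpoint)
  then have "\<Gamma> S \<notin> \<Omega>" using open_domain by (simp add: frontier_def interior_open)
  define r where "r l = dist (\<Gamma> S) (\<Gamma> 0) / real (Suc l)" for l
  have "\<Gamma> 0 \<in> \<Omega>" using \<Gamma> by auto
  then have "0 < dist (\<Gamma> S) (\<Gamma> 0)" using \<open>\<Gamma> S \<notin> \<Omega>\<close> by auto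
  then have r: "0 < r l" "r (Suc l) < r l" "r 0 \<le> dist (\<Gamma> S) (\<Gamma> 0)" for l
    by (auto simp: r_def field_simps)
  have "r \<longlonglongrightarrow> 0" unfolding r_def using LIMSEQ_Suc[OF lim_const_over_n] by blast
  note tail_facts = \<Gamma> \<open>\<Gamma> S \<notin> \<Omega>\<close>
  have "(\<lambda>l. tail_component \<Gamma> S (r l)) \<in> e"
    using pe_chain_tail_component[OF tail_facts r(1,2) \<open>r \<longlonglongrightarrow> 0\<close> r(3)]
      tail_component_divides[OF tail_facts E tail r(1) \<open>r \<longlonglongrightarrow> 0\<close>]
    by (intro prime_end_dividing_chain[OF e])
  then show ?thesis
    using impression_eq[OF end_e] INT_closure_tail_component[OF tail_facts r(1) \<open>r \<longlonglongrightarrow> 0\<close>] by simp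
qed

lemma rect_accessibleI:
  fixes S :: real
  assumes e: "e \<in> prime_ends \<Omega>" "E \<in> e" and \<Gamma>: "0 < S" "1-lipschitz_on {0..S} \<Gamma>" "\<Gamma> ` {0..<S} \<subseteq> \<Omega>"
    and tail: "\<And>k. \<exists>t\<in>{0<..<S}. \<Gamma> ` {t<..<S} \<subseteq> E k"
  shows "e \<in> rect_accessible_prime_ends \<Omega>"
proof -
  have imp: "impression e = {\<Gamma> S}" using assms by (rule impression_eq_endpoint)
  define \<gamma> where "\<gamma> t = \<Gamma> (S * t)" for t
  have "(\<lambda>t. S * t + 0) ` {0..1} \<subseteq> {0..S}" using \<Gamma>(1) by (auto simp: mult_left_le)
  from lipschitz_on_compose_affine[OF \<Gamma>(2) this] have "rectifiable_curve \<gamma>"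
    by (auto simp: \<gamma>_def[abs_def] intro: lipschitz_imp_rectifiable_curve)
  moreover have "\<gamma> ` {0..<1} \<subseteq> \<Omega>" using \<Gamma>(1,3) by (auto simp: \<gamma>_def image_subset_iff)
  moreover have "impression e = {\<gamma> 1}" using imp by (simp add: \<gamma>_def)
  moreover have "\<exists>t\<in>{0<..<1}. \<gamma> ` {t<..<1} \<subseteq> E k" for k
  proof -
    obtain t where "t \<in> {0<..<S}" "\<Gamma> ` {t<..<S} \<subseteq> E k" using tail by blast
    then show ?thesis
      using \<Gamma>(1) by (intro bexI[of _ "t / S"]) (auto simp: \<gamma>_def image_subset_iff field_simps)
  qed
  ultimately show ?thesis
    unfolding rect_accessible_prime_ends_def singleton_prime_ends_def using e imp by blast
qed

end

subsection \<open>Limits of curves entering a chain\<close>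

definition last_exit :: "(real \<Rightarrow> 'a) \<Rightarrow> real \<Rightarrow> 'a set \<Rightarrow> real" where
  "last_exit c T A = Sup {t \<in> {0..T}. c t \<notin> A}"

lemma bdd_above_exit_times: "bdd_above {t \<in> {0..T :: real}. c t \<notin> A}"
  by (rule bdd_aboveI[of _ T]) auto

context
  fixes c :: "real \<Rightarrow> 'a" and T :: real and A :: "'a set"
  assumes T_nonneg: "0 \<le> T" and start_outside: "c 0 \<notin> A"
begin

lemma last_exit_bounds: "0 \<le> last_exit c T A" "last_exit c T A \<le> T"
  unfolding last_exit_def using T_nonneg start_outside
  by (auto intro!: cSup_upper bdd_above_exit_times cSup_least)

lemma after_last_exit:
  assumes "last_exit c T A < t" "t \<le> T"
  shows "c t \<in> A"
proof (rule ccontr)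
  assume "c t \<notin> A"
  then have "t \<le> last_exit c T A"
    unfolding last_exit_def using assms last_exit_bounds(1)
    by (intro cSup_upper bdd_above_exit_times) auto
  then show False using assms(1) by simp
qed

end

lemma last_exit_antimono:
  assumes "0 \<le> T" "c 0 \<notin> B" "A \<subseteq> B"
  shows "last_exit c T B \<le> last_exit c T A"
  unfolding last_exit_def using assms
  by (intro cSup_subset_mono bdd_above_exit_times) auto

lemma last_exit_in_frontier:
  fixes c :: "real \<Rightarrow> 'a::topological_space"
  assumes T: "0 \<le> T" and c: "continuous_on {0..T} c" "c 0 \<notin> A" "c T \<in> A"
  shows "c (last_exit c T A) \<in> frontier A"
proof -
  let ?s = "last_exit c T A" and ?B = "{t \<in> {0..T}. c t \<notin> A}"
  have s: "0 \<le> ?s" "?s \<le> T" using last_exit_bounds[of T c A] T c(2) by auto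
  have closure_B: "closure ?B \<subseteq> {0..T}" by (intro closure_minimal) auto
  have "?s \<in> closure ?B"
    unfolding last_exit_def using T c(2) by (intro closure_contains_Sup bdd_above_exit_times) auto
  moreover have "c ` closure ?B \<subseteq> closure (- A)"
    using closure_subset[of "- A"]
    by (intro image_closure_subset continuous_on_subset[OF c(1) closure_B]) auto
  ultimately have "c ?s \<in> closure (- A)" by blast
  moreover have "c ?s \<in> closure A"
  proof (cases "?s < T")
    case True
    have "c ` closure {?s<..<T} \<subseteq> closure A"
      using s True closure_subset[of A] after_last_exit[of T c A] T c(2)
      by (intro image_closure_subset continuous_on_subset[OF c(1)]) auto
    then show ?thesis using True by auto
  next
    case False
    then show ?thesis using s(2) c(3) closure_subset by fastforce
  qed
  ultimately show ?thesis by (simp add: frontier_closures)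
qed

lemma diagonal_convergent_subsequence:
  fixes f :: "nat \<Rightarrow> nat \<Rightarrow> 'a::metric_space"
  assumes K: "\<And>k. compact (K k)" and f: "\<And>n k. k < n \<Longrightarrow> f n k \<in> K k"
  obtains \<phi> w where "strict_mono \<phi>" "\<And>k. w k \<in> K k" "\<And>k. (\<lambda>n. f (\<phi> n) k) \<longlonglongrightarrow> w k"
proof -
  define W where "W n k = f (max n (Suc k)) k" for n k
  have "compact (PiE UNIV K)" by (rule compact_PiE_UNIV[OF K])
  moreover have "W n \<in> PiE UNIV K" for n
    using f by (auto simp: W_def less_max_iff_disj)
  ultimately obtain w \<phi> where w: "w \<in> PiE UNIV K" "strict_mono \<phi>" "(W \<circ> \<phi>) \<longlonglongrightarrow> w"
    unfolding compact_eq_seq_compact_metric seq_compact_def by meson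
  have "(\<lambda>n. f (\<phi> n) k) \<longlonglongrightarrow> w k" for k
  proof (rule Lim_transform_eventually)
    have "continuous_on UNIV (\<lambda>g :: nat \<Rightarrow> 'a. g k)" by (rule continuous_on_product_coordinates)
    then have "isCont (\<lambda>g :: nat \<Rightarrow> 'a. g k) w"
      using continuous_on_eq_continuous_at[OF open_UNIV] by blast
    then show "(\<lambda>n. W (\<phi> n) k) \<longlonglongrightarrow> w k" using isCont_tendsto_compose[OF _ w(3)] by (simp add: o_def)
    have "\<forall>\<^sub>F n in sequentially. Suc k \<le> \<phi> n"
      using filterlim_subseq[OF w(2)] by (simp add: filterlim_at_top)
    then show "\<forall>\<^sub>F n in sequentially. W (\<phi> n) k = f (\<phi> n) k"
      by eventually_elim (simp add: W_def max_absorb1)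
  qed
  with w show ?thesis by (intro that[of \<phi> w]) auto
qed

lemma lipschitz_on_segments:
  fixes s :: "nat \<Rightarrow> real"
  assumes s: "\<And>k. s k \<le> s (Suc k)" "s \<longlonglongrightarrow> S" and lip: "\<And>k. L-lipschitz_on {s k..s (Suc k)} f"
  shows "L-lipschitz_on {s 0..<S} f"
proof (rule lipschitz_onI)
  have initial: "L-lipschitz_on {s 0..s k} f" for k
  proof (induction k)
    case 0
    then show ?case using lipschitz_on_nonneg[OF lip[of 0]] by (auto intro!: lipschitz_onI)
  next
    case (Suc k)
    then show ?case using lipschitz_on_concat[OF Suc lip refl] by simp
  qed
  fix x y assume xy: "x \<in> {s 0..<S}" "y \<in> {s 0..<S}"
  have "\<forall>\<^sub>F k in sequentially. max x y < s k" using xy by (intro order_tendstoD(1)[OF s(2)]) auto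
  then obtain k where "max x y < s k" by (meson eventually_happens sequentially_bot)
  then show "dist (f x) (f y) \<le> L * dist x y" using xy by (intro lipschitz_onD[OF initial[of k]]) auto
qed (rule lipschitz_on_nonneg[OF lip])

lemma segment_containing_exists:
  fixes s :: "nat \<Rightarrow> real"
  assumes "s \<longlonglongrightarrow> S" "s k \<le> t" "t < S"
  shows "\<exists>j\<ge>k. s j \<le> t \<and> t < s (Suc j)"
proof (rule ccontr)
  assume none: "\<not> ?thesis"
  have below: "s j \<le> t" if "k \<le> j" for j
    using that
  proof (induction j rule: dec_induct)
    case (step j)
    then show ?case using none not_less by blast
  qed (rule assms(2))
  have "\<forall>\<^sub>F j in sequentially. t < s j" by (rule order_tendstoD(1)[OF assms(1,3)])
  then obtain j where "k \<le> j" "t < s j" unfolding eventually_sequentially by (meson nle_le)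
  then show False using below[of j] by simp
qed

lemma lip_joined_sequence_curve:
  fixes z :: "nat \<Rightarrow> 'a::metric_space" and l :: "nat \<Rightarrow> real"
  assumes l: "\<And>k. 0 < l k" and joined: "\<And>k. lip_joined (A k) (l k) (z k) (z (Suc k))"
  defines "s \<equiv> \<lambda>k. \<Sum>i<k. l i"
  obtains \<Gamma> where "\<And>k. 1-lipschitz_on {s k..s (Suc k)} \<Gamma>" "\<And>k. \<Gamma> ` {s k..s (Suc k)} \<subseteq> A k"
proof -
  obtain c where c: "\<And>k. 1-lipschitz_on {0..l k} (c k)" "\<And>k. c k ` {0..l k} \<subseteq> A k"
    "\<And>k. c k 0 = z k" "\<And>k. c k (l k) = z (Suc k)"
    using joined unfolding lip_joined_def lip_curve_def by metis
  have s_Suc: "s (Suc k) = s k + l k" for k by (simp add: s_def)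
  have "strict_mono s" by (rule strict_monoI_Suc) (simp add: s_Suc l)
  define \<Gamma> where "\<Gamma> t = (let k = LEAST k. t < s (Suc k) in c k (t - s k))" for t
  have inner: "\<Gamma> t = c k (t - s k)" if "s k \<le> t" "t < s (Suc k)" for k t
  proof -
    have "(LEAST k. t < s (Suc k)) = k"
    proof (rule Least_equality)
      fix j assume "t < s (Suc j)"
      then have "s k < s (Suc j)" using that(1) by simp
      then show "k \<le> j" using \<open>strict_mono s\<close> by (simp add: strict_mono_less)
    qed (rule that(2))
    then show ?thesis by (simp add: \<Gamma>_def)
  qed
  have seg: "\<Gamma> t = c k (t - s k)" if "t \<in> {s k..s (Suc k)}" for k t
  proof (cases "t = s (Suc k)")
    case True
    have "\<Gamma> (s (Suc k)) = c (Suc k) 0" using inner[of "Suc k" "s (Suc k)"] l by (simp add: s_Suc)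
    then show ?thesis using True c(3,4) by (simp add: s_Suc)
  qed (use inner that in auto)
  show ?thesis
  proof
    fix k
    show "\<Gamma> ` {s k..s (Suc k)} \<subseteq> A k" using c(2)[of k] by (auto simp: seg s_Suc image_subset_iff)
    have "1-lipschitz_on {s k..s (Suc k)} (\<lambda>t. c k (t - s k))"
      using lipschitz_on_compose_affine[OF c(1), of 1 "- s k" "{s k..s (Suc k)}" k] by (force simp: s_Suc)
    then show "1-lipschitz_on {s k..s (Suc k)} \<Gamma>" by (rule lipschitz_on_transform) (simp add: seg)
  qed
qed

lemma lip_joined_infinite_concat:
  fixes z :: "nat \<Rightarrow> 'a::complete_space" and l :: "nat \<Rightarrow> real"
  assumes l: "\<And>k. 0 < l k" "summable l" and joined: "\<And>k. lip_joined (A k) (l k) (z k) (z (Suc k))"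
    and A: "\<And>k. A (Suc k) \<subseteq> A k"
  obtains \<Gamma> S where "1-lipschitz_on {0..S} \<Gamma>" "\<And>k. (\<Sum>i<k. l i) < S" "\<And>k. \<Gamma> ` {\<Sum>i<k. l i..<S} \<subseteq> A k"
proof -
  define s where "s k = (\<Sum>i<k. l i)" for k
  define S where "S = suminf l"
  obtain \<Gamma>0 where \<Gamma>0: "\<And>k. 1-lipschitz_on {s k..s (Suc k)} \<Gamma>0" "\<And>k. \<Gamma>0 ` {s k..s (Suc k)} \<subseteq> A k"
    using lip_joined_sequence_curve[of l A z, OF l(1) joined] unfolding s_def by blast
  have lim: "s \<longlonglongrightarrow> S" unfolding s_def S_def using l(2) by (rule summable_LIMSEQ)
  have "1-lipschitz_on {s 0..<S} \<Gamma>0"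
    using l(1) by (intro lipschitz_on_segments[OF _ lim \<Gamma>0(1)]) (simp add: s_def less_imp_le)
  then obtain \<Gamma> where \<Gamma>: "1-lipschitz_on (closure {0..<S}) \<Gamma>" "\<And>x. x \<in> {0..<S} \<Longrightarrow> \<Gamma> x = \<Gamma>0 x"
    using lipschitz_extend_closure by (fastforce simp: s_def)
  have less: "s k < S" for k unfolding s_def S_def using l by (intro sum_less_suminf)
  show ?thesis
  proof (rule that)
    show "1-lipschitz_on {0..S} \<Gamma>" using \<Gamma>(1) less[of 0] by (simp add: s_def)
    show "(\<Sum>i<k. l i) < S" for k using less[of k] by (simp add: s_def)
    have "\<Gamma> t \<in> A k" if t: "s k \<le> t" "t < S" for t k
    proof -
      obtain j where j: "k \<le> j" "s j \<le> t" "t < s (Suc j)"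
        using segment_containing_exists[OF lim t] by blast
      have "0 \<le> t" using t(1) l(1) sum_nonneg[of "{..<k}" l] by (simp add: s_def less_imp_le)
      then have "\<Gamma> t = \<Gamma>0 t" using \<Gamma>(2) t(2) by simp
      also have "\<Gamma>0 t \<in> A j" using \<Gamma>0(2)[of j] j by auto
      also have "A j \<subseteq> A k" using j(1) A by (rule lift_Suc_antimono_le[rotated])
      finally show ?thesis .
    qed
    then show "\<Gamma> ` {\<Sum>i<k. l i..<S} \<subseteq> A k" for k by (auto simp: s_def)
  qed
qed

context quasiconvex_domain
begin

lemma last_exit_chain_gap:
  assumes E: "pe_chain \<Omega> E" and c: "lip_curve \<Omega> T c" "c 0 \<notin> E k" "c T \<in> E (Suc k)"
  shows "last_exit c T (E k) + chain_gap \<Omega> E k \<le> last_exit c T (E (Suc k))"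
proof -
  let ?s = "last_exit c T (E k)" and ?s' = "last_exit c T (E (Suc k))"
  have sub: "E (Suc k) \<subseteq> E k" using E by (simp add: pe_chain_def)
  have T: "0 \<le> T" and lip: "1-lipschitz_on {0..T} c" using c(1) by (auto simp: lip_curve_def)
  have ss': "0 \<le> ?s" "?s \<le> ?s'" "?s' \<le> T"
    using last_exit_bounds[of T c "E k"] last_exit_bounds[of T c "E (Suc k)"]
      last_exit_antimono[of T c "E k" "E (Suc k)"] T c(2) sub by auto
  have image: "1-lipschitz_on {?s..?s'} c" "c ` {?s..?s'} \<subseteq> \<Omega>"
    using c(1) ss' by (auto intro: lipschitz_on_subset[OF lip] lip_curve_mem)
  have "c ?s \<in> c ` {?s..?s'} \<inter> frontier (E k)" "c ?s' \<in> c ` {?s..?s'} \<inter> frontier (E (Suc k))"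
    using ss'(2) c sub lip_curve_continuous[OF c(1)] by (auto intro!: last_exit_in_frontier T)
  then have "chain_gap \<Omega> E k \<le> diameter (c ` {?s..?s'})"
    using lipschitz_image_continuum[OF image(1) ss'(2)] image(2)
    by (intro chain_gap_le_diameter) blast+
  also have "\<dots> \<le> ?s' - ?s" by (rule lipschitz_image_continuum(3)[OF image(1) ss'(2)])
  finally show ?thesis by simp
qed

lemma chain_visiting_times:
  assumes E: "pe_chain \<Omega> E" and c: "lip_curve \<Omega> T c" "c 0 \<notin> E 0" "c T \<in> E n"
    and visit: "\<And>k s s'. 0 \<le> s \<Longrightarrow> s + chain_gap \<Omega> E k \<le> s' \<Longrightarrow> s' \<le> T \<Longrightarrow> \<exists>t\<in>{s<..<s'}. P k (c t)"
  shows "\<exists>t. (\<forall>k<n. t k \<in> {0..T} \<and> P k (c (t k)) \<and> c ` {t k..T} \<subseteq> E k) \<and>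
    (\<forall>k. Suc k < n \<longrightarrow> t k \<le> t (Suc k))"
proof -
  define s where "s k = last_exit c T (E k)" for k
  have T: "0 \<le> T" using c(1) by (simp add: lip_curve_def)
  have start: "c 0 \<notin> E k" for k using c(2) pe_chain_decreasing[OF E, of 0 k] by blast
  have finish: "c T \<in> E k" if "k \<le> n" for k using c(3) pe_chain_decreasing[OF E that] by blast
  have s: "0 \<le> s k" "s k \<le> T" for k unfolding s_def using last_exit_bounds[of T c "E k"] T start by auto
  have "\<exists>t\<in>{s k<..<s (Suc k)}. P k (c t)" if "k < n" for k
    using that s start finish[of "Suc k"] unfolding s_def
    by (intro visit last_exit_chain_gap[OF E c(1)]) auto
  then obtain t where t: "\<And>k. k < n \<Longrightarrow> s k < t k" "\<And>k. k < n \<Longrightarrow> t k < s (Suc k)"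
    "\<And>k. k < n \<Longrightarrow> P k (c (t k))"
    unfolding Bex_def greaterThanLessThan_iff by metis
  have "t k \<in> {0..T}" "c ` {t k..T} \<subseteq> E k" if "k < n" for k
    using t(1,2)[OF that] s(1)[of k] s(2)[of "Suc k"] after_last_exit[of T c "E k"] T start
    by (auto simp: s_def)
  moreover have "t k \<le> t (Suc k)" if "Suc k < n" for k using t(2)[of k] t(1)[of "Suc k"] that by simp
  ultimately show ?thesis using t(3) by (intro exI[of _ t]) blast
qed

lemma eventually_joined_to_limit:
  assumes E: "pe_chain \<Omega> E" and a: "a \<in> \<Omega>" "x \<longlonglongrightarrow> a" "\<forall>\<^sub>F n in sequentially. x n \<in> E (Suc k)"
    and "0 < \<eta>"
  shows "\<forall>\<^sub>F n in sequentially. lip_joined (E k) \<eta> a (x n)"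
proof -
  obtain \<rho> where \<rho>: "0 < \<rho>" "ball a \<rho> \<subseteq> \<Omega>" using a(1) open_domain by (meson open_contains_ball)
  have "(\<lambda>n. C * dist a (x n)) \<longlonglongrightarrow> C * dist a a" using a(2) by (intro tendsto_intros)
  then have "\<forall>\<^sub>F n in sequentially. C * dist a (x n) < min \<rho> (min \<eta> (chain_gap \<Omega> E k))"
    using \<rho>(1) \<open>0 < \<eta>\<close> chain_gap_pos[OF E, of k] by (intro order_tendstoD(2)) auto
  with a(3) show ?thesis
  proof eventually_elim
    case (elim n)
    then have "lip_joined \<Omega> (C * dist a (x n)) a (x n)" by (intro lip_joined_in_ball[OF \<rho>(2)]) simp
    then have "lip_joined (E k) (C * dist a (x n)) a (x n)"
      using elim by (intro chain_lip_joined[OF E]) auto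
    then show ?case using elim(2) by (auto elim: lip_joined_lengthen)
  qed
qed

lemma limit_lip_joined:
  assumes E: "pe_chain \<Omega> E" and a: "a \<in> \<Omega>" "x \<longlonglongrightarrow> a" and b: "b \<in> \<Omega>" "y \<longlonglongrightarrow> b" and m: "m \<longlonglongrightarrow> l"
    and joined: "\<forall>\<^sub>F n in sequentially. lip_joined (E (Suc k)) (m n) (x n) (y n)" and "0 < \<epsilon>"
  shows "lip_joined (E k) (l + \<epsilon>) a b"
proof -
  have x: "\<forall>\<^sub>F n in sequentially. x n \<in> E (Suc k)" and y: "\<forall>\<^sub>F n in sequentially. y n \<in> E (Suc k)"
    by (rule eventually_mono[OF joined], use lip_joined_mem in blast)+
  have third: "0 < \<epsilon> / 3" using \<open>0 < \<epsilon>\<close> by simp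
  have "\<forall>\<^sub>F n in sequentially. m n < l + \<epsilon> / 3" using third by (intro order_tendstoD(2)[OF m]) simp
  with eventually_joined_to_limit[OF E a x third] eventually_joined_to_limit[OF E b y third] joined
  have "\<forall>\<^sub>F n in sequentially. lip_joined (E k) (l + \<epsilon>) a b"
  proof eventually_elim
    case (elim n)
    have "lip_joined (E k) (m n) (x n) (y n)"
      using elim(3) pe_chain_decreasing[OF E, of k "Suc k"] by (auto elim: lip_joined_mono)
    then have "lip_joined (E k) (\<epsilon> / 3 + m n + \<epsilon> / 3) a b"
      using elim(1) lip_joined_sym[OF elim(2)] by (blast intro: lip_joined_trans)
    then show ?case using elim(4) by (auto elim: lip_joined_lengthen)
  qed
  then show ?thesis by (simp add: eventually_const_iff)
qed

end

locale bounded_domain = quasiconvex_domain \<Omega> C for \<Omega> :: "'a::complete_space set" and C :: real +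
  assumes proper: "\<And>S :: 'a set. closed S \<Longrightarrow> bounded S \<Longrightarrow> compact S"
    and bounded: "bounded \<Omega>" and not_UNIV: "\<Omega> \<noteq> UNIV"
begin

abbreviation bdist :: "'a \<Rightarrow> real" where "bdist x \<equiv> infdist x (- \<Omega>)"

definition uniformly_visits_interior :: "(nat \<Rightarrow> real) \<Rightarrow> (nat \<Rightarrow> real \<Rightarrow> 'a) \<Rightarrow> bool" where
  "uniformly_visits_interior T c \<longleftrightarrow> (\<forall>\<delta>>0. \<exists>r>0. \<forall>n s s'. 0 \<le> s \<longrightarrow> s + \<delta> \<le> s' \<longrightarrow> s' \<le> T n \<longrightarrow>
    (\<exists>t\<in>{s<..<s'}. r \<le> bdist (c n t)))"

lemma mem_iff_bdist_pos: "x \<in> \<Omega> \<longleftrightarrow> 0 < bdist x"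
proof -
  have "closed (- \<Omega>)" "- \<Omega> \<noteq> {}" using open_domain not_UNIV by auto
  then show ?thesis using in_closed_iff_infdist_zero[of "- \<Omega>" x] infdist_nonneg[of x "- \<Omega>"] by auto
qed

lemma bdist_borel [measurable]: "bdist \<in> borel_measurable borel"
  by (intro borel_measurable_continuous_onI continuous_intros)

lemma compact_bdist_ge:
  assumes "0 < r"
  shows "compact {x. r \<le> bdist x}"
proof (rule proper)
  show "closed {x. r \<le> bdist x}" by (intro closed_Collect_le continuous_intros)
  show "bounded {x. r \<le> bdist x}"
    using assms by (intro bounded_subset[OF bounded]) (auto simp: mem_iff_bdist_pos)
qed

lemma rect_accessible_if_joined_sequence:
  assumes e: "e \<in> prime_ends \<Omega>" "E \<in> e" and \<theta>: "\<And>k. \<theta> k \<le> \<theta> (Suc k)" "\<And>k. \<theta> k \<le> M"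
    and joined: "\<And>k \<epsilon>. 0 < \<epsilon> \<Longrightarrow> lip_joined (E k) (\<theta> (Suc k) - \<theta> k + \<epsilon>) (z k) (z (Suc k))"
  shows "e \<in> rect_accessible_prime_ends \<Omega>"
proof -
  have E: "pe_chain \<Omega> E" using e by (auto simp: prime_ends_def intro: pe_end_chain)
  define l where "l k = \<theta> (Suc k) - \<theta> k + (1/2)^k" for k
  have l: "0 < l k" for k using \<theta>(1)[of k] by (simp add: l_def add_nonneg_pos)
  have summable: "summable l"
  proof (rule summableI_nonneg_bounded)
    show "0 \<le> l k" for k using l[of k] by simp
    fix n
    have "(\<Sum>k<n. l k) = \<theta> n - \<theta> 0 + (\<Sum>k<n. (1/2)^k)"
      by (simp add: l_def sum.distrib sum_lessThan_telescope)
    also have "(\<Sum>k<n. (1/2::real)^k) \<le> 2"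
      using sum_le_suminf[of "\<lambda>k. (1/2::real)^k" "{..<n}"] by (simp add: suminf_geometric summable_geometric)
    finally show "(\<Sum>k<n. l k) \<le> M - \<theta> 0 + 2" using \<theta>(2)[of n] by simp
  qed
  have "lip_joined (E k) (l k) (z k) (z (Suc k))" for k
    unfolding l_def by (rule joined) simp
  moreover have "E (Suc k) \<subseteq> E k" for k using E by (simp add: pe_chain_def)
  ultimately obtain \<Gamma> S where \<Gamma>: "1-lipschitz_on {0..S} \<Gamma>" "\<And>k. (\<Sum>i<k. l i) < S"
    "\<And>k. \<Gamma> ` {\<Sum>i<k. l i..<S} \<subseteq> E k"
    by (rule lip_joined_infinite_concat[where l = l and A = E and z = z, OF l summable]) iprover
  show ?thesis
  proof (rule rect_accessibleI[OF e _ \<Gamma>(1)])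
    show "0 < S" using \<Gamma>(2)[of 0] by simp
    show "\<Gamma> ` {0..<S} \<subseteq> \<Omega>" using \<Gamma>(3)[of 0] pe_chain_subset[OF E, of 0] by auto
    fix k
    have "0 < (\<Sum>i<Suc k. l i)" using l by (intro sum_pos) auto
    moreover have "\<Gamma> ` {\<Sum>i<Suc k. l i..<S} \<subseteq> E k"
      using \<Gamma>(3)[of "Suc k"] pe_chain_decreasing[OF E, of k "Suc k"] by auto
    ultimately show "\<exists>t\<in>{0<..<S}. \<Gamma> ` {t<..<S} \<subseteq> E k"
      using \<Gamma>(2)[of "Suc k"] by (intro bexI[of _ "\<Sum>i<Suc k. l i"]) (auto simp: image_subset_iff)
  qed
qed

lemma joined_interior_points:
  fixes c :: "nat \<Rightarrow> real \<Rightarrow> 'a" and T :: "nat \<Rightarrow> real"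
  assumes E: "pe_chain \<Omega> E"
    and c: "\<And>n. lip_curve \<Omega> (T n) (c n)" "\<And>n. c n 0 \<notin> E 0" "\<And>n. c n (T n) \<in> E n"
    and visit: "uniformly_visits_interior T c"
  obtains r t where "\<And>k. 0 < r k" "\<And>n k. k < n \<Longrightarrow> t n k \<in> {0..T n}"
    "\<And>n k. k < n \<Longrightarrow> r k \<le> bdist (c n (t n k))" "\<And>n k. Suc k < n \<Longrightarrow> t n k \<le> t n (Suc k)"
    "\<And>n k. Suc k < n \<Longrightarrow> lip_joined (E k) (t n (Suc k) - t n k) (c n (t n k)) (c n (t n (Suc k)))"
proof -
  have "\<exists>r>0. \<forall>n s s'. 0 \<le> s \<longrightarrow> s + chain_gap \<Omega> E k \<le> s' \<longrightarrow> s' \<le> T n \<longrightarrow>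
      (\<exists>t\<in>{s<..<s'}. r \<le> bdist (c n t))" for k
    using visit chain_gap_pos[OF E, of k] by (simp add: uniformly_visits_interior_def)
  then obtain r where r: "\<And>k. 0 < r k" "\<And>k n s s'. 0 \<le> s \<Longrightarrow> s + chain_gap \<Omega> E k \<le> s' \<Longrightarrow>
      s' \<le> T n \<Longrightarrow> \<exists>t\<in>{s<..<s'}. r k \<le> bdist (c n t)"
    by metis
  have "\<exists>t. (\<forall>k<n. t k \<in> {0..T n} \<and> r k \<le> bdist (c n (t k)) \<and> c n ` {t k..T n} \<subseteq> E k) \<and>
      (\<forall>k. Suc k < n \<longrightarrow> t k \<le> t (Suc k))" for n
    by (rule chain_visiting_times[OF E c r(2)])
  then obtain t where t: "\<And>n k. k < n \<Longrightarrow> t n k \<in> {0..T n}"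
    "\<And>n k. k < n \<Longrightarrow> r k \<le> bdist (c n (t n k))" "\<And>n k. k < n \<Longrightarrow> c n ` {t n k..T n} \<subseteq> E k"
    "\<And>n k. Suc k < n \<Longrightarrow> t n k \<le> t n (Suc k)"
    by metis
  have "lip_joined (E k) (t n (Suc k) - t n k) (c n (t n k)) (c n (t n (Suc k)))"
    if k: "Suc k < n" for n k
  proof -
    have T: "0 \<le> t n k" "t n (Suc k) \<le> T n" using t(1)[of "Suc k" n] t(1)[of k n] k by auto
    then have "c n ` {t n k..t n (Suc k)} \<subseteq> c n ` {t n k..T n}" by (intro image_mono) auto
    also have "\<dots> \<subseteq> E k" using k by (intro t(3)) simp
    finally show ?thesis by (intro lip_curve_segment[OF c(1) T(1) t(4)[OF k] T(2)])
  qed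
  with r(1) t(1,2,4) show ?thesis by (rule that)
qed

text \<open>Each curve \<open>c n\<close> spends a definite time between \<open>E k\<close> and \<open>E (k + 1)\<close>, hence visits there a
  compact subset of \<open>\<Omega>\<close> that does not depend on \<open>n\<close>. A diagonal argument makes the visited
  points converge as \<open>n \<rightarrow> \<infinity>\<close>, and pieces of the curves \<open>c n\<close> join the limit points.\<close>

lemma joined_limit_sequence:
  fixes c :: "nat \<Rightarrow> real \<Rightarrow> 'a" and T :: "nat \<Rightarrow> real"
  assumes E: "pe_chain \<Omega> E" and T: "\<And>n. T n \<le> M"
    and c: "\<And>n. lip_curve \<Omega> (T n) (c n)" "\<And>n. c n 0 \<notin> E 0" "\<And>n. c n (T n) \<in> E n"
    and visit: "uniformly_visits_interior T c"
  obtains \<theta> z where "\<And>k. \<theta> k \<le> \<theta> (Suc k)" "\<And>k. \<theta> k \<le> M"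
    "\<And>k \<epsilon>. 0 < \<epsilon> \<Longrightarrow> lip_joined (E k) (\<theta> (Suc k) - \<theta> k + \<epsilon>) (z k) (z (Suc k))"
proof -
  obtain r t where r: "\<And>k. 0 < r k" and t: "\<And>n k. k < n \<Longrightarrow> t n k \<in> {0..T n}"
    "\<And>n k. k < n \<Longrightarrow> r k \<le> bdist (c n (t n k))" "\<And>n k. Suc k < n \<Longrightarrow> t n k \<le> t n (Suc k)"
    and joined: "\<And>n k. Suc k < n \<Longrightarrow>
      lip_joined (E k) (t n (Suc k) - t n k) (c n (t n k)) (c n (t n (Suc k)))"
    using joined_interior_points[OF E c visit] by metis
  let ?K = "\<lambda>k. {x. r k \<le> bdist x} \<times> {0..M}" and ?f = "\<lambda>n k. (c n (t n k), t n k)"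
  have "compact (?K k)" for k by (intro compact_Times compact_bdist_ge r) auto
  moreover have "?f n k \<in> ?K k" if "k < n" for n k using t(1,2)[OF that] T[of n] by auto
  ultimately obtain \<phi> w where \<phi>: "strict_mono \<phi>" and w: "\<And>k. w k \<in> ?K k" "\<And>k. (\<lambda>n. ?f (\<phi> n) k) \<longlonglongrightarrow> w k"
    using diagonal_convergent_subsequence[of ?K ?f] by blast
  define \<zeta> \<theta> where "\<zeta> k = fst (w k)" and "\<theta> k = snd (w k)" for k
  have \<zeta>: "\<zeta> k \<in> \<Omega>" and \<theta>: "\<theta> k \<le> M" for k
    using w(1)[of k] r[of k] by (auto simp: \<zeta>_def \<theta>_def mem_iff_bdist_pos)
  have lim: "(\<lambda>n. c (\<phi> n) (t (\<phi> n) k)) \<longlonglongrightarrow> \<zeta> k" "(\<lambda>n. t (\<phi> n) k) \<longlonglongrightarrow> \<theta> k" for k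
    using tendsto_fst[OF w(2)] tendsto_snd[OF w(2)] by (auto simp: \<zeta>_def \<theta>_def)
  have large: "\<forall>\<^sub>F n in sequentially. k < \<phi> n" for k
    using filterlim_subseq[OF \<phi>] by (simp add: filterlim_at_top flip: Suc_le_eq)
  have "\<theta> k \<le> \<theta> (Suc k)" for k
    by (rule tendsto_le[OF _ lim(2) lim(2) eventually_mono[OF large t(3)]]) auto
  moreover have "lip_joined (E k) (\<theta> (Suc (Suc k)) - \<theta> (Suc k) + \<epsilon>) (\<zeta> (Suc k)) (\<zeta> (Suc (Suc k)))"
    if "0 < \<epsilon>" for k \<epsilon>
    by (rule limit_lip_joined[OF E \<zeta> lim(1) \<zeta> lim(1) tendsto_diff[OF lim(2) lim(2)]
        eventually_mono[OF large joined] that])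
  ultimately show ?thesis using \<theta> by (intro that[of "\<lambda>k. \<theta> (Suc k)" "\<lambda>k. \<zeta> (Suc k)"]) auto
qed

lemma rect_accessible_limit:
  fixes c :: "nat \<Rightarrow> real \<Rightarrow> 'a" and T :: "nat \<Rightarrow> real"
  assumes e: "e \<in> prime_ends \<Omega>" "E \<in> e" and T: "\<And>n. T n \<le> M"
    and c: "\<And>n. lip_curve \<Omega> (T n) (c n)" "\<And>n. c n 0 = x0" "\<And>n. c n (T n) \<in> E n"
    and visit: "uniformly_visits_interior T c"
  shows "e \<in> rect_accessible_prime_ends \<Omega>"
proof -
  have end_e: "e \<in> pe_ends \<Omega>" using e(1) by (simp add: prime_ends_def)
  have E: "pe_chain \<Omega> E" using end_e e(2) by (rule pe_end_chain)
  have "x0 \<in> \<Omega>" using c(1)[of 0] c(2)[of 0] by (auto simp: lip_curve_def)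
  then have "x0 \<notin> frontier \<Omega>" using open_domain by (simp add: frontier_def interior_open)
  then obtain m where m: "x0 \<notin> closure (E m)" using E unfolding pe_chain_def by blast
  note shift = pe_chain_shift[OF E, of m]
  obtain \<theta> z where \<theta>: "\<And>k. \<theta> k \<le> \<theta> (Suc k)" "\<And>k. \<theta> k \<le> M" and
    z: "\<And>k \<epsilon>. 0 < \<epsilon> \<Longrightarrow> lip_joined (E (k + m)) (\<theta> (Suc k) - \<theta> k + \<epsilon>) (z k) (z (Suc k))"
  proof (rule joined_limit_sequence[OF shift(1), of "\<lambda>n. T (n + m)" M "\<lambda>n. c (n + m)"])
    show "c (n + m) 0 \<notin> E (0 + m)" for n using m c(2) closure_subset by auto
    show "uniformly_visits_interior (\<lambda>n. T (n + m)) (\<lambda>n. c (n + m))"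
      using visit unfolding uniformly_visits_interior_def by metis
  qed (use T c in auto)
  then show ?thesis
    using rect_accessible_if_joined_sequence[OF e(1) pe_end_equiv_chain[OF end_e e(2) shift] \<theta> z] by blast
qed

end

subsection \<open>Weighted length\<close>

definition weighted_length :: "('a \<Rightarrow> ennreal) \<Rightarrow> real \<Rightarrow> (real \<Rightarrow> 'a) \<Rightarrow> ennreal" where
  "weighted_length w l c = (\<integral>\<^sup>+t\<in>{0..l}. w (c t) \<partial>lborel)"

definition weighted_dist :: "'a::metric_space set \<Rightarrow> ('a \<Rightarrow> ennreal) \<Rightarrow> 'a \<Rightarrow> 'a \<Rightarrow> ennreal" where
  "weighted_dist A w x y =
    (INF (l, c) \<in> {(l, c). lip_curve A l c \<and> c 0 = x \<and> c l = y}. weighted_length w l c)"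

lemma weighted_length_le:
  assumes "\<And>t. 0 \<le> t \<Longrightarrow> t \<le> l \<Longrightarrow> w (c t) \<le> B" "0 \<le> l"
  shows "weighted_length w l c \<le> B * ennreal l"
proof -
  have "weighted_length w l c \<le> (\<integral>\<^sup>+t\<in>{0..l}. B \<partial>lborel)"
    unfolding weighted_length_def using assms(1) by (intro nn_integral_mono) (auto simp: indicator_def)
  then show ?thesis using assms(2) by (simp add: nn_integral_cmult_indicator)
qed

lemma weighted_length_ge:
  assumes "0 \<le> s" "s \<le> s'" "s' \<le> l" "\<And>t. s < t \<Longrightarrow> t < s' \<Longrightarrow> B \<le> w (c t)"
  shows "B * ennreal (s' - s) \<le> weighted_length w l c"
proof -
  have "B * ennreal (s' - s) = (\<integral>\<^sup>+t\<in>{s<..<s'}. B \<partial>lborel)"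
    using assms(2) by (simp add: nn_integral_cmult_indicator)
  also have "\<dots> \<le> weighted_length w l c"
    unfolding weighted_length_def using assms by (intro nn_integral_mono) (auto simp: indicator_def)
  finally show ?thesis .
qed

lemma weighted_length_join:
  fixes w :: "'a::metric_space \<Rightarrow> ennreal"
  assumes w: "w \<in> borel_measurable borel" and c: "continuous_on {0..l} c" and c': "continuous_on {0..m} c'"
  shows "weighted_length w (l + m) (curve_join l c c') \<le> weighted_length w l c + weighted_length w m c'"
proof -
  define f where "f t = w (c t) * indicator {0..l} t" for t
  define f' where "f' t = w (c' t) * indicator {0..m} t" for t
  have [measurable]: "f \<in> borel_measurable borel" "f' \<in> borel_measurable borel"
    unfolding f_def[abs_def] f'_def[abs_def]
    by (rule borel_measurable_curve_comp[OF w c] borel_measurable_curve_comp[OF w c'])+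
  have "w (curve_join l c c' t) * indicator {0..l + m} t \<le> f t + f' (t - l)" for t
    by (auto simp: f_def f'_def curve_join_def indicator_def)
  then have "weighted_length w (l + m) (curve_join l c c') \<le> (\<integral>\<^sup>+t. f t + f' (t - l) \<partial>lborel)"
    unfolding weighted_length_def by (rule nn_integral_mono)
  also have "\<dots> = (\<integral>\<^sup>+t. f t \<partial>lborel) + (\<integral>\<^sup>+t. f' (t - l) \<partial>lborel)"
    by (rule nn_integral_add) auto
  also have "(\<integral>\<^sup>+t. f' (t - l) \<partial>lborel) = (\<integral>\<^sup>+t. f' t \<partial>lborel)"
    using nn_integral_real_affine[of f' 1 "- l"] by simp
  finally show ?thesis by (simp add: weighted_length_def f_def f'_def)
qed

lemma weighted_dist_le:
  "lip_curve A l c \<Longrightarrow> c 0 = x \<Longrightarrow> c l = y \<Longrightarrow> weighted_dist A w x y \<le> weighted_length w l c"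
  unfolding weighted_dist_def by (rule INF_lower2[of "(l, c)"]) auto

lemma weighted_dist_less_obtain:
  assumes "weighted_dist A w x y < B"
  obtains l c where "lip_curve A l c" "c 0 = x" "c l = y" "weighted_length w l c < B"
  using assms that unfolding weighted_dist_def INF_less_iff by auto

lemma weighted_dist_step:
  assumes w: "w \<in> borel_measurable borel" and c: "lip_curve A m c" "c 0 = y" "c m = z"
    and d: "weighted_length w m c \<le> ennreal d"
  shows "weighted_dist A w x z \<le> weighted_dist A w x y + ennreal d"
proof -
  have "weighted_dist A w x z - ennreal d \<le> weighted_length w l b"
    if b: "lip_curve A l b" "b 0 = x" "b l = y" for l b
  proof -
    have "weighted_dist A w x z \<le> weighted_length w (l + m) (curve_join l b c)"
      using b c lip_curve_join[OF b(1) c(1)] curve_join_endpoints[of l m b c]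
      by (intro weighted_dist_le) (auto simp: lip_curve_def)
    also have "\<dots> \<le> weighted_length w l b + weighted_length w m c"
      by (intro weighted_length_join[OF w] lip_curve_continuous[OF b(1)] lip_curve_continuous[OF c(1)])
    also have "\<dots> \<le> ennreal d + weighted_length w l b"
      using d by (simp add: add.commute add_left_mono)
    finally show ?thesis by (simp add: ennreal_minus_le_iff)
  qed
  then have "weighted_dist A w x z - ennreal d \<le> weighted_dist A w x y"
    unfolding weighted_dist_def[of A w x y] by (intro INF_greatest) auto
  then show ?thesis by (simp add: ennreal_minus_le_iff add.commute)
qed

subsection \<open>The potential of a boundary weight\<close>

locale singular_weight =
  fixes h :: "real \<Rightarrow> ennreal"
  assumes h_borel: "h \<in> borel_measurable borel" and h_antimono: "antimono h" and h_ge_1: "1 \<le> h r"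
    and h_finite: "0 < r \<Longrightarrow> h r < \<infinity>" and h_unbounded: "\<And>B. \<exists>r>0. ennreal B \<le> h r"

locale weighted_domain = bounded_domain \<Omega> C + singular_weight h
  for \<Omega> :: "'a::complete_space set" and C :: real and h :: "real \<Rightarrow> ennreal" +
  fixes x0 :: 'a
  assumes base_point: "x0 \<in> \<Omega>"
begin

text \<open>The factor 2 in the weight absorbs the variation of the distance to the boundary near a point.\<close>

abbreviation weight :: "'a \<Rightarrow> ennreal" where
  "weight x \<equiv> h (2 * bdist x)"

definition potential :: "'a \<Rightarrow> ennreal" where
  "potential = weighted_dist \<Omega> weight x0"

lemma weight_borel: "weight \<in> borel_measurable borel"
  using h_borel by measurable

lemma length_le_weighted_length:
  assumes "0 \<le> l"
  shows "ennreal l \<le> weighted_length weight l c"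
  using weighted_length_ge[of 0 l l 1 weight c] h_ge_1 assms by simp

lemma lip_joined_near:
  assumes x: "x \<in> \<Omega>" and y: "dist x y < bdist x / (8 * C)" and z: "dist x z < bdist x / (8 * C)"
  shows "lip_joined (ball x (bdist x / 2)) (C * dist y z) y z"
proof (rule lip_joined_in_ball)
  have small: "bdist x / (8 * C) \<le> bdist x / 8"
    using C_ge_1 infdist_nonneg[of x "- \<Omega>"] by (intro divide_left_mono) auto
  show "ball y (3 * bdist x / 8) \<subseteq> ball x (bdist x / 2)"
  proof
    fix t assume "t \<in> ball y (3 * bdist x / 8)"
    then show "t \<in> ball x (bdist x / 2)" using y small dist_triangle[of x t y] by simp
  qed
  have "C * dist y z < C * (2 * (bdist x / (8 * C)))"
    using y z dist_triangle3[of y z x] C_ge_1 by (intro mult_strict_left_mono) auto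
  also have "\<dots> \<le> 3 * bdist x / 8" using C_ge_1 infdist_nonneg[of x "- \<Omega>"] by simp
  finally show "C * dist y z < 3 * bdist x / 8" .
qed

lemma potential_step:
  assumes x: "x \<in> \<Omega>" and y: "dist x y < bdist x / (8 * C)" and z: "dist x z < bdist x / (8 * C)"
  shows "potential z \<le> potential y + ennreal (C * enn2real (h (bdist x)) * dist y z)"
proof -
  have pos: "0 < bdist x" using x by (simp add: mem_iff_bdist_pos)
  obtain c where c: "lip_curve (ball x (bdist x / 2)) (C * dist y z) c" "c 0 = y" "c (C * dist y z) = z"
    using lip_joined_near[OF assms] unfolding lip_joined_def by blast
  have far: "bdist x / 2 \<le> bdist t" if "t \<in> ball x (bdist x / 2)" for t
    using infdist_triangle[of x "- \<Omega>" t] that by simp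
  then have "ball x (bdist x / 2) \<subseteq> \<Omega>" using pos by (force simp: mem_iff_bdist_pos)
  then have lip: "lip_curve \<Omega> (C * dist y z) c" using c(1) by (auto simp: lip_curve_def)
  have "weighted_length weight (C * dist y z) c \<le> h (bdist x) * ennreal (C * dist y z)"
    using far lip_curve_mem[OF c(1)] C_ge_1 by (intro weighted_length_le antimonoD[OF h_antimono]) fastforce+
  also have "\<dots> = ennreal (C * enn2real (h (bdist x)) * dist y z)"
    using h_finite[OF pos] C_ge_1 by (cases "h (bdist x)") (auto simp: ennreal_mult[symmetric] ac_simps)
  finally show ?thesis
    unfolding potential_def by (rule weighted_dist_step[OF weight_borel lip c(2,3)])
qed

lemma truncate_potential_lipschitz:
  assumes x: "x \<in> \<Omega>" and y: "dist x y < bdist x / (8 * C)" and z: "dist x z < bdist x / (8 * C)"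
  shows "\<bar>truncate N (potential y) - truncate N (potential z)\<bar> \<le> C * enn2real (h (bdist x)) * dist y z"
proof -
  have "truncate N (potential z) \<le> truncate N (potential y) + C * enn2real (h (bdist x)) * dist y z"
    using C_ge_1 by (intro truncate_le_add potential_step[OF x y z]) simp
  moreover have "truncate N (potential y) \<le> truncate N (potential z) + C * enn2real (h (bdist x)) * dist z y"
    using C_ge_1 by (intro truncate_le_add potential_step[OF x z y]) simp
  ultimately show ?thesis by (simp add: dist_commute abs_le_iff)
qed

lemma continuous_on_truncate_potential: "continuous_on \<Omega> (\<lambda>x. truncate N (potential x))"
  unfolding continuous_on_eq_continuous_within
proof
  fix x assume x: "x \<in> \<Omega>"
  let ?L = "C * enn2real (h (bdist x))"
  have pos: "0 < bdist x / (8 * C)" using x C_ge_1 by (simp add: mem_iff_bdist_pos)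
  have "((\<lambda>y. truncate N (potential y) - truncate N (potential x)) \<longlongrightarrow> 0) (at x within \<Omega>)"
  proof (rule Lim_null_comparison)
    show "\<forall>\<^sub>F y in at x within \<Omega>.
        norm (truncate N (potential y) - truncate N (potential x)) \<le> ?L * dist y x"
      unfolding eventually_at
      using truncate_potential_lipschitz[OF x _, of _ x N] pos
      by (intro exI[of _ "bdist x / (8 * C)"]) (auto simp: dist_commute)
    have "((\<lambda>y. ?L * dist y x) \<longlongrightarrow> ?L * dist x x) (at x within \<Omega>)" by (intro tendsto_intros)
    then show "((\<lambda>y. ?L * dist y x) \<longlongrightarrow> 0) (at x within \<Omega>)" by simp
  qed
  then show "continuous (at x within \<Omega>) (\<lambda>x. truncate N (potential x))"
    unfolding continuous_within by (simp add: LIM_zero_iff)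
qed

lemma upper_gradient_truncate_potential:
  "upper_gradient \<Omega> (\<lambda>x. truncate N (potential x)) (\<lambda>x. ennreal C * h (bdist x))"
proof (rule upper_gradient_if_locally_lipschitz)
  show "(\<lambda>x. ennreal C * h (bdist x)) \<in> borel_measurable borel" using h_borel by measurable
  show "continuous_on \<Omega> (\<lambda>x. bdist x / (8 * C))" using C_ge_1 by (intro continuous_intros) auto
  show "0 < bdist x / (8 * C)" if "x \<in> \<Omega>" for x using that C_ge_1 by (simp add: mem_iff_bdist_pos)
  fix x y z assume x: "x \<in> \<Omega>" "dist x y < bdist x / (8 * C)" "dist x z < bdist x / (8 * C)"
  have "h (bdist x) < \<infinity>" using x(1) by (intro h_finite) (simp add: mem_iff_bdist_pos)
  then have "ennreal (C * enn2real (h (bdist x)) * dist y z) = ennreal C * h (bdist x) * ennreal (dist y z)"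
    using C_ge_1 by (cases "h (bdist x)") (auto simp: ennreal_mult)
  then show "ennreal \<bar>truncate N (potential y) - truncate N (potential z)\<bar> \<le>
      ennreal C * h (bdist x) * ennreal (dist y z)"
    using truncate_potential_lipschitz[OF x, of N] by (metis ennreal_leI)
qed

lemma potential_finite:
  assumes "x \<in> \<Omega>"
  shows "potential x < \<infinity>"
proof -
  obtain l c where c: "lip_curve \<Omega> l c" "c 0 = x0" "c l = x"
    using lip_joined_connected[OF open_domain connected_domain base_point assms]
    unfolding lip_joined_def by blast
  have l: "0 \<le> l" using c(1) by (simp add: lip_curve_def)
  have "continuous_on {0..l} (\<lambda>t. bdist (c t))"
    using lip_curve_continuous[OF c(1)] by (intro continuous_intros)
  then obtain t0 where t0: "t0 \<in> {0..l}" "\<And>t. t \<in> {0..l} \<Longrightarrow> bdist (c t0) \<le> bdist (c t)"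
    using continuous_attains_inf[of "{0..l}" "\<lambda>t. bdist (c t)"] l by auto
  have "0 < bdist (c t0)" using lip_curve_mem[OF c(1)] t0(1) by (simp flip: mem_iff_bdist_pos)
  have "potential x \<le> weighted_length weight l c"
    unfolding potential_def by (rule weighted_dist_le[OF c])
  also have "\<dots> \<le> h (2 * bdist (c t0)) * ennreal l"
    using t0(2) l by (intro weighted_length_le antimonoD[OF h_antimono]) auto
  also have "\<dots> < \<infinity>"
    using h_finite[of "2 * bdist (c t0)"] \<open>0 < bdist (c t0)\<close> by (simp add: ennreal_mult_less_top)
  finally show ?thesis .
qed

lemma uniformly_visits_interior_if_short:
  assumes short: "\<And>n. weighted_length weight (T n) (c n) < ennreal N"
  shows "uniformly_visits_interior T c"
  unfolding uniformly_visits_interior_def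
proof (intro allI impI)
  fix \<delta> :: real assume "0 < \<delta>"
  obtain r where r: "0 < r" "ennreal (N / \<delta>) \<le> h r" using h_unbounded by blast
  have "\<exists>t\<in>{s<..<s'}. r / 2 \<le> bdist (c n t)" if s: "0 \<le> s" "s + \<delta> \<le> s'" "s' \<le> T n" for n s s'
  proof (rule ccontr)
    assume "\<not> ?thesis"
    then have near: "2 * bdist (c n t) \<le> r" if "s < t" "t < s'" for t using that by force
    have "ennreal N = ennreal (N / \<delta>) * ennreal \<delta>"
      using \<open>0 < \<delta>\<close> by (simp add: ennreal_mult''[symmetric])
    also have "\<dots> \<le> h r * ennreal (s' - s)"
      using r(2) s by (intro mult_mono ennreal_leI) auto
    also have "\<dots> \<le> weighted_length weight (T n) (c n)"
      using s \<open>0 < \<delta>\<close> near by (intro weighted_length_ge antimonoD[OF h_antimono]) auto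
    finally show False using short[of n] by simp
  qed
  then show "\<exists>r>0. \<forall>n s s'. 0 \<le> s \<longrightarrow> s + \<delta> \<le> s' \<longrightarrow> s' \<le> T n \<longrightarrow> (\<exists>t\<in>{s<..<s'}. r \<le> bdist (c n t))"
    using r(1) by (intro exI[of _ "r / 2"]) auto
qed

lemma rect_accessible_if_potential_bounded:
  assumes e: "e \<in> prime_ends \<Omega>" "E \<in> e" and y: "\<And>n. y n \<in> E n" "\<And>n. potential (y n) < ennreal N"
  shows "e \<in> rect_accessible_prime_ends \<Omega>"
proof -
  have "\<exists>l c. lip_curve \<Omega> l c \<and> c 0 = x0 \<and> c l = y n \<and> weighted_length weight l c < ennreal N" for n
    using y(2)[of n] unfolding potential_def by (rule weighted_dist_less_obtain) blast
  then obtain T c where c: "\<And>n. lip_curve \<Omega> (T n) (c n)" "\<And>n. c n 0 = x0" "\<And>n. c n (T n) = y n"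
    and short: "\<And>n. weighted_length weight (T n) (c n) < ennreal N"
    by metis
  have "T n \<le> N" for n
  proof -
    have T: "0 \<le> T n" using c(1)[of n] by (simp add: lip_curve_def)
    then have "ennreal (T n) < ennreal N" using length_le_weighted_length short order_le_less_trans by blast
    then show ?thesis using T by (simp add: ennreal_less_iff)
  qed
  moreover have "c n (T n) \<in> E n" for n using c(3) y(1) by simp
  ultimately show ?thesis
    by (rule rect_accessible_limit[OF e _ c(1,2) _ uniformly_visits_interior_if_short[OF short]])
qed

lemma potential_tends_to_top:
  assumes "e \<in> prime_ends \<Omega> - rect_accessible_prime_ends \<Omega>"
  shows "\<forall>\<^sub>F y in pe_nhds \<Omega> e. ennreal N \<le> potential y"
proof -
  have e: "e \<in> pe_ends \<Omega>" using assms by (simp add: prime_ends_def)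
  obtain E where E: "E \<in> e" using pe_end_nonempty[OF e] by blast
  have "\<exists>n. \<forall>y\<in>E n. ennreal N \<le> potential y"
  proof (rule ccontr)
    assume "\<not> ?thesis"
    then have "\<forall>n. \<exists>y. y \<in> E n \<and> potential y < ennreal N" by (meson not_le)
    then obtain y where "\<And>n. y n \<in> E n" "\<And>n. potential (y n) < ennreal N" by metis
    then show False using rect_accessible_if_potential_bounded[OF _ E] assms by blast
  qed
  then obtain n where "\<forall>y\<in>E n. ennreal N \<le> potential y" ..
  then show ?thesis by (intro eventually_pe_nhdsI[OF e E]) auto
qed

end

subsection \<open>Integrable weights with a singularity\<close>

lemma epow_ennreal: "0 \<le> x \<Longrightarrow> epow (ennreal x) p = ennreal (x powr p)"
  by (simp add: epow_def)

lemma epow_mono: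
  assumes "0 \<le> p" "a \<le> b"
  shows "epow a p \<le> epow b p"
  using assms
  by (cases a; cases b) (auto simp: epow_def top_unique intro!: ennreal_leI powr_mono2)

lemma epow_less_top: "a < \<infinity> \<Longrightarrow> epow a p < \<infinity>"
  by (simp add: epow_def)

lemma epow_inverse_epow:
  assumes "0 < p"
  shows "epow (epow a (1 / p)) p = a"
  using assms by (cases a) (auto simp: epow_ennreal powr_powr, simp add: epow_def)

lemma epow_cmult:
  assumes "0 < c"
  shows "epow (ennreal c * a) p = ennreal (c powr p) * epow a p"
proof (cases a)
  case (real x)
  then show ?thesis
    using assms by (simp add: epow_ennreal powr_mult flip: ennreal_mult)
next
  case top
  then show ?thesis using assms by (simp add: epow_def ennreal_mult_top)
qed

lemma epow_borel [measurable]: "(\<lambda>a. epow a p) \<in> borel_measurable borel"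
  unfolding epow_def[abs_def] by measurable

definition step_weight :: "(nat \<Rightarrow> real) \<Rightarrow> real \<Rightarrow> ennreal" where
  "step_weight \<rho> r = 1 + (\<Sum>j. indicator {..<\<rho> j} r)"

lemma step_weight_borel [measurable]: "step_weight \<rho> \<in> borel_measurable borel"
  unfolding step_weight_def[abs_def] by measurable

lemma step_weight_ge_1: "1 \<le> step_weight \<rho> r"
  by (simp add: step_weight_def)

lemma step_weight_antimono: "r \<le> r' \<Longrightarrow> step_weight \<rho> r' \<le> step_weight \<rho> r"
  unfolding step_weight_def by (intro add_left_mono suminf_le) (auto simp: indicator_def)

lemma step_weight_finite:
  assumes "\<rho> \<longlonglongrightarrow> 0" "0 < r"
  shows "step_weight \<rho> r < \<infinity>"
proof -
  obtain J where J: "\<And>j. J \<le> j \<Longrightarrow> \<rho> j < r"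
    using order_tendstoD(2)[OF assms] unfolding eventually_sequentially by blast
  have "indicator {..<\<rho> j} r = (0 :: ennreal)" if "j \<notin> {..<J}" for j
    using J[of j] that by simp
  then have "(\<Sum>j. indicator {..<\<rho> j} r :: ennreal) = (\<Sum>j<J. indicator {..<\<rho> j} r)"
    by (intro suminf_finite) auto
  also have "\<dots> \<le> (\<Sum>j<J. 1)" by (intro sum_mono) (simp add: indicator_def)
  also have "\<dots> < \<infinity>" by (simp add: of_nat_less_top)
  finally show ?thesis by (simp add: step_weight_def)
qed

lemma step_weight_unbounded:
  assumes "\<And>j. 0 < \<rho> j"
  obtains r where "0 < r" "ennreal B \<le> step_weight \<rho> r"
proof -
  obtain J :: nat where J: "B \<le> real J" using real_arch_simple by blast
  define r where "r = Min (\<rho> ` {..J}) / 2"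
  have Min_pos: "0 < Min (\<rho> ` {..J})" using assms by (subst Min_gr_iff) auto
  have r_less: "r < \<rho> j" if "j < J" for j
  proof -
    have "Min (\<rho> ` {..J}) \<le> \<rho> j" using that by (intro Min_le) auto
    then show ?thesis using Min_pos unfolding r_def by linarith
  qed
  have "ennreal B \<le> ennreal (real J)" by (rule ennreal_leI[OF J])
  also have "\<dots> = (\<Sum>j<J. indicator {..<\<rho> j} r)"
    using r_less by (simp add: ennreal_of_nat_eq_real_of_nat[symmetric])
  also have "\<dots> \<le> (\<Sum>j. indicator {..<\<rho> j} r)" by (intro sum_le_suminf) auto
  also have "\<dots> \<le> step_weight \<rho> r" by (simp add: step_weight_def)
  finally show ?thesis using Min_pos by (intro that[of r]) (simp_all add: r_def)
qed

lemma nn_integral_step_weight: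
  assumes [measurable]: "A \<in> sets M" "d \<in> borel_measurable M"
  shows "(\<integral>\<^sup>+x\<in>A. step_weight \<rho> (d x) \<partial>M) = emeasure M A + (\<Sum>j. emeasure M {x \<in> A. d x < \<rho> j})"
proof -
  have [measurable]: "{x \<in> A. d x < \<rho> j} \<in> sets M" for j
  proof -
    have "{x \<in> A. d x < \<rho> j} = {x \<in> space M. x \<in> A \<and> d x < \<rho> j}"
      using sets.sets_into_space[OF assms(1)] by auto
    then show ?thesis by simp
  qed
  have "(\<integral>\<^sup>+x\<in>A. step_weight \<rho> (d x) \<partial>M) =
      (\<integral>\<^sup>+x. indicator A x + (\<Sum>j. indicator {x \<in> A. d x < \<rho> j} x) \<partial>M)"
    by (intro nn_integral_cong) (auto simp: step_weight_def indicator_def)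
  also have "\<dots> = emeasure M A + (\<Sum>j. emeasure M {x \<in> A. d x < \<rho> j})"
    by (subst nn_integral_add, simp, simp, subst nn_integral_suminf) auto
  finally show ?thesis .
qed

lemma emeasure_sublevel_tendsto_0:
  fixes d :: "'a \<Rightarrow> real"
  assumes [measurable]: "A \<in> sets M" "d \<in> borel_measurable M"
    and fin: "emeasure M A < \<infinity>" and pos: "\<And>x. x \<in> A \<Longrightarrow> 0 < d x"
  shows "(\<lambda>n. emeasure M {x \<in> A. d x < 1 / real (Suc n)}) \<longlonglongrightarrow> 0"
proof -
  let ?S = "\<lambda>n. {x \<in> A. d x < 1 / real (Suc n)}"
  have "(\<lambda>n. emeasure M (?S n)) \<longlonglongrightarrow> emeasure M (\<Inter>n. ?S n)"
  proof (rule Lim_emeasure_decseq)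
    have "?S n = {x \<in> space M. x \<in> A \<and> d x < 1 / real (Suc n)}" for n
      using sets.sets_into_space[OF assms(1)] by auto
    then show "range ?S \<subseteq> sets M" by auto
    have "1 / real (Suc n) \<le> 1 / real (Suc m)" if "m \<le> n" for m n
      using that by (simp add: frac_le)
    then show "decseq ?S" unfolding decseq_def by (force intro: order_less_le_trans)
    show "emeasure M (?S n) \<noteq> \<infinity>" for n
      using emeasure_mono[of "?S n" A M] fin by (auto simp: less_top top_unique)
  qed
  moreover have "(\<Inter>n. ?S n) = {}"
  proof -
    have "x \<notin> (\<Inter>n. ?S n)" for x
    proof (cases "x \<in> A")
      case True
      obtain n where "1 / real (Suc n) < d x" by (rule nat_approx_posE[OF pos[OF True]])
      then have "x \<notin> ?S n" by simp
      then show ?thesis by blast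
    qed simp
    then show ?thesis by blast
  qed
  ultimately show ?thesis by simp
qed

lemma small_sublevels_exist:
  fixes d :: "'a \<Rightarrow> real"
  assumes "A \<in> sets M" "d \<in> borel_measurable M" "emeasure M A < \<infinity>" "\<And>x. x \<in> A \<Longrightarrow> 0 < d x"
  obtains \<rho> where "\<And>j::nat. 0 < \<rho> j" "\<rho> \<longlonglongrightarrow> 0"
    "\<And>j. emeasure M {x \<in> A. d x < \<rho> j} \<le> ennreal ((1/2)^j)"
proof -
  have "\<exists>n\<ge>j. emeasure M {x \<in> A. d x < 1 / real (Suc n)} < ennreal ((1/2)^j)" for j
  proof -
    have "\<forall>\<^sub>F n in sequentially. emeasure M {x \<in> A. d x < 1 / real (Suc n)} < ennreal ((1/2)^j)"
      using order_tendstoD(2)[OF emeasure_sublevel_tendsto_0[OF assms]] by simp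
    then show ?thesis unfolding eventually_sequentially by (meson le_cases)
  qed
  then obtain n where n: "\<And>j. j \<le> n j"
    "\<And>j. emeasure M {x \<in> A. d x < 1 / real (Suc (n j))} < ennreal ((1/2)^j)" by metis
  show ?thesis
  proof (rule that[of "\<lambda>j. 1 / real (Suc (n j))"])
    show "(\<lambda>j. 1 / real (Suc (n j))) \<longlonglongrightarrow> 0"
    proof (rule tendsto_sandwich[OF _ _ tendsto_const LIMSEQ_Suc[OF lim_const_over_n[of 1]]])
      show "\<forall>\<^sub>F j in sequentially. 1 / real (Suc (n j)) \<le> 1 / real (Suc j)"
        using n(1) by (simp add: frac_le)
    qed simp
  qed (use n(2) in \<open>auto intro: less_imp_le\<close>)
qed

lemma singular_weight_epow_step_weight:
  assumes \<rho>: "\<And>j. 0 < \<rho> j" "\<rho> \<longlonglongrightarrow> 0" and p: "0 < p"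
  shows "singular_weight (\<lambda>r. epow (step_weight \<rho> r) (1 / p))"
proof
  let ?h = "\<lambda>r. epow (step_weight \<rho> r) (1 / p)"
  have ge: "epow a (1 / p) \<le> ?h r" if "a \<le> step_weight \<rho> r" for a r
    using that p by (intro epow_mono) auto
  show "?h \<in> borel_measurable borel" by measurable
  show "antimono ?h"
    unfolding antimono_def using p by (auto intro!: epow_mono step_weight_antimono)
  show "1 \<le> ?h r" for r using ge[OF step_weight_ge_1, of r] epow_ennreal[of 1] by simp
  show "?h r < \<infinity>" if "0 < r" for r by (intro epow_less_top step_weight_finite[OF \<rho>(2) that])
  show "\<exists>r>0. ennreal B \<le> ?h r" for B
  proof -
    obtain r where r: "0 < r" "ennreal (\<bar>B\<bar> powr p) \<le> step_weight \<rho> r"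
      by (rule step_weight_unbounded[OF \<rho>(1)])
    have "ennreal B \<le> epow (ennreal (\<bar>B\<bar> powr p)) (1 / p)"
      using p by (simp add: epow_ennreal powr_powr ennreal_leI)
    also have "\<dots> \<le> ?h r" by (rule ge[OF r(2)])
    finally show ?thesis using r(1) by blast
  qed
qed

lemma singular_weight_exists:
  fixes d :: "'a \<Rightarrow> real" and p :: real
  assumes d: "A \<in> sets M" "d \<in> borel_measurable M" "emeasure M A < \<infinity>" "\<And>x. x \<in> A \<Longrightarrow> 0 < d x"
    and p: "0 < p"
  shows "\<exists>h. singular_weight h \<and> (\<integral>\<^sup>+x\<in>A. epow (h (d x)) p \<partial>M) < \<infinity>"
proof -
  obtain \<rho> where \<rho>: "\<And>j::nat. 0 < \<rho> j" "\<rho> \<longlonglongrightarrow> 0"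
    "\<And>j. emeasure M {x \<in> A. d x < \<rho> j} \<le> ennreal ((1/2)^j)"
    using small_sublevels_exist[OF d] by blast
  define h where "h r = epow (step_weight \<rho> r) (1 / p)" for r
  have "(\<integral>\<^sup>+x\<in>A. epow (h (d x)) p \<partial>M) = emeasure M A + (\<Sum>j. emeasure M {x \<in> A. d x < \<rho> j})"
    using nn_integral_step_weight[OF d(1,2)] p by (simp add: h_def epow_inverse_epow)
  also have "\<dots> \<le> emeasure M A + (\<Sum>j. ennreal ((1/2)^j))"
    using \<rho>(3) by (intro add_left_mono suminf_le) auto
  also have "(\<Sum>j. ennreal ((1/2)^j)) = ennreal (\<Sum>j. (1/2)^j)"
    by (intro suminf_ennreal2 summable_geometric) auto
  also have "emeasure M A + ennreal (\<Sum>j. (1/2)^j) < \<infinity>" using d(3) by simp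
  finally have "(\<integral>\<^sup>+x\<in>A. epow (h (d x)) p \<partial>M) < \<infinity>" .
  moreover have "singular_weight h"
    unfolding h_def[abs_def] by (rule singular_weight_epow_step_weight[OF \<rho>(1,2) p])
  ultimately show ?thesis by blast
qed

subsection \<open>Sets of zero prime end capacity\<close>

lemma N1p_normp_le:
  assumes "upper_gradient U u g"
  shows "N1p_normp p \<mu> U u \<le>
    (\<integral>\<^sup>+x\<in>U. ennreal (\<bar>u x\<bar> powr p) \<partial>\<mu>) + (\<integral>\<^sup>+x\<in>U. epow (g x) p \<partial>\<mu>)"
  unfolding N1p_normp_def nn_integral_completion
  using assms by (intro add_left_mono INF_lower) simp

lemma pe_cap_le:
  assumes "(\<lambda>x. u x * indicator \<Omega> x) \<in> borel_measurable \<mu>" "upper_gradient \<Omega> u g"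
    and finite: "(\<integral>\<^sup>+x\<in>\<Omega>. ennreal (\<bar>u x\<bar> powr p) \<partial>\<mu>) + (\<integral>\<^sup>+x\<in>\<Omega>. epow (g x) p \<partial>\<mu>) < \<infinity>"
    and "\<And>e. e \<in> F \<Longrightarrow> \<forall>\<^sub>F y in pe_nhds \<Omega> e. 1 \<le> u y"
  shows "pe_cap p \<mu> \<Omega> F \<le>
    (\<integral>\<^sup>+x\<in>\<Omega>. ennreal (\<bar>u x\<bar> powr p) \<partial>\<mu>) + (\<integral>\<^sup>+x\<in>\<Omega>. epow (g x) p \<partial>\<mu>)"
proof -
  note norm_le = N1p_normp_le[OF assms(2), of p \<mu>]
  have "in_N1p p \<mu> \<Omega> u"
    unfolding in_N1p_def using assms(1) norm_le finite
    by (auto intro: measurable_completion order_le_less_trans)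
  moreover have "1 \<le> Liminf (pe_nhds \<Omega> e) (\<lambda>y. ereal (u y))" if "e \<in> F" for e
    using assms(4)[OF that] by (intro Liminf_bounded) (simp add: one_ereal_def)
  ultimately have "pe_cap p \<mu> \<Omega> F \<le> N1p_normp p \<mu> \<Omega> u"
    unfolding pe_cap_def by (intro INF_lower) blast
  then show ?thesis using norm_le by (rule order_trans)
qed

lemma tendsto_powr_0:
  fixes f :: "nat \<Rightarrow> real"
  assumes "f \<longlonglongrightarrow> 0" "\<And>n. 0 \<le> f n" "0 < p"
  shows "(\<lambda>n. f n powr p) \<longlonglongrightarrow> 0"
  using tendsto_powr'[OF assms(1) tendsto_const, of p] assms(2,3) by simp

lemma nn_integral_epow_cmult_tendsto_0:
  assumes g: "g \<in> borel_measurable M" "(\<integral>\<^sup>+x\<in>A. epow (g x) p \<partial>M) < \<infinity>" and A: "A \<in> sets M"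
    and "0 < p" and c: "c \<longlonglongrightarrow> 0" "\<And>n. 0 < c n"
  shows "(\<lambda>n. \<integral>\<^sup>+x\<in>A. epow (ennreal (c n) * g x) p \<partial>M) \<longlonglongrightarrow> 0"
proof -
  have [measurable]: "g \<in> borel_measurable M" "A \<in> sets M" by fact+
  obtain i where i: "0 \<le> i" "(\<integral>\<^sup>+x\<in>A. epow (g x) p \<partial>M) = ennreal i"
    using g(2) by (cases "\<integral>\<^sup>+x\<in>A. epow (g x) p \<partial>M") auto
  have "(\<integral>\<^sup>+x\<in>A. epow (ennreal (c n) * g x) p \<partial>M) =
      ennreal (c n powr p) * (\<integral>\<^sup>+x\<in>A. epow (g x) p \<partial>M)" for n
    using c(2) by (simp add: epow_cmult mult.assoc nn_integral_cmult)
  then have "(\<integral>\<^sup>+x\<in>A. epow (ennreal (c n) * g x) p \<partial>M) = ennreal (c n powr p * i)" for n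
    using i by (simp add: ennreal_mult)
  moreover have "(\<lambda>n. ennreal (c n powr p * i)) \<longlonglongrightarrow> ennreal 0"
    using c \<open>0 < p\<close>
    by (intro tendsto_ennrealI tendsto_mult_left_zero tendsto_powr_0) (auto simp: less_imp_le)
  ultimately show ?thesis by simp
qed

lemma truncate_le_enn2real: "a < \<infinity> \<Longrightarrow> truncate N a \<le> enn2real a"
  unfolding truncate_def by (intro enn2real_mono) auto

lemma truncate_quotient_tendsto_0:
  assumes "a < \<infinity>" and N: "\<And>n. 0 < N n" "(\<lambda>n. 1 / N n) \<longlonglongrightarrow> 0"
  shows "(\<lambda>n. 1 / N n * truncate (N n) a) \<longlonglongrightarrow> 0"
proof (rule tendsto_sandwich[OF _ _ tendsto_const])
  show "\<forall>\<^sub>F n in sequentially. 1 / N n * truncate (N n) a \<le> 1 / N n * enn2real a"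
    using truncate_le_enn2real[OF assms(1)] N(1)
    by (intro always_eventually allI mult_left_mono) (auto simp: less_imp_le)
  show "(\<lambda>n. 1 / N n * enn2real a) \<longlonglongrightarrow> 0" by (rule tendsto_mult_left_zero[OF N(2)])
qed (use truncate_nonneg N(1) in \<open>auto simp: less_imp_le\<close>)

lemma nn_integral_powr_tendsto_0:
  fixes u :: "nat \<Rightarrow> 'a \<Rightarrow> real"
  assumes A: "A \<in> sets M" "emeasure M A < \<infinity>" and "0 < p"
    and meas: "\<And>n. (\<lambda>x. u n x * indicator A x) \<in> borel_measurable M"
    and u: "\<And>n x. \<bar>u n x\<bar> \<le> 1" "\<And>x. x \<in> A \<Longrightarrow> (\<lambda>n. u n x) \<longlonglongrightarrow> 0"
  shows "(\<lambda>n. \<integral>\<^sup>+x\<in>A. ennreal (\<bar>u n x\<bar> powr p) \<partial>M) \<longlonglongrightarrow> 0"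
proof -
  have "(\<lambda>n. \<integral>\<^sup>+x\<in>A. ennreal (\<bar>u n x\<bar> powr p) \<partial>M) \<longlonglongrightarrow> (\<integral>\<^sup>+x. 0 \<partial>M)"
  proof (rule nn_integral_dominated_convergence[where w = "indicator A"])
    show "(\<lambda>x. ennreal (\<bar>u n x\<bar> powr p) * indicator A x) \<in> borel_measurable M" for n
    proof -
      have "(\<lambda>x. ennreal (\<bar>u n x * indicator A x\<bar> powr p)) \<in> borel_measurable M"
        using meas[of n] by measurable
      also have "(\<lambda>x. ennreal (\<bar>u n x * indicator A x\<bar> powr p)) =
          (\<lambda>x. ennreal (\<bar>u n x\<bar> powr p) * indicator A x)"
        by (auto simp: indicator_def)
      finally show ?thesis .
    qed
    show "AE x in M. ennreal (\<bar>u n x\<bar> powr p) * indicator A x \<le> indicator A x" for n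
      using u(1)[of n] \<open>0 < p\<close> by (intro AE_I2) (auto simp: indicator_def powr_le1)
    have "(\<lambda>n. ennreal (\<bar>u n x\<bar> powr p)) \<longlonglongrightarrow> ennreal 0" if "x \<in> A" for x
      using u(2)[OF that] \<open>0 < p\<close> by (intro tendsto_ennrealI tendsto_powr_0 tendsto_rabs_zero) auto
    then show "AE x in M. (\<lambda>n. ennreal (\<bar>u n x\<bar> powr p) * indicator A x) \<longlonglongrightarrow> 0"
      by (intro AE_I2) (auto simp: indicator_def)
  qed (use A in auto)
  then show ?thesis by simp
qed

lemma pe_cap_le_truncate:
  fixes U :: "'a::metric_space \<Rightarrow> ennreal"
  assumes "0 < N" "(\<lambda>x. truncate N (U x) * indicator \<Omega> x) \<in> borel_measurable \<mu>"
    and g: "upper_gradient \<Omega> (\<lambda>x. truncate N (U x)) g"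
    and singular: "\<And>e. e \<in> F \<Longrightarrow> \<forall>\<^sub>F y in pe_nhds \<Omega> e. ennreal N \<le> U y"
    and finite: "(\<integral>\<^sup>+x\<in>\<Omega>. ennreal (\<bar>1 / N * truncate N (U x)\<bar> powr p) \<partial>\<mu>) +
      (\<integral>\<^sup>+x\<in>\<Omega>. epow (ennreal (1 / N) * g x) p \<partial>\<mu>) < \<infinity>"
  shows "pe_cap p \<mu> \<Omega> F \<le> (\<integral>\<^sup>+x\<in>\<Omega>. ennreal (\<bar>1 / N * truncate N (U x)\<bar> powr p) \<partial>\<mu>) +
    (\<integral>\<^sup>+x\<in>\<Omega>. epow (ennreal (1 / N) * g x) p \<partial>\<mu>)"
proof (rule pe_cap_le[OF _ _ finite])
  show "(\<lambda>x. 1 / N * truncate N (U x) * indicator \<Omega> x) \<in> borel_measurable \<mu>"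
    unfolding mult.assoc by (intro borel_measurable_times borel_measurable_const assms(2))
  show "upper_gradient \<Omega> (\<lambda>x. 1 / N * truncate N (U x)) (\<lambda>x. ennreal (1 / N) * g x)"
    using \<open>0 < N\<close> by (intro upper_gradient_cmult g) simp
  show "\<forall>\<^sub>F y in pe_nhds \<Omega> e. 1 \<le> 1 / N * truncate N (U y)" if "e \<in> F" for e
    using singular[OF that]
  proof eventually_elim
    case (elim y)
    then have "truncate N (U y) = N" using \<open>0 < N\<close> by (simp add: truncate_def min_absorb1)
    then show ?case using \<open>0 < N\<close> by simp
  qed
qed

lemma pe_cap_eq_0_if_potential:
  fixes \<mu> :: "'a::metric_space measure" and U g :: "'a \<Rightarrow> ennreal"
  assumes borel: "sets \<mu> = sets borel" and \<Omega>: "open \<Omega>" "emeasure \<mu> \<Omega> < \<infinity>" and "0 < p"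
    and U: "\<And>x. x \<in> \<Omega> \<Longrightarrow> U x < \<infinity>" "\<And>N. continuous_on \<Omega> (\<lambda>x. truncate N (U x))"
    and g: "\<And>N. upper_gradient \<Omega> (\<lambda>x. truncate N (U x)) g" "(\<integral>\<^sup>+x\<in>\<Omega>. epow (g x) p \<partial>\<mu>) < \<infinity>"
    and singular: "\<And>e N. e \<in> F \<Longrightarrow> \<forall>\<^sub>F y in pe_nhds \<Omega> e. ennreal N \<le> U y"
  shows "pe_cap p \<mu> \<Omega> F = 0"
proof -
  define N where "N n = real (Suc n)" for n
  have N: "0 < N n" "(\<lambda>n. 1 / N n) \<longlonglongrightarrow> 0" for n
    using LIMSEQ_Suc[OF lim_const_over_n[of 1]] by (auto simp: N_def)
  have meas: "(\<lambda>x. truncate N (U x) * indicator \<Omega> x) \<in> borel_measurable \<mu>" for N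
    using borel_measurable_continuous_on_indicator[OF _ U(2)] \<Omega>(1) borel
    by (simp add: mult.commute cong: measurable_cong_sets)
  define u where "u n x = 1 / N n * truncate (N n) (U x)" for n x
  have "(\<lambda>x. u n x * indicator \<Omega> x) \<in> borel_measurable \<mu>" for n
    unfolding u_def mult.assoc by (intro borel_measurable_times borel_measurable_const meas)
  moreover have "\<bar>u n x\<bar> \<le> 1" for n x
    using truncate_nonneg[of "N n"] truncate_le[of "N n"] N(1)[of n] by (simp add: u_def)
  moreover have "(\<lambda>n. u n x) \<longlonglongrightarrow> 0" if "x \<in> \<Omega>" for x
    unfolding u_def by (rule truncate_quotient_tendsto_0[OF U(1)[OF that] N])
  ultimately have u_lim: "(\<lambda>n. \<integral>\<^sup>+x\<in>\<Omega>. ennreal (\<bar>u n x\<bar> powr p) \<partial>\<mu>) \<longlonglongrightarrow> 0"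
    using \<Omega> borel \<open>0 < p\<close> by (intro nn_integral_powr_tendsto_0) auto
  have "g \<in> borel_measurable \<mu>"
    using g(1) borel by (simp add: upper_gradient_def cong: measurable_cong_sets)
  then have g_lim: "(\<lambda>n. \<integral>\<^sup>+x\<in>\<Omega>. epow (ennreal (1 / N n) * g x) p \<partial>\<mu>) \<longlonglongrightarrow> 0"
    using g(2) \<Omega>(1) borel \<open>0 < p\<close> N by (intro nn_integral_epow_cmult_tendsto_0) auto
  let ?a = "\<lambda>n. (\<integral>\<^sup>+x\<in>\<Omega>. ennreal (\<bar>u n x\<bar> powr p) \<partial>\<mu>) +
    (\<integral>\<^sup>+x\<in>\<Omega>. epow (ennreal (1 / N n) * g x) p \<partial>\<mu>)"
  have lim: "?a \<longlonglongrightarrow> 0" using tendsto_add[OF u_lim g_lim] by simp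
  have "\<forall>\<^sub>F n in sequentially. ?a n < \<infinity>" using order_tendstoD(2)[OF lim, of top] by simp
  then have "\<forall>\<^sub>F n in sequentially. pe_cap p \<mu> \<Omega> F \<le> ?a n"
    unfolding u_def by eventually_elim (rule pe_cap_le_truncate[OF N(1) meas g(1) singular])
  then have "pe_cap p \<mu> \<Omega> F \<le> 0" by (intro tendsto_lowerbound[OF lim]) auto
  then show ?thesis by simp
qed

lemma (in weighted_domain) pe_cap_inaccessible_eq_0_if_integrable:
  assumes borel: "sets \<mu> = sets borel" and "emeasure \<mu> \<Omega> < \<infinity>" and "0 < p"
    and h: "(\<integral>\<^sup>+x\<in>\<Omega>. epow (h (bdist x)) p \<partial>\<mu>) < \<infinity>"
  shows "pe_cap p \<mu> \<Omega> (prime_ends \<Omega> - rect_accessible_prime_ends \<Omega>) = 0"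
proof (rule pe_cap_eq_0_if_potential[where U = potential and g = "\<lambda>x. ennreal C * h (bdist x)"])
  have [measurable]: "\<Omega> \<in> sets \<mu>" "h \<in> borel_measurable borel" "bdist \<in> borel_measurable \<mu>"
    using open_domain h_borel bdist_borel borel by (auto cong: measurable_cong_sets)
  have "(\<integral>\<^sup>+x\<in>\<Omega>. epow (ennreal C * h (bdist x)) p \<partial>\<mu>) =
      ennreal (C powr p) * (\<integral>\<^sup>+x\<in>\<Omega>. epow (h (bdist x)) p \<partial>\<mu>)"
    using C_ge_1 by (simp add: epow_cmult mult.assoc nn_integral_cmult)
  then show "(\<integral>\<^sup>+x\<in>\<Omega>. epow (ennreal C * h (bdist x)) p \<partial>\<mu>) < \<infinity>"
    using h by (simp add: ennreal_mult_less_top)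
qed (use assms open_domain potential_finite continuous_on_truncate_potential
    upper_gradient_truncate_potential potential_tends_to_top in auto)

lemma (in bounded_domain) pe_cap_inaccessible_eq_0:
  assumes borel: "sets \<mu> = sets borel" and fin: "emeasure \<mu> \<Omega> < \<infinity>" and p: "0 < p" and "\<Omega> \<noteq> {}"
  shows "pe_cap p \<mu> \<Omega> (prime_ends \<Omega> - rect_accessible_prime_ends \<Omega>) = 0"
proof -
  obtain x0 where x0: "x0 \<in> \<Omega>" using \<open>\<Omega> \<noteq> {}\<close> by blast
  have meas: "\<Omega> \<in> sets \<mu>" using open_domain borel by auto
  have bdist: "bdist \<in> borel_measurable \<mu>" using bdist_borel borel by (simp cong: measurable_cong_sets)
  have pos: "0 < bdist x" if "x \<in> \<Omega>" for x using that by (simp add: mem_iff_bdist_pos)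
  obtain h where h: "singular_weight h" "(\<integral>\<^sup>+x\<in>\<Omega>. epow (h (bdist x)) p \<partial>\<mu>) < \<infinity>"
    using singular_weight_exists[OF meas bdist fin pos p] by blast
  interpret weighted_domain \<Omega> C h x0
    by (intro weighted_domain.intro weighted_domain_axioms.intro bounded_domain_axioms h(1) x0)
  show ?thesis by (rule pe_cap_inaccessible_eq_0_if_integrable[OF borel fin p h(2)])
qed

theorem theorem3p3:
  fixes \<mu> :: "'a::complete_space measure" and p :: real and \<Omega> :: "'a set"
  assumes "1 < p"
    and "doubling_measure \<mu>"
    and "poincare p \<mu>"
    and "open \<Omega>" and "connected \<Omega>" and "\<Omega> \<noteq> {}" and "bounded \<Omega>" and "\<Omega> \<noteq> UNIV"
    and "sobolev_cap p \<mu> (UNIV - \<Omega>) > 0"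
    and "ends_chains_bounded \<Omega>"
  shows "pe_cap p \<mu> \<Omega> (prime_ends \<Omega> - rect_accessible_prime_ends \<Omega>) = 0"
proof -
  obtain D where D: "doubling_space \<mu> D"
    using doubling_measure_imp_doubling_space[OF assms(2)] by blast
  then interpret doubling_space \<mu> D .
  obtain C where C: "1 \<le> C" "\<And>x y :: 'a. lip_joined UNIV (C * dist x y) x y"
    using poincare_quasiconvex[OF D assms(3)] by blast
  interpret bounded_domain \<Omega> C
    using C assms(4,5,7,8) doubling_space_compact[OF D] by unfold_locales auto
  show ?thesis
    using pe_cap_inaccessible_eq_0[OF sets_eq_borel emeasure_bounded_finite[OF assms(7)]] assms(1,6) by simp
qed

end
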